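(* Let $(X,f)$ be a uniquely ergodic minimal dynamical system on a connected space $X$. Suppose that $(X,f)$ belongs to one of the following two classes: (I) $(X,f)$ is not totally uniquely ergodic; (II) $(X,f)$ is totally uniquely ergodic but not topologically weakly mixing. Then there exist $m\geq 2$ and a non-uniform $A\in C(X,\mathrm{GL}(m))$.
   Context: A dynamical system $(X,f)$ is a compact metric space $X$ together with a homeomorphism $f:X\to X$. It is minimal if for every $x\in X$ the forward orbit $\{f^i x: i\in\mathbb{N}\}$ is dense in $X$ ($\mathbb{N}$ includes $0$, $\mathbb{N}^+$ denotes the positive integers). It is uniquely ergodic if there is exactly one $f$-invariant Borel probability measure on $X$. It is totally uniquely ergodic if it is uniquely ergodic with unique invariant measure $\mu$ and, for every $n\in\mathbb{N}^+$, $\mu$ is the unique $f^n$-invariant Borel probability measure on $X$. It is topologically transitive if for all non-empty open $U,V\subset X$ there is $k\in\mathbb{N}^+$ with $f^k(U)\cap V\neq\emptyset$; it is topologically weakly mixing if $(X\times X,f\times f)$ is topologically transitive. $\mathrm{GL}(m)$ is the set of invertible real $m\times m$ matrices and $C(X,\mathrm{GL}(m))$ is the set of continuous maps $X\to\mathrm{GL}(m)$. For $A\in C(X,\mathrm{GL}(m))$ and $n\geq1$ put $A(n,x)=A(f^{n-1}x)A(f^{n-2}x)\cdots A(x)$. $A$ is uniform if $\frac1n\log\|A(n,x)\|$ converges uniformly on $X$ as $n\to\infty$ (this does not depend on the choice of matrix norm), and non-uniform otherwise. *)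

theory Defs
  imports "HOL-Probability.Probability" "Jordan_Normal_Form.Matrix"
begin

definition dynamical_system :: "'a::metric_space set \<Rightarrow> ('a \<Rightarrow> 'a) \<Rightarrow> bool" where
  "dynamical_system X f \<longleftrightarrow> compact X \<and> (\<exists>g. homeomorphism X X f g)"

definition minimal_system :: "'a::topological_space set \<Rightarrow> ('a \<Rightarrow> 'a) \<Rightarrow> bool" where
  "minimal_system X f \<longleftrightarrow> (\<forall>x\<in>X. X \<subseteq> closure (range (\<lambda>i. (f ^^ i) x)))"

(* restrict_space borel X is the Borel sigma-algebra of the subspace X. A continuous self-map of X
   is measurable for it, so distr M M f is the push-forward of M under f. *)
definition invariant_prob_measures ::
    "'a::topological_space set \<Rightarrow> ('a \<Rightarrow> 'a) \<Rightarrow> 'a measure set" where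
  "invariant_prob_measures X f =
    {M. prob_space M \<and> sets M = sets (restrict_space borel X) \<and> distr M M f = M}"

definition uniquely_ergodic :: "'a::topological_space set \<Rightarrow> ('a \<Rightarrow> 'a) \<Rightarrow> bool" where
  "uniquely_ergodic X f \<longleftrightarrow> (\<exists>!M. M \<in> invariant_prob_measures X f)"

definition totally_uniquely_ergodic :: "'a::topological_space set \<Rightarrow> ('a \<Rightarrow> 'a) \<Rightarrow> bool" where
  "totally_uniquely_ergodic X f \<longleftrightarrow>
    (\<exists>M. invariant_prob_measures X f = {M} \<and>
         (\<forall>n\<ge>1. invariant_prob_measures X (f ^^ n) = {M}))"

definition topologically_transitive :: "'a::topological_space set \<Rightarrow> ('a \<Rightarrow> 'a) \<Rightarrow> bool" where
  "topologically_transitive X f \<longleftrightarrow>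
    (\<forall>U V. openin (top_of_set X) U \<and> U \<noteq> {} \<and> openin (top_of_set X) V \<and> V \<noteq> {} \<longrightarrow>
      (\<exists>k\<ge>1. (f ^^ k) ` U \<inter> V \<noteq> {}))"

definition topologically_weakly_mixing :: "'a::topological_space set \<Rightarrow> ('a \<Rightarrow> 'a) \<Rightarrow> bool" where
  "topologically_weakly_mixing X f \<longleftrightarrow> topologically_transitive (X \<times> X) (map_prod f f)"

definition GL :: "nat \<Rightarrow> real mat set" where
  "GL m = {B \<in> carrier_mat m m. invertible_mat B}"

(* The type of matrices of all sizes carries no topology; on the m x m matrices, continuity for
   the topology of R^(m*m) is continuity of every entry. *)
definition continuous_GL :: "'a::topological_space set \<Rightarrow> nat \<Rightarrow> ('a \<Rightarrow> real mat) set" where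
  "continuous_GL X m =
    {A. (\<forall>x\<in>X. A x \<in> GL m) \<and> (\<forall>i<m. \<forall>j<m. continuous_on X (\<lambda>x. A x $$ (i, j)))}"

(* A(n,x) = A(f^(n-1) x) ... A(f x) A(x) *)
primrec cocycle :: "nat \<Rightarrow> ('a \<Rightarrow> 'a) \<Rightarrow> ('a \<Rightarrow> real mat) \<Rightarrow> nat \<Rightarrow> 'a \<Rightarrow> real mat" where
  "cocycle m f A 0 x = 1\<^sub>m m"
| "cocycle m f A (Suc n) x = A ((f ^^ n) x) * cocycle m f A n x"

(* Sum of the absolute values of the entries, a submultiplicative norm on the m x m matrices.
   Any other norm changes ln (norm (A(n,x))) / n by O(1/n) uniformly in x, so the notion of
   uniformity below does not depend on this choice. *)
definition mat_norm :: "real mat \<Rightarrow> real" where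
  "mat_norm B = (\<Sum>i<dim_row B. \<Sum>j<dim_col B. \<bar>B $$ (i, j)\<bar>)"

definition uniform_cocycle ::
    "'a::topological_space set \<Rightarrow> ('a \<Rightarrow> 'a) \<Rightarrow> nat \<Rightarrow> ('a \<Rightarrow> real mat) \<Rightarrow> bool" where
  "uniform_cocycle X f m A \<longleftrightarrow>
    uniformly_convergent_on X (\<lambda>n x. 1 / real n * ln (mat_norm (cocycle m f A n x)))"

end

(* Both classes are handled by producing a cocycle whose growth rate would have to be constant on X
   if it were uniform, and is not.

   Class II. If no iterate of f x f carries U into V, let W be the open set of pairs that visit V.
   The measures of the differences of the sections of W define a continuous f-invariant
   pseudometric on X. Almost periodicity together with a Parseval argument then gives a continuous
   eigenfunction h with eigenvalue l, l not 1; by connectedness h maps onto the unit circle. Over h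
   one takes Herman's cocycle, a hyperbolic matrix times the rotation by the argument of h. Its norm
   is exponentially large somewhere by the maximum principle, but for every n it is bounded at some
   point at time n or n + 1, because otherwise a winding number would have to equal itself plus two.

   Class I. Let nu be invariant under f^n but not under f. A Fourier coefficient on Z/n of a test
   function gives psi, with nonzero nu-integral, whose averages g_K along f^n satisfy
   g_K(f x) = w g_K(x) + O(1/K) for an n-th root of unity w, w not 1. A cyclic permutation matrix
   with one exponential weight has growth rate max_i Re(conj z0 w^i g_K(x)). If this is uniform and
   z0 is a limit of values of g_K of maximal modulus, then g_K(X) is close to the finite set of all
   w^i z0, hence by connectedness to a single point, contradicting the rotation by w. *)

theory Submission
  imports Defs "HOL-Complex_Analysis.Complex_Analysis" "HOL-Real_Asymp.Real_Asymp"
begin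

text \<open>Uniformity is exploited through minimality: a uniform limit of the rates is continuous,
  and moving the base point from \<open>x\<close> to \<open>f x\<close> changes the norms by bounded
  factors only, so the limit is invariant, hence constant.

  The map \<open>v \<mapsto> 5/4 v + 3/4 (cnj v)\<close> stretches the real axis by 2 and shrinks
  the imaginary axis by 1/2. Its determinant is \<open>(5/4)^2 - (3/4)^2 = 1\<close>, and the
  coefficient \<open>5/4 > 1\<close> is the source of the exponential growth.

  An eigenfunction in L2 would not do for class II, since the cocycle over it has to be continuous.
  This is why the failure of weak mixing is first turned into a continuous pseudometric: exponential
  sums that are Lipschitz for it are equicontinuous, and continuity survives the limit.

  In class I the matrices have to be fixed before K tends to infinity, while the extremal values of
  g_K move with K. Hence z0 is a limit along a subsequence, and the constant rate is identified
  along that subsequence. The nonzero integral of psi keeps z0 away from 0.\<close>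

subsection \<open>Herman's cocycle over a rotation\<close>

text \<open>The \<open>n\<close>-th iterate at \<open>z\<close> of the cocycle \<open>v \<mapsto> 5/4 z v + 3/4 cnj (z v)\<close> over the rotation by \<open>l\<close>
  is the real-linear map \<open>v \<mapsto> P v + Q (cnj v)\<close> of the complex plane.\<close>

fun rot_P :: "complex \<Rightarrow> nat \<Rightarrow> complex \<Rightarrow> complex"
  and rot_Q :: "complex \<Rightarrow> nat \<Rightarrow> complex \<Rightarrow> complex" where
  "rot_P l 0 z = 1"
| "rot_Q l 0 z = 0"
| "rot_P l (Suc n) z = 5/4 * (l ^ n * z) * rot_P l n z + 3/4 * cnj (l ^ n * z) * cnj (rot_Q l n z)"
| "rot_Q l (Suc n) z = 5/4 * (l ^ n * z) * rot_Q l n z + 3/4 * cnj (l ^ n * z) * cnj (rot_P l n z)"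

lemma cnj_mult_unit: "norm z = 1 \<Longrightarrow> z * cnj z = 1" "norm z = 1 \<Longrightarrow> cnj z * z = 1"
  by (simp_all add: complex_norm_square[symmetric] mult.commute[of "cnj z"])

text \<open>\<open>|P|^2 - |Q|^2\<close> is the determinant of
  \<open>v \<mapsto> P v + Q (cnj v)\<close>, and every factor of the product has determinant
  1.\<close>

lemma rot_det:
  assumes "norm l = 1" "norm z = 1"
  shows "rot_P l n z * cnj (rot_P l n z) - rot_Q l n z * cnj (rot_Q l n z) = 1"
proof (induction n)
  case (Suc n)
  define w where "w = l ^ n * z"
  have w: "w * cnj w = 1"
    using assms by (intro cnj_mult_unit) (simp add: w_def norm_mult norm_power)
  \<comment> \<open>A polynomial identity in which \<open>p'\<close> and \<open>q'\<close> stand for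
    the conjugates of \<open>p\<close> and \<open>q\<close>, so that ring normalization
    suffices.\<close>
  have gen: "(a * w * p + b * cnj w * q') * (a * cnj w * p' + b * w * q)
      - (a * w * q + b * cnj w * p') * (a * cnj w * q' + b * w * p)
     = (a * a - b * b) * ((w * cnj w) * (p * p' - q * q'))" for a b p q p' q'
    by (simp add: algebra_simps)
  have "rot_P l (Suc n) z * cnj (rot_P l (Suc n) z) - rot_Q l (Suc n) z * cnj (rot_Q l (Suc n) z)
     = (5/4 * (5/4) - 3/4 * (3/4)) * ((w * cnj w) * (rot_P l n z * cnj (rot_P l n z) - rot_Q l n z * cnj (rot_Q l n z)))"
    unfolding rot_P.simps rot_Q.simps w_def[symmetric] gen[symmetric] by simp
  then show ?case unfolding Suc w by simp
qed simp

lemma rot_norm: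
  assumes "norm l = 1" "norm z = 1"
  shows "(norm (rot_P l n z))\<^sup>2 = (norm (rot_Q l n z))\<^sup>2 + 1"
proof -
  have "complex_of_real ((norm (rot_P l n z))\<^sup>2 - (norm (rot_Q l n z))\<^sup>2) = complex_of_real 1"
    using rot_det[OF assms, of n]
    by (simp only: of_real_diff of_real_power complex_norm_square[symmetric] of_real_1)
  then have "(norm (rot_P l n z))\<^sup>2 - (norm (rot_Q l n z))\<^sup>2 = 1" by (simp only: of_real_eq_iff)
  then show ?thesis by simp
qed

lemma rot_P_ge_1: "norm l = 1 \<Longrightarrow> norm z = 1 \<Longrightarrow> 1 \<le> norm (rot_P l n z)"
  using rot_norm[of l z n] by (auto intro: power2_le_imp_le)

lemma rot_Q_le: "norm l = 1 \<Longrightarrow> norm z = 1 \<Longrightarrow> norm (rot_Q l n z) \<le> norm (rot_P l n z)"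
  using rot_norm[of l z n] by (auto intro: power2_le_imp_le)

text \<open>The defining recursion splits off the last factor of the product; here the first one, at
  \<open>z\<close> itself, is split off. This links time \<open>n + 1\<close> at \<open>z\<close> to
  time \<open>n\<close> at \<open>l * z\<close> and is the source of the factor
  \<open>z\<^sup>2\<close> in the winding argument.\<close>

lemma rot_right:
  "rot_P l (Suc n) z = z * (5/4 * rot_P l n (l * z) + 3/4 * rot_Q l n (l * z))"
  "rot_Q l (Suc n) z = cnj z * (3/4 * rot_P l n (l * z) + 5/4 * rot_Q l n (l * z))"
proof (induction n)
  case (Suc n)
  define a b where "a = (5/4 :: complex)" and "b = (3/4 :: complex)"
  have ab: "cnj a = a" "cnj b = b" by (simp_all add: a_def b_def)
  note defs = rot_P.simps(2) rot_Q.simps(2)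
  show "rot_P l (Suc (Suc n)) z = z * (5/4 * rot_P l (Suc n) (l * z) + 3/4 * rot_Q l (Suc n) (l * z))"
    unfolding defs(1)[of l "Suc n"] Suc unfolding defs a_def[symmetric] b_def[symmetric]
    by (simp add: algebra_simps ab)
  show "rot_Q l (Suc (Suc n)) z = cnj z * (3/4 * rot_P l (Suc n) (l * z) + 5/4 * rot_Q l (Suc n) (l * z))"
    unfolding defs(2)[of l "Suc n"] Suc unfolding defs a_def[symmetric] b_def[symmetric]
    by (simp add: algebra_simps ab)
qed simp_all

text \<open>The left side is the numerator of the difference of the quotients \<open>P / Q\<close>
  at times \<open>n\<close> and \<open>n + 1\<close>. Determinant 1 keeps it bounded however large
  \<open>P\<close> and \<open>Q\<close> are.\<close>

lemma rot_wronskian: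
  assumes "norm l = 1" "norm z = 1"
  shows "rot_P l n z * rot_Q l (Suc n) z - rot_P l (Suc n) z * rot_Q l n z = 3/4 * cnj (l ^ n * z)"
proof -
  have gen: "p * (a * w * q + b * p') - (a * w * p + b * q') * q = b * (p * p' - q * q')"
    for a b p q p' q' w :: complex
    by (simp add: algebra_simps)
  show ?thesis unfolding rot_P.simps rot_Q.simps gen rot_det[OF assms] by simp
qed

text \<open>One more factor on either side changes the modulus of \<open>P\<close> by a factor
  between \<open>5/4 - 3/4 = 1/2\<close> and \<open>5/4 + 3/4 = 2\<close>, because
  \<open>|Q| \<le> |P|\<close>. Both values are therefore within a factor 2 of the modulus at time
  \<open>n + 1\<close> and point \<open>z\<close>.\<close>

lemma rot_shift_bounds:
  assumes "norm l = 1" "norm z = 1"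
  shows "norm (rot_P l n (l * z)) \<le> 4 * norm (rot_P l n z)"
    "norm (rot_P l n z) \<le> 4 * norm (rot_P l n (l * z))"
proof -
  have lz: "norm (l * z) = 1" using assms by (simp add: norm_mult)
  let ?p = "norm (rot_P l n z)" and ?p' = "norm (rot_P l n (l * z))" and ?s = "norm (rot_P l (Suc n) z)"
  have ln: "norm (l ^ n * z) = 1" using assms by (simp add: norm_mult norm_power)
  have a1: "norm (5/4 * (l ^ n * z) * rot_P l n z) = 5/4 * ?p"
    unfolding norm_mult[of _ "rot_P l n z"] norm_mult[of _ "l ^ n * z"] ln by simp
  have a2: "norm (3/4 * cnj (l ^ n * z) * cnj (rot_Q l n z)) \<le> 3/4 * ?p"
    unfolding norm_mult[of _ "cnj (rot_Q l n z)"] norm_mult[of _ "cnj (l ^ n * z)"] complex_mod_cnj ln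
    using rot_Q_le[OF assms, of n] by simp
  have b1: "?s \<le> 2 * ?p"
    unfolding rot_P.simps(2) using a1 a2 norm_triangle_ineq[of "5/4 * (l ^ n * z) * rot_P l n z" "3/4 * cnj (l ^ n * z) * cnj (rot_Q l n z)"] by linarith
  have b2: "?s \<ge> ?p / 2"
    unfolding rot_P.simps(2) using a1 a2 norm_diff_ineq[of "5/4 * (l ^ n * z) * rot_P l n z" "3/4 * cnj (l ^ n * z) * cnj (rot_Q l n z)"] by linarith
  have a3: "norm (5/4 * rot_P l n (l * z)) = 5/4 * ?p'" by (simp add: norm_mult)
  have a4: "norm (3/4 * rot_Q l n (l * z)) \<le> 3/4 * ?p'"
    using rot_Q_le[OF assms(1) lz, of n] by (simp add: norm_mult)
  have e: "?s = norm (5/4 * rot_P l n (l * z) + 3/4 * rot_Q l n (l * z))"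
    unfolding rot_right norm_mult using assms by simp
  have b3: "?s \<le> 2 * ?p'"
    unfolding e using a3 a4 norm_triangle_ineq[of "5/4 * rot_P l n (l * z)" "3/4 * rot_Q l n (l * z)"] by linarith
  have b4: "?s \<ge> ?p' / 2"
    unfolding e using a3 a4 norm_diff_ineq[of "5/4 * rot_P l n (l * z)" "3/4 * rot_Q l n (l * z)"] by linarith
  show "?p' \<le> 4 * ?p" "?p \<le> 4 * ?p'" using b1 b2 b3 b4 by linarith+
qed

lemma continuous_on_rot [continuous_intros]:
  assumes "continuous_on S g"
  shows "continuous_on S (\<lambda>x. rot_P l n (g x))" "continuous_on S (\<lambda>x. rot_Q l n (g x))"
proof (induction n)
  case (Suc n)
  {
    case 1
    show ?case unfolding rot_P.simps by (intro continuous_intros assms Suc)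
  next
    case 2
    show ?case unfolding rot_Q.simps by (intro continuous_intros assms Suc)
  }
qed simp_all

text \<open>On the unit circle \<open>z\<^sup>-\<^sup>n P\<^sub>n(z)\<close> is a polynomial in \<open>z\<^sup>-\<^sup>2\<close>, whose constant term has modulus \<open>(5/4)\<^sup>n\<close>.\<close>

fun rot_p :: "complex \<Rightarrow> nat \<Rightarrow> complex \<Rightarrow> complex"
  and rot_q :: "complex \<Rightarrow> nat \<Rightarrow> complex \<Rightarrow> complex" where
  "rot_p l 0 w = 1"
| "rot_q l 0 w = 0"
| "rot_p l (Suc n) w = 5/4 * l ^ n * rot_p l n w + 3/4 * cnj l ^ n * w * rot_q l n w"
| "rot_q l (Suc n) w = 5/4 * cnj l ^ n * w * rot_q l n w + 3/4 * l ^ n * rot_p l n w"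

text \<open>On the circle \<open>cnj z = z * w\<close>, so each factor of the product contributes
  one \<open>z\<close>, and conjugates of \<open>z\<close> are absorbed into \<open>w\<close>. What
  remains is polynomial in \<open>w\<close> and makes sense on the whole disc.\<close>

lemma rot_p_eq:
  assumes "norm z = 1" "w = cnj z ^ 2"
  shows "rot_P l n z = z ^ n * rot_p l n w \<and> cnj (rot_Q l n z) = z ^ n * rot_q l n w"
proof (induction n)
  case (Suc n)
  have c: "cnj z = z * w"
  proof -
    have "z * w = (z * cnj z) * cnj z" unfolding assms(2) power2_eq_square by (simp only: mult.assoc)
    then show ?thesis using cnj_mult_unit(1)[OF assms(1)] by simp
  qed
  have "rot_P l (Suc n) z = z ^ Suc n * rot_p l (Suc n) w"
    unfolding rot_P.simps rot_p.simps complex_cnj_mult c using Suc by (simp add: algebra_simps)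
  moreover have "cnj (rot_Q l (Suc n) z) = z ^ Suc n * rot_q l (Suc n) w"
    unfolding rot_Q.simps rot_q.simps complex_cnj_mult complex_cnj_add complex_cnj_cnj
    unfolding c using Suc by (simp add: algebra_simps)
  ultimately show ?case by blast
qed simp

lemma holomorphic_rot_p: "rot_p l n holomorphic_on S \<and> rot_q l n holomorphic_on S"
proof (induction n)
  case 0
  have "rot_p l 0 = (\<lambda>_. 1)" "rot_q l 0 = (\<lambda>_. 0)" by auto
  then show ?case by simp
next
  case (Suc n)
  have eqs: "rot_p l (Suc n) = (\<lambda>w. 5/4 * l ^ n * rot_p l n w + 3/4 * cnj l ^ n * w * rot_q l n w)"
       "rot_q l (Suc n) = (\<lambda>w. 5/4 * cnj l ^ n * w * rot_q l n w + 3/4 * l ^ n * rot_p l n w)" by auto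
  show ?case
    unfolding eqs by (intro conjI holomorphic_intros Suc[THEN conjunct1] Suc[THEN conjunct2])
qed

lemma rot_p_0: "norm l = 1 \<Longrightarrow> norm (rot_p l n 0) = (5/4) ^ n"
proof (induction n)
  case (Suc n)
  have "rot_p l (Suc n) 0 = 5/4 * l ^ n * rot_p l n 0" by simp
  then show ?case using Suc by (simp only: norm_mult norm_power) simp
qed simp

lemma rot_P_large:
  assumes "norm l = 1"
  obtains z where "norm z = 1" "(5/4) ^ n \<le> norm (rot_P l n z)"
proof -
  have "\<exists>w. norm w = 1 \<and> (5/4) ^ n \<le> norm (rot_p l n w)"
  proof (rule ccontr)
    assume "\<not> ?thesis"
    then have less: "norm (rot_p l n w) < (5/4) ^ n" if "w \<in> sphere 0 1" for w
      using that by (meson mem_sphere_0 not_le)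
    have cont: "continuous_on (cball 0 1) (rot_p l n)"
      using holomorphic_rot_p holomorphic_on_imp_continuous_on by blast
    have "continuous_on (sphere 0 1) (\<lambda>w. norm (rot_p l n w))"
      by (intro continuous_intros continuous_on_subset[OF cont]) auto
    then obtain w0 where w0: "w0 \<in> sphere 0 1" "\<And>w. w \<in> sphere 0 1 \<Longrightarrow> norm (rot_p l n w) \<le> norm (rot_p l n w0)"
      using continuous_attains_sup[of "sphere (0::complex) 1" "\<lambda>w. norm (rot_p l n w)"] by auto
    have "norm (rot_p l n 0) \<le> norm (rot_p l n w0)"
    proof (rule maximum_modulus_frontier[of "rot_p l n" "cball 0 1"])
      show "rot_p l n holomorphic_on interior (cball 0 1)" using holomorphic_rot_p by blast
      show "continuous_on (closure (cball 0 1)) (rot_p l n)" using cont by simp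
      show "norm (rot_p l n z) \<le> norm (rot_p l n w0)" if "z \<in> frontier (cball 0 1)" for z
        using that w0(2) by (simp add: frontier_cball)
    qed auto
    with less[OF w0(1)] rot_p_0[OF assms, of n] show False by simp
  qed
  then obtain w where w: "norm w = 1" "(5/4) ^ n \<le> norm (rot_p l n w)" by blast
  define z where "z = cnj (csqrt w)"
  have z: "norm z = 1" "w = cnj z ^ 2" using w(1) by (simp_all add: z_def norm_mult)
  have "norm (rot_P l n z) = norm (rot_p l n w)"
    using rot_p_eq[OF z, of l n] z(1) by (simp add: norm_mult norm_power)
  with w(2) z(1) show ?thesis using that by metis
qed

declare rot_P.simps [simp del] rot_Q.simps [simp del]

section \<open>Winding numbers and times of bounded norm\<close>

lemma sub_unit_nonzero:
  fixes u :: complex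
  assumes "norm u < 1"
  shows "1 + u \<noteq> 0"
proof
  assume "1 + u = 0"
  then have "norm (- u) = 1" by (metis add_eq_0_iff2 norm_one)
  with assms show False by simp
qed

lemma sub_unit_not_nonpos:
  fixes u :: complex
  assumes "norm u < 1"
  shows "1 + u \<notin> \<real>\<^sub>\<le>\<^sub>0"
proof
  assume "1 + u \<in> \<real>\<^sub>\<le>\<^sub>0"
  then have "Re (1 + u) \<le> 0" by (simp add: complex_nonpos_Reals_iff)
  then show False using abs_Re_le_cmod[of u] assms by simp
qed

text \<open>Two logarithms of the same number are equal or at least \<open>2 * pi\<close> apart, so
  the range of \<open>F\<close> is discrete.\<close>

lemma exp_constant_on:
  fixes F :: "'a::topological_space \<Rightarrow> complex"
  assumes "connected S" "continuous_on S F" and exp: "\<And>x. x \<in> S \<Longrightarrow> exp (F x) = w"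
  shows "F constant_on S"
proof (rule continuous_discrete_range_constant[OF assms(1,2)])
  fix x assume x: "x \<in> S"
  have "2 * pi \<le> norm (F y - F x)" if "y \<in> S" "F y \<noteq> F x" for y
  proof -
    from exp x that(1) have "exp (F y) = exp (F x)" by simp
    then obtain k :: int where k: "F y = F x + (of_int (2 * k) * pi) * \<i>" unfolding exp_eq by blast
    with that(2) have "1 \<le> \<bar>real_of_int k\<bar>" by (cases "k = 0") auto
    then show ?thesis unfolding k by (simp add: norm_mult abs_mult)
  qed
  then show "\<exists>e>0. \<forall>y. y \<in> S \<and> F y \<noteq> F x \<longrightarrow> e \<le> norm (F y - F x)"
    by (intro exI[of _ "2 * pi"]) auto
qed

text \<open>If both \<open>P\<close>'s are at least 2 in modulus on the whole circle, then \<open>r = P / Q\<close> at time \<open>n\<close> has a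
  continuous logarithm along the circle, \<open>r\<close> at time \<open>n + 1\<close> has relative distance less than 1 from it, and on
  the other hand has winding number larger by 2, because of the factor \<open>z\<^sup>2\<close> in \<open>rec\<close>.\<close>

lemma rot_P_small:
  assumes l: "norm l = 1"
  shows "\<exists>z. norm z = 1 \<and> (norm (rot_P l n z) < 2 \<or> norm (rot_P l (Suc n) z) < 2)"
proof (rule ccontr)
  assume "\<not> ?thesis"
  then have big: "2 \<le> norm (rot_P l n z)" "2 \<le> norm (rot_P l (Suc n) z)" if "norm z = 1" for z
    using that by (meson not_le)+
  define \<beta> where "\<beta> = Arg l"
  have \<beta>: "l = cis \<beta>"
    using rcis_cmod_Arg[of l] l by (simp add: rcis_def \<beta>_def)
  have Qbig: "1 < norm (rot_Q l n z)" "1 < norm (rot_Q l (Suc n) z)" if "norm z = 1" for z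
  proof -
    have *: "1 < norm (rot_Q l m z)" if "2 \<le> norm (rot_P l m z)" for m
    proof -
      have "2\<^sup>2 \<le> (norm (rot_P l m z))\<^sup>2" using that by (intro power_mono) auto
      then have "1\<^sup>2 < (norm (rot_Q l m z))\<^sup>2" using rot_norm[OF l \<open>norm z = 1\<close>, of m] by simp
      then show ?thesis by (rule power2_less_imp_less) simp
    qed
    show "1 < norm (rot_Q l n z)" "1 < norm (rot_Q l (Suc n) z)" using * big[OF that] by blast+
  qed
  define r where "r m z = rot_P l m z / rot_Q l m z" for m z
  have r0: "r n z \<noteq> 0" if "norm z = 1" for z
    using big(1)[OF that] Qbig(1)[OF that] by (auto simp: r_def)
  have r1: "1 \<le> norm (r n z)" if "norm z = 1" for z
  proof -
    have "0 < norm (rot_Q l n z)" using Qbig(1)[OF that] by linarith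
    then show ?thesis using rot_Q_le[OF l that, of n] by (simp add: r_def norm_divide pos_le_divide_eq)
  qed
  \<comment> \<open>The bound 5/3 is the reciprocal of the 3/5 in \<open>rec\<close>. Together with
    the lower bound 1 it makes both \<open>3/5 * r\<close> and \<open>3/5 / r\<close> smaller than 1
    in modulus, so that the principal logarithm is continuous on the correction factors.\<close>
  have r2: "norm (r n z) < 5/3" if "norm z = 1" for z
  proof -
    let ?p = "norm (rot_P l n z)" and ?q = "norm (rot_Q l n z)"
    have "2\<^sup>2 \<le> ?p\<^sup>2" using big(1)[OF that] by (intro power_mono) auto
    then have "(3 * ?p)\<^sup>2 < (5 * ?q)\<^sup>2"
      using rot_norm[OF l that, of n] by (simp add: power_mult_distrib)
    then have "3 * ?p < 5 * ?q" by (rule power2_less_imp_less) simp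
    moreover have "0 < ?q" using Qbig(1)[OF that] by linarith
    ultimately show ?thesis by (simp add: r_def norm_divide pos_divide_less_eq)
  qed
  define d where "d z = r (Suc n) z / r n z - 1" for z
  have d: "norm (d z) < 1" if "norm z = 1" for z
  proof -
    have nz: "rot_Q l (Suc n) z \<noteq> 0" "rot_P l n z \<noteq> 0" "rot_Q l n z \<noteq> 0"
      using Qbig[OF that] big(1)[OF that] by auto
    have gen: "(p' / q') / (p / q) - 1 = - (p * q' - p' * q) / (q' * p)"
      if "q \<noteq> 0" "p \<noteq> 0" "q' \<noteq> 0" for p q p' q' :: complex
      using that by (simp add: field_simps)
    have "d z = - (rot_P l n z * rot_Q l (Suc n) z - rot_P l (Suc n) z * rot_Q l n z) / (rot_Q l (Suc n) z * rot_P l n z)"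
      unfolding d_def r_def using gen[OF nz(3,2,1)] .
    also have "\<dots> = - (3/4 * cnj (l ^ n * z)) / (rot_Q l (Suc n) z * rot_P l n z)"
      unfolding rot_wronskian[OF l that] ..
    finally have "norm (d z) = 3/4 / (norm (rot_Q l (Suc n) z) * norm (rot_P l n z))"
      using l that by (simp only: norm_divide norm_minus_cancel norm_mult complex_mod_cnj norm_power) simp
    also have "\<dots> < 1"
    proof -
      have "1 * 2 \<le> norm (rot_Q l (Suc n) z) * norm (rot_P l n z)"
        using Qbig(2)[OF that] big(1)[OF that] by (intro mult_mono) auto
      then show ?thesis by (simp add: divide_simps)
    qed
    finally show ?thesis .
  qed
  have lz: "norm (l * z) = 1" if "norm z = 1" for z using that l by (simp add: norm_mult)
  have rec: "r (Suc n) z = z\<^sup>2 * r n (l * z) * (1 + 3/5 / r n (l * z)) / (1 + 3/5 * r n (l * z))" if z: "norm z = 1" for z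
  proof -
    have z0: "z \<noteq> 0" using z by auto
    have c: "cnj z = 1 / z" using cnj_mult_unit(2)[OF z] z0 by (simp add: nonzero_eq_divide_eq)
    have Q0: "rot_Q l n (l * z) \<noteq> 0" "rot_P l n (l * z) \<noteq> 0" using Qbig(1)[OF lz[OF z]] big(1)[OF lz[OF z]] by auto
    have gen: "z * (5/4 * p + 3/4 * q) / (1 / z * (3/4 * p + 5/4 * q)) = z\<^sup>2 * (p/q) * (1 + 3/5 / (p/q)) / (1 + 3/5 * (p/q))"
      if "q \<noteq> 0" "p \<noteq> 0" for p q :: complex
    proof -
      have 1: "z * X / (1 / z * Y) = z\<^sup>2 * (X / Y)" for X Y :: complex
        using z0 by (simp add: power2_eq_square)
      have 2: "5/4 * p + 3/4 * q = (5/4 * q) * ((p/q) * (1 + 3/5 / (p/q)))"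
          "3/4 * p + 5/4 * q = (5/4 * q) * (1 + 3/5 * (p/q))"
        using that by (simp_all add: field_simps)
      have 3: "(5/4 * q) * X / ((5/4 * q) * Y) = X / Y" for X Y
        using that by (intro mult_divide_mult_cancel_left) simp
      show ?thesis unfolding 1 2 3 by (simp add: mult.assoc)
    qed
    show ?thesis unfolding r_def rot_right c using gen[OF Q0] by simp
  qed
  have contr: "continuous_on UNIV (\<lambda>t. r m (g t))" if "continuous_on UNIV g" "\<And>t. norm (g t) = 1" "m = n \<or> m = Suc n"
    for g :: "real \<Rightarrow> complex" and m
  proof -
    have "rot_Q l m (g t) \<noteq> 0" for t
      using that(3) Qbig[OF that(2)[of t]] by (elim disjE) auto
    then show ?thesis unfolding r_def using that(1) by (intro continuous_intros) auto
  qed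
  have contcis: "continuous_on UNIV cis" by (intro continuous_intros)
  \<comment> \<open>\<open>L\<close> lives on the real line and need not be periodic: its increment
    over \<open>2 * pi\<close> records the winding number of \<open>r n\<close>.\<close>
  obtain L where L: "continuous_on UNIV L" "\<And>t. r n (cis t) = exp (L t)"
    using continuous_logarithm_on_contractible[OF contr[OF contcis], of n] r0 by (auto simp: convex_imp_contractible)
  \<comment> \<open>Principal logarithms of functions of \<open>cis t\<close>, so \<open>E\<close>
    is periodic and adds nothing to the winding.\<close>
  define E where "E t = Ln (1 + d (cis t)) - Ln (1 + 3/5 / r n (l * cis t)) + Ln (1 + 3/5 * r n (l * cis t))" for t
  have small: "norm (3/5 / r n (l * cis t)) < 1" "norm (3/5 * r n (l * cis t)) < 1" for t
    using r1[OF lz[of "cis t"]] r2[OF lz[of "cis t"]] by (auto simp: norm_divide norm_mult divide_simps)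
  have contrl: "continuous_on UNIV (\<lambda>t. r n (l * cis t))"
    by (intro contr continuous_intros) (auto simp: norm_mult l)
  have E: "continuous_on UNIV E"
    unfolding E_def d_def
  proof (intro continuous_intros contr contcis contrl ballI)
    show "1 + (r (Suc n) (cis t) / r n (cis t) - 1) \<notin> \<real>\<^sub>\<le>\<^sub>0" for t
      using sub_unit_not_nonpos[OF d[of "cis t"]] unfolding d_def by simp
    show "1 + 3/5 / r n (l * cis t) \<notin> \<real>\<^sub>\<le>\<^sub>0" "1 + 3/5 * r n (l * cis t) \<notin> \<real>\<^sub>\<le>\<^sub>0" for t
      using sub_unit_not_nonpos[OF small(1)] sub_unit_not_nonpos[OF small(2)] by auto
  qed (auto simp: r0 lz)
  have expE: "exp (E t) = (1 + d (cis t)) / (1 + 3/5 / r n (l * cis t)) * (1 + 3/5 * r n (l * cis t))" for t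
  proof -
    have "1 + d (cis t) \<noteq> 0" "1 + 3/5 / r n (l * cis t) \<noteq> 0" "1 + 3/5 * r n (l * cis t) \<noteq> 0"
      using sub_unit_nonzero[OF small(1)] sub_unit_nonzero[OF small(2)] sub_unit_nonzero[OF d] norm_cis by blast+
    then show ?thesis unfolding E_def by (simp add: exp_add exp_diff)
  qed
  have nz: "1 + 3/5 / r n (l * cis t) \<noteq> 0" "1 + 3/5 * r n (l * cis t) \<noteq> 0" for t
    using sub_unit_nonzero[OF small(1)] sub_unit_nonzero[OF small(2)] by blast+
  \<comment> \<open>The relation \<open>rec\<close> in logarithmic form: \<open>F\<close> is a
    continuous logarithm of 1, hence constant. Between 0 and \<open>2 * pi\<close> only the
    increment of \<open>2 * \<i> * t\<close> remains, because the increments of \<open>L\<close>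
    from 0 and from \<open>\<beta>\<close> agree.\<close>
  define F where "F t = L t + E t - 2 * \<i> * of_real t - L (t + \<beta>)" for t
  have contLs: "continuous_on UNIV (\<lambda>t. L (t + s))" for s :: real
    by (rule continuous_on_compose2[OF L(1)]) (auto intro!: continuous_intros)
  have F: "continuous_on UNIV F"
    unfolding F_def by (intro continuous_intros L(1) E contLs)
  have expF: "exp (F t) = 1" for t
  proof -
    have "exp (F t) = r n (cis t) * exp (E t) / ((cis t)\<^sup>2 * r n (l * cis t))"
    proof -
      have "exp (2 * \<i> * of_real t) = (cis t)\<^sup>2"
        unfolding power2_eq_square cis_conv_exp exp_add[symmetric] by (simp add: algebra_simps)
      moreover have "exp (L (t + \<beta>)) = r n (l * cis t)"
        unfolding L(2)[symmetric] \<beta> cis_mult by (simp only: add.commute)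
      ultimately show ?thesis unfolding F_def exp_diff exp_add L(2)[symmetric] by simp
    qed
    also have "r n (cis t) * (1 + d (cis t)) = r (Suc n) (cis t)"
      unfolding d_def using r0[of "cis t"] by simp
    then have "r n (cis t) * exp (E t) = r (Suc n) (cis t) / (1 + 3/5 / r n (l * cis t)) * (1 + 3/5 * r n (l * cis t))"
      unfolding expE by (metis (no_types, lifting) mult.assoc times_divide_eq_right)
    also have "\<dots> = (cis t)\<^sup>2 * r n (l * cis t)"
      unfolding rec[of "cis t", OF norm_cis] using nz[of t] by simp
    finally show ?thesis using r0[OF lz[OF norm_cis[of t]]] by simp
  qed
  have shift: "exp (L (t + 2 * pi) - L t) = 1" for t
    unfolding exp_diff L(2)[symmetric] using r0[of "cis t"]
    by (simp add: cis_mult[symmetric])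
  have const: "G s = G t" if "continuous_on UNIV G" "\<And>t. exp (G t) = 1" for G :: "real \<Rightarrow> complex" and s t
    using exp_constant_on[OF connected_UNIV that(1), of 1] that(2) by (auto simp: constant_on_def)
  have "L (0 + 2 * pi) - L 0 = L (\<beta> + 2 * pi) - L \<beta>"
    by (rule const[of "\<lambda>t. L (t + 2 * pi) - L t"]) (intro continuous_intros contLs L(1) shift)+
  moreover have "F (0 + 2 * pi) = F 0" by (rule const[OF F expF])
  moreover have "E (2 * pi) = E 0" unfolding E_def by simp
  ultimately have "4 * \<i> * of_real pi = 0" unfolding F_def by (simp add: algebra_simps)
  then show False by simp
qed

subsection \<open>Minimal maps and eigenfunctions\<close>

locale minimal_map =
  fixes X :: "'a::metric_space set" and f :: "'a \<Rightarrow> 'a"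
  assumes compact: "compact X"
    and cont: "continuous_on X f"
    and maps: "f ` X \<subseteq> X"
    and minimal: "minimal_system X f"
begin

lemma f_in [simp]: "x \<in> X \<Longrightarrow> f x \<in> X"
  using maps by blast

lemma funpow_in [simp]: "x \<in> X \<Longrightarrow> (f ^^ n) x \<in> X"
  by (induction n) auto

lemma continuous_on_funpow: "continuous_on X (f ^^ n)"
proof (induction n)
  case 0
  show ?case by (simp add: id_def)
next
  case (Suc n)
  have "continuous_on X (f \<circ> (f ^^ n))"
    by (intro continuous_on_compose Suc continuous_on_subset[OF cont]) auto
  then show ?case by simp
qed

lemma continuous_on_iterate:
  assumes "continuous_on X u"
  shows "continuous_on X (\<lambda>x. u ((f ^^ n) x))"
  by (rule continuous_on_compose2[OF assms continuous_on_funpow]) auto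

lemma closure_orbit: "x \<in> X \<Longrightarrow> closure (range (\<lambda>i. (f ^^ i) x)) = X"
  using minimal compact_imp_closed[OF compact]
  by (intro antisym closure_minimal) (auto simp: minimal_system_def)

lemma orbit_hits:
  assumes "open U" "y \<in> U" "y \<in> X" "x \<in> X"
  obtains n where "(f ^^ n) x \<in> U"
proof -
  have "U \<inter> closure (range (\<lambda>i. (f ^^ i) x)) \<noteq> {}"
    using assms closure_orbit by blast
  then have "U \<inter> range (\<lambda>i. (f ^^ i) x) \<noteq> {}"
    using open_Int_closure_eq_empty[OF assms(1)] by blast
  then show ?thesis using that by blast
qed

lemma invariant_const:
  fixes u :: "'a \<Rightarrow> 'b::t1_space"
  assumes u: "continuous_on X u" and inv: "\<And>x. x \<in> X \<Longrightarrow> u (f x) = u x"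
    and "x \<in> X" "y \<in> X"
  shows "u x = u y"
proof -
  have orb: "u ((f ^^ n) y) = u y" for n
    by (induction n) (use assms(4) inv in auto)
  have "u x = u y"
    by (rule continuous_constant_on_closure[of "range (\<lambda>i. (f ^^ i) y)" u])
       (use assms closure_orbit[OF assms(4)] orb in auto)
  then show ?thesis .
qed

text \<open>The form in which uniformity is exploited in both classes. There \<open>v\<close> is not
  the rate itself but a sequence close to it, for which approximate invariance under
  \<open>f\<close> is easier to see.\<close>

lemma limit_const:
  fixes v :: "nat \<Rightarrow> 'a \<Rightarrow> real"
  assumes lim: "uniform_limit X v l sequentially"
    and cv: "\<And>k. continuous_on X (v k)"
    and shift: "\<And>x. x \<in> X \<Longrightarrow> (\<lambda>k. v k (f x) - v k x) \<longlonglongrightarrow> 0"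
  obtains c where "uniform_limit X v (\<lambda>_. c) sequentially"
proof -
  have cl: "continuous_on X l"
    by (rule uniform_limit_theorem[OF _ lim]) (use cv in auto)
  have "l (f x) = l x" if "x \<in> X" for x
  proof -
    have "(\<lambda>k. v k (f x) - v k x) \<longlonglongrightarrow> l (f x) - l x"
      by (intro tendsto_diff tendsto_uniform_limitI[OF lim]) (use that in auto)
    then show ?thesis using LIMSEQ_unique[OF shift[OF that]] by force
  qed
  then have const: "l x = l y" if "x \<in> X" "y \<in> X" for x y
    using invariant_const[OF cl] that by blast
  have "uniform_limit X v (\<lambda>_. l (SOME x. x \<in> X)) sequentially"
    by (rule uniform_limit_cong'[THEN iffD1, OF _ _ lim]) (use const some_in_eq in blast)+
  then show ?thesis by (rule that)
qed

text \<open>If the eigenfunction missed a point of the circle, it would have a continuous, hence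
  bounded, argument, which increases by the same non-zero amount at each step.\<close>

lemma eigenfunction_onto:
  fixes h :: "'a \<Rightarrow> complex"
  assumes conn: "connected X" and ne: "X \<noteq> {}"
    and h: "continuous_on X h" and unit: "\<And>x. x \<in> X \<Longrightarrow> norm (h x) = 1"
    and eig: "\<And>x. x \<in> X \<Longrightarrow> h (f x) = l * h x" and l: "l \<noteq> 1" and w: "norm w = 1"
  shows "\<exists>x\<in>X. h x = w"
proof (rule ccontr)
  assume no: "\<not> ?thesis"
  have w0: "w \<noteq> 0" using w by auto
  have dom: "- h x / w \<notin> \<real>\<^sub>\<le>\<^sub>0" if "x \<in> X" for x
  proof
    assume "- h x / w \<in> \<real>\<^sub>\<le>\<^sub>0"
    then obtain r where r: "- h x / w = of_real r" "r \<le> 0" by (auto simp: nonpos_Reals_def)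
    have "norm (- h x / w) = 1" using unit[OF that] w by (simp add: norm_divide)
    then have "r = -1" unfolding r(1) using r(2) by simp
    then have "h x = w" using r w0 by (simp add: field_simps)
    then show False using no that by blast
  qed
  \<comment> \<open>The minus sign moves the omitted value \<open>w\<close> to -1, on the branch cut
    of \<open>Ln\<close>.\<close>
  define T where "T x = Ln (- h x / w)" for x
  have T: "continuous_on X T"
    unfolding T_def using dom w0 by (intro continuous_intros h) auto
  have expT: "exp (T x) = - h x / w" if "x \<in> X" for x
    unfolding T_def using unit[OF that] w0 by (intro exp_Ln) auto
  have ReT: "Re (T x) = 0" if "x \<in> X" for x
    unfolding T_def using unit[OF that] w by (subst Re_Ln) (auto simp: norm_divide)
  have ImT: "\<bar>Im (T x)\<bar> \<le> pi" if "x \<in> X" for x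
    unfolding T_def using unit[OF that] w0 Im_Ln_le_pi[of "- h x / w"] mpi_less_Im_Ln[of "- h x / w"] by force
  have "(\<lambda>x. T (f x) - T x) constant_on X"
  proof (rule exp_constant_on[OF conn])
    show "continuous_on X (\<lambda>x. T (f x) - T x)"
      using continuous_on_iterate[OF T, of 1] T by (intro continuous_intros) auto
    show "exp (T (f x) - T x) = l" if "x \<in> X" for x
      using that unit[OF that] w0 by (auto simp: exp_diff expT eig)
  qed
  then obtain c where c: "\<And>x. x \<in> X \<Longrightarrow> T (f x) - T x = c" by (auto simp: constant_on_def)
  obtain x where x: "x \<in> X" using ne by blast
  have it: "T ((f ^^ n) x) = T x + of_nat n * c" for n
  proof (induction n)
    case (Suc n)
    then show ?case using c[OF funpow_in[OF x, of n]] by (simp add: algebra_simps)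
  qed simp
  have "norm c = 0"
  proof (rule ccontr)
    assume "norm c \<noteq> 0"
    then obtain n :: nat where n: "2 * pi < real n * norm c"
      using reals_Archimedean3[of "norm c"] by auto
    have bd: "norm (T y) \<le> pi" if "y \<in> X" for y
      using cmod_le[of "T y"] ReT[OF that] ImT[OF that] by simp
    have "real n * norm c = norm (T ((f ^^ n) x) - T x)" unfolding it by (simp add: norm_mult)
    also have "\<dots> \<le> 2 * pi" using norm_triangle_ineq4[of "T ((f ^^ n) x)" "T x"] bd[OF x] bd[OF funpow_in[OF x, of n]] by linarith
    finally show False using n by simp
  qed
  then have "T (f x) = T x" using c[OF x] by simp
  then have "- h (f x) / w = - h x / w" using expT x by (metis f_in)
  then show False using eig[OF x] w0 unit[OF x] l by auto
qed

end

section \<open>Real 2 x 2 matrices and the cocycle over an eigenfunction\<close>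

text \<open>The matrix of the real-linear map \<open>v \<mapsto> p v + q (cnj v)\<close> of the complex plane.\<close>

definition mat_PQ :: "complex \<Rightarrow> complex \<Rightarrow> real mat" where
  "mat_PQ p q = mat 2 2 (\<lambda>(i, j).
     if i = 0 then (if j = 0 then Re p + Re q else Im q - Im p)
     else (if j = 0 then Im p + Im q else Re p - Re q))"

lemma mat_PQ_carrier [simp]: "mat_PQ p q \<in> carrier_mat 2 2"
  by (simp add: mat_PQ_def)

lemma mat_PQ_entries [simp]:
  "mat_PQ p q $$ (0, 0) = Re p + Re q" "mat_PQ p q $$ (0, Suc 0) = Im q - Im p"
  "mat_PQ p q $$ (Suc 0, 0) = Im p + Im q" "mat_PQ p q $$ (Suc 0, Suc 0) = Re p - Re q"
  "dim_row (mat_PQ p q) = 2" "dim_col (mat_PQ p q) = 2"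
  by (simp_all add: mat_PQ_def)

lemma mat_PQ_mult: "mat_PQ p q * mat_PQ p' q' = mat_PQ (p * p' + q * cnj q') (p * q' + q * cnj p')"
proof (rule eq_matI)
  fix i j assume "i < dim_row (mat_PQ (p * p' + q * cnj q') (p * q' + q * cnj p'))"
    "j < dim_col (mat_PQ (p * p' + q * cnj q') (p * q' + q * cnj p'))"
  then have "i = 0 \<or> i = Suc 0" "j = 0 \<or> j = Suc 0" by auto
  then show "(mat_PQ p q * mat_PQ p' q') $$ (i, j) = mat_PQ (p * p' + q * cnj q') (p * q' + q * cnj p') $$ (i, j)"
    by (auto simp: scalar_prod_def numeral_2_eq_2 algebra_simps)
qed auto

lemma mat_PQ_one: "mat_PQ 1 0 = 1\<^sub>m 2"
proof (rule eq_matI)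
  fix i j assume "i < dim_row (1\<^sub>m 2 :: real mat)" "j < dim_col (1\<^sub>m 2 :: real mat)"
  then have "i = 0 \<or> i = Suc 0" "j = 0 \<or> j = Suc 0" by auto
  then show "mat_PQ 1 0 $$ (i, j) = 1\<^sub>m 2 $$ (i, j)" by auto
qed auto

text \<open>With determinant 1 the inverse of \<open>v \<mapsto> p v + q (cnj v)\<close> is
  \<open>v \<mapsto> cnj p v - q (cnj v)\<close>.\<close>

lemma mat_PQ_GL:
  assumes "p * cnj p - q * cnj q = 1"
  shows "mat_PQ p q \<in> GL 2"
proof -
  have "mat_PQ p q * mat_PQ (cnj p) (- q) = 1\<^sub>m 2" "mat_PQ (cnj p) (- q) * mat_PQ p q = 1\<^sub>m 2"
    unfolding mat_PQ_mult mat_PQ_one[symmetric] using assms by (simp_all add: mult.commute)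
  then show ?thesis
    unfolding GL_def invertible_mat_def inverts_mat_def
    by (auto intro!: exI[of _ "mat_PQ (cnj p) (- q)"])
qed

lemma mat_norm_PQ:
  "mat_norm (mat_PQ p q) = \<bar>Re p + Re q\<bar> + \<bar>Im q - Im p\<bar> + \<bar>Im p + Im q\<bar> + \<bar>Re p - Re q\<bar>"
  by (simp add: mat_norm_def numeral_2_eq_2)

lemma mat_norm_PQ_bounds:
  "norm p \<le> mat_norm (mat_PQ p q)"
  "norm q \<le> norm p \<Longrightarrow> mat_norm (mat_PQ p q) \<le> 8 * norm p"
  unfolding mat_norm_PQ
  using cmod_le[of p] abs_Re_le_cmod[of p] abs_Im_le_cmod[of p] abs_Re_le_cmod[of q] abs_Im_le_cmod[of q]
  by linarith+

context minimal_map
begin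

lemma non_uniform_of_eigenfunction:
  fixes h :: "'a \<Rightarrow> complex"
  assumes conn: "connected X" and ne: "X \<noteq> {}"
    and h: "continuous_on X h" and unit: "\<And>x. x \<in> X \<Longrightarrow> norm (h x) = 1"
    and eig: "\<And>x. x \<in> X \<Longrightarrow> h (f x) = l * h x" and l: "l \<noteq> 1"
  shows "\<exists>A\<in>continuous_GL X 2. \<not> uniform_cocycle X f 2 A"
proof -
  have nl: "norm l = 1"
  proof -
    obtain x where "x \<in> X" using ne by blast
    then show ?thesis using eig[of x] unit[of x] unit[of "f x"] by (simp add: norm_mult)
  qed
  define A where "A x = mat_PQ (5/4 * h x) (3/4 * cnj (h x))" for x
  have iter: "h ((f ^^ n) x) = l ^ n * h x" if "x \<in> X" for n x
    using that by (induction n) (auto simp: eig)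
  have coc: "cocycle 2 f A n x = mat_PQ (rot_P l n (h x)) (rot_Q l n (h x))" if "x \<in> X" for n x
  proof (induction n)
    case 0
    show ?case by (simp add: mat_PQ_one rot_P.simps rot_Q.simps)
  next
    case (Suc n)
    have "A ((f ^^ n) x) = mat_PQ (5/4 * (l ^ n * h x)) (3/4 * cnj (l ^ n * h x))"
      unfolding A_def iter[OF that] ..
    then show ?case by (simp only: cocycle.simps Suc mat_PQ_mult rot_P.simps rot_Q.simps)
  qed
  have "A \<in> continuous_GL X 2"
  proof -
    have "A x \<in> GL 2" if "x \<in> X" for x
    proof -
      have "cocycle 2 f A 1 x = A x" by (simp add: A_def)
      then have "A x = mat_PQ (rot_P l 1 (h x)) (rot_Q l 1 (h x))" using coc[OF that, of 1] by simp
      then show ?thesis using mat_PQ_GL[OF rot_det[OF nl unit[OF that], of 1]] by simp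
    qed
    moreover have "continuous_on X (\<lambda>x. A x $$ (i, j))" if "i < 2" "j < 2" for i j
    proof -
      have "i = 0 \<or> i = Suc 0" "j = 0 \<or> j = Suc 0" using that by auto
      then show ?thesis unfolding A_def using h by (auto intro!: continuous_intros)
    qed
    ultimately show ?thesis unfolding continuous_GL_def by blast
  qed
  moreover have "\<not> uniform_cocycle X f 2 A"
  proof
    assume "uniform_cocycle X f 2 A"
    then obtain L where L: "uniform_limit X (\<lambda>n x. 1 / real n * ln (mat_norm (cocycle 2 f A n x))) L sequentially"
      unfolding uniform_cocycle_def uniformly_convergent_on_def by blast
    \<comment> \<open>Passing from the matrix norm to \<open>|P|\<close> costs at most
      \<open>ln 8 / n\<close> and makes the estimates for \<open>P\<close> applicable.\<close>
    define v where "v n x = 1 / real n * ln (norm (rot_P l n (h x)))" for n x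
    have P1: "1 \<le> norm (rot_P l n (h x))" if "x \<in> X" for n x
      using rot_P_ge_1[OF nl unit[OF that]] .
    have lnabs: "\<bar>1 / real n * ln a - 1 / real n * ln b\<bar> \<le> 1 / real n * ln C"
      if "a \<le> C * b" "b \<le> C * a" "0 < a" "0 < b" "0 < C" for a b C :: real and n
    proof -
      have "ln a \<le> ln (C * b)" "ln b \<le> ln (C * a)"
        using that by simp_all
      then have "\<bar>ln a - ln b\<bar> \<le> ln C" using that by (simp add: ln_mult)
      then have "1 / real n * \<bar>ln a - ln b\<bar> \<le> 1 / real n * ln C" by (intro mult_left_mono) auto
      then show ?thesis unfolding right_diff_distrib[symmetric] abs_mult by simp
    qed
    have to0: "(\<lambda>n. 1 / real n * c) \<longlonglongrightarrow> 0" for c :: real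
      using tendsto_mult_right[OF lim_1_over_n, of c] by simp
    have vu: "\<bar>v n x - 1 / real n * ln (mat_norm (cocycle 2 f A n x))\<bar> \<le> 1 / real n * ln 8" if "x \<in> X" for n x
      unfolding v_def coc[OF that]
      using mat_norm_PQ_bounds(1)[of "rot_P l n (h x)" "rot_Q l n (h x)"]
        mat_norm_PQ_bounds(2)[OF rot_Q_le[OF nl unit[OF that], of n]] P1[OF that, of n]
      by (intro lnabs) linarith+
    have limv: "uniform_limit X v L sequentially"
    proof (rule uniform_limitI)
      fix e :: real assume e: "0 < e"
      have "\<forall>\<^sub>F n in sequentially. \<forall>x\<in>X. dist (1 / real n * ln (mat_norm (cocycle 2 f A n x))) (L x) < e / 2"
        using uniform_limitD[OF L, of "e/2"] e by simp
      moreover have "\<forall>\<^sub>F n in sequentially. 1 / real n * ln 8 < e / 2"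
        using order_tendstoD(2)[OF to0, of "e/2" "ln 8"] e by simp
      ultimately show "\<forall>\<^sub>F n in sequentially. \<forall>x\<in>X. dist (v n x) (L x) < e"
      proof eventually_elim
        case (elim n)
        show ?case
        proof
          fix x assume "x \<in> X"
          then show "dist (v n x) (L x) < e"
            using elim(2) bspec[OF elim(1) \<open>x \<in> X\<close>] vu[OF \<open>x \<in> X\<close>, of n] unfolding dist_real_def by linarith
        qed
      qed
    qed
    have "continuous_on X (v n)" for n
      unfolding v_def[abs_def] using P1[of _ n] by (intro continuous_intros h) force+
    moreover have "(\<lambda>k. v k (f x) - v k x) \<longlonglongrightarrow> 0" if x: "x \<in> X" for x
    proof (rule Lim_null_comparison[OF _ to0[of "ln 4"]])
      show "\<forall>\<^sub>F n in sequentially. norm (v n (f x) - v n x) \<le> 1 / real n * ln 4"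
      proof (rule always_eventually, rule allI)
        fix n
        show "norm (v n (f x) - v n x) \<le> 1 / real n * ln 4"
          unfolding v_def real_norm_def eig[OF x]
          using rot_shift_bounds[OF nl unit[OF x], of n] P1[OF x, of n] P1[OF f_in[OF x], of n]
          by (intro lnabs) (auto simp: eig[OF x])
      qed
    qed
    ultimately obtain c where c: "uniform_limit X v (\<lambda>_. c) sequentially"
      using limit_const[OF limv] by blast
    \<comment> \<open>A quarter of the forced rate: the point of large norm gives
      \<open>c > 4 * e - e\<close>, the point of small norm gives \<open>c < e + e\<close>. Both
      points of the circle are values of \<open>h\<close> because \<open>h\<close> is onto.\<close>
    define e where "e = ln (5/4 :: real) / 4"
    have e: "0 < e" by (simp add: e_def)
    obtain N where N: "\<And>n x. N \<le> n \<Longrightarrow> x \<in> X \<Longrightarrow> \<bar>v n x - c\<bar> < e" "\<And>n. N \<le> n \<Longrightarrow> 1 / real n * ln 2 < e"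
    proof -
      have "\<forall>\<^sub>F n in sequentially. (\<forall>x\<in>X. dist (v n x) c < e) \<and> 1 / real n * ln 2 < e"
        using uniform_limitD[OF c e] order_tendstoD(2)[OF to0, of e "ln 2"] e by (auto intro: eventually_conj)
      then show ?thesis using that unfolding eventually_sequentially dist_real_def by blast
    qed
    define n where "n = max N 1"
    have n: "N \<le> n" "1 \<le> n" by (auto simp: n_def)
    obtain z where z: "norm z = 1" "(5/4) ^ n \<le> norm (rot_P l n z)" using rot_P_large[OF nl] .
    obtain x where x: "x \<in> X" "h x = z"
      using eigenfunction_onto[OF conn ne h unit eig l z(1)] by blast
    have "real n * ln (5/4) \<le> ln (norm (rot_P l n z))"
      using z(2) by (subst ln_realpow[symmetric]) (auto intro!: ln_mono less_le_trans[OF _ z(2)])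
    then have "ln (5/4) \<le> v n x"
      unfolding v_def x(2) using n(2) by (simp add: field_simps)
    then have low: "3 * e < c" using N(1)[OF n(1) x(1)] unfolding e_def by linarith
    obtain z where z: "norm z = 1" "norm (rot_P l n z) < 2 \<or> norm (rot_P l (Suc n) z) < 2"
      using rot_P_small[OF nl] by blast
    then obtain m where m: "N \<le> m" "norm (rot_P l m z) < 2" using n(1) le_SucI by blast
    obtain x where x: "x \<in> X" "h x = z"
      using eigenfunction_onto[OF conn ne h unit eig l z(1)] by blast
    have "ln (norm (rot_P l m z)) \<le> ln 2" using m(2) P1[OF x(1), of m] x(2) by (intro ln_mono) auto
    then have "v m x \<le> 1 / real m * ln 2" unfolding v_def x(2) by (intro mult_left_mono) auto
    then have "c < 2 * e" using N(1)[OF m(1) x(1)] N(2)[OF m(1)] by linarith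
    then show False using low e by linarith
  qed
  ultimately show ?thesis by blast
qed

end

subsection \<open>An invariant pseudometric in the absence of weak mixing\<close>

lemma measurable_self_map:
  assumes "sets M = sets (restrict_space borel X)" "continuous_on X f" "f ` X \<subseteq> X"
  shows "f \<in> M \<rightarrow>\<^sub>M M"
proof -
  have "f \<in> restrict_space borel X \<rightarrow>\<^sub>M restrict_space borel X"
    using assms
    by (intro measurable_restrict_space2 borel_measurable_continuous_on_restrict)
       (auto simp: space_restrict_space)
  then show ?thesis using measurable_cong_sets[OF assms(1) assms(1)] by blast
qed

text \<open>Kept separate from minimality because it is also instantiated with \<open>f ^^ n\<close>
  in place of \<open>f\<close>, in class I.\<close>

locale invariant_prob = prob_space M
  for X :: "'a::metric_space set" and f :: "'a \<Rightarrow> 'a" and M :: "'a measure" +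
  assumes compact_X: "compact X" and cont_f: "continuous_on X f" and maps_f: "f ` X \<subseteq> X"
    and sets_M: "sets M = sets (restrict_space borel X)" and distr_M: "distr M M f = M"
begin

lemma space_M: "space M = X"
  using sets_eq_imp_space_eq[OF sets_M] by (simp add: space_restrict_space)

lemma measurable_continuous: "continuous_on X u \<Longrightarrow> u \<in> borel_measurable M"
  using borel_measurable_continuous_on_restrict measurable_cong_sets[OF sets_M refl] by blast

lemma integrable_continuous:
  fixes u :: "'a \<Rightarrow> 'b::{banach, second_countable_topology}"
  assumes "continuous_on X u"
  shows "integrable M u"
proof -
  obtain B where "\<And>x. x \<in> X \<Longrightarrow> norm (u x) \<le> B"
    using compact_imp_bounded[OF compact_continuous_image[OF assms compact_X]]
    by (auto simp: bounded_iff)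
  then show ?thesis
    using measurable_continuous[OF assms]
    by (intro integrable_const_bound[of _ B] AE_I2) (auto simp: space_M)
qed

lemma measurable_f: "f \<in> M \<rightarrow>\<^sub>M M"
  using measurable_self_map[OF sets_M cont_f maps_f] .

lemma integral_f:
  fixes u :: "'a \<Rightarrow> 'b::{banach, second_countable_topology}"
  assumes "u \<in> borel_measurable M"
  shows "(\<integral>x. u (f x) \<partial>M) = (\<integral>x. u x \<partial>M)"
  using integral_distr[OF measurable_f assms] by (simp add: distr_M)

lemma sets_vimage_f: "A \<in> sets M \<Longrightarrow> f -` A \<inter> X \<in> sets M"
  using measurable_sets[OF measurable_f, of A] by (simp add: space_M)

lemma measure_vimage_f: "A \<in> sets M \<Longrightarrow> measure M (f -` A \<inter> X) = measure M A"
  using measure_distr[OF measurable_f, of A] by (simp add: distr_M space_M)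

lemma sets_open: "open U \<Longrightarrow> X \<inter> U \<in> sets M"
  unfolding sets_M by (auto simp: sets_restrict_space)

lemma measure_zero_of_subset_UN:
  assumes "\<And>n :: nat. A n \<in> sets M" "\<And>n. measure M (A n) = 0" "B \<subseteq> (\<Union>n. A n)"
  shows "measure M B = 0"
proof -
  have "(\<Union>n. A n) \<in> null_sets M"
    using assms(1,2) by (intro null_sets_UN) (auto simp: null_sets_def emeasure_eq_measure)
  then have "measure M (\<Union>n. A n) = 0" by (simp add: measure_eq_0_null_sets)
  moreover have "measure M B \<le> measure M (\<Union>n. A n)"
    using assms(1,3) by (intro finite_measure_mono) auto
  ultimately show ?thesis using measure_nonneg[of M B] by linarith
qed

lemma measure_le_add_of_subset_Un:
  assumes "A \<in> sets M" "B \<in> sets M" "C \<subseteq> A \<union> B" 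
  shows "measure M C \<le> measure M A + measure M B"
proof -
  have "measure M C \<le> measure M (A \<union> B)"
    using assms by (intro finite_measure_mono) auto
  also have "\<dots> \<le> measure M A + measure M B"
    using assms by (intro measure_subadditive) auto
  finally show ?thesis .
qed

end

locale minimal_measure = minimal_map X f + invariant_prob X f M
  for X :: "'a::metric_space set" and f M
begin

lemma X_nonempty: "X \<noteq> {}"
  using not_empty space_M by simp

lemma sets_vimage_funpow: "A \<in> sets M \<Longrightarrow> (f ^^ n) -` A \<inter> X \<in> sets M"
  and measure_vimage_funpow: "A \<in> sets M \<Longrightarrow> measure M ((f ^^ n) -` A \<inter> X) = measure M A"
proof (induction n)
  case 0
  {
    case 1
    show ?case using sets.sets_into_space[OF 1] 1 by (simp add: space_M Int_absorb2)
  next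
    case 2
    show ?case using sets.sets_into_space[OF 2] by (simp add: space_M Int_absorb2)
  }
next
  case (Suc n)
  have *: "(f ^^ Suc n) -` A \<inter> X = f -` ((f ^^ n) -` A \<inter> X) \<inter> X"
    by (auto simp: funpow_swap1)
  {
    case 1
    show ?case unfolding * by (intro sets_vimage_f Suc 1)
  next
    case 2
    show ?case unfolding * using measure_vimage_f[OF Suc(1)[OF 2]] Suc(2)[OF 2] by simp
  }
qed

text \<open>By minimality the preimages of \<open>U\<close> under the iterates cover
  \<open>X\<close>, and by invariance they all have the measure of \<open>U\<close>.\<close>

lemma full_support:
  assumes U: "open U" and y: "y \<in> U" "y \<in> X"
  shows "0 < measure M (X \<inter> U)"
proof (rule ccontr)
  assume "\<not> ?thesis"
  then have 0: "measure M (X \<inter> U) = 0" using measure_nonneg[of M "X \<inter> U"] by linarith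
  have "measure M X = 0"
  proof (rule measure_zero_of_subset_UN)
    show "(f ^^ n) -` (X \<inter> U) \<inter> X \<in> sets M" for n
      by (intro sets_vimage_funpow sets_open U)
    show "measure M ((f ^^ n) -` (X \<inter> U) \<inter> X) = 0" for n
      using measure_vimage_funpow[OF sets_open[OF U]] 0 by simp
    show "X \<subseteq> (\<Union>n. (f ^^ n) -` (X \<inter> U) \<inter> X)"
    proof
      fix x assume x: "x \<in> X"
      obtain n where "(f ^^ n) x \<in> U" using orbit_hits[OF U y x] .
      then show "x \<in> (\<Union>n. (f ^^ n) -` (X \<inter> U) \<inter> X)" using x by auto
    qed
  qed
  then show False using prob_space by (simp add: space_M)
qed

text \<open>The section at \<open>x\<close> of the set W of the overview. Times start at 1, as in
  topological transitivity.\<close>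

definition reach :: "('a \<times> 'a) set \<Rightarrow> 'a \<Rightarrow> 'a set" where
  "reach V x = {y \<in> X. \<exists>k\<ge>1. ((f ^^ k) x, (f ^^ k) y) \<in> V}"

lemma reach_subset: "reach V x \<subseteq> X"
  by (auto simp: reach_def)

lemma reach_f_subset: "f -` reach V (f x) \<inter> X \<subseteq> reach V x"
  unfolding reach_def by (auto simp flip: funpow.simps funpow_Suc_right simp: funpow_swap1 intro: le_SucI)
    (metis funpow_swap1 comp_apply funpow.simps(2) le_SucI)

lemma reach_lsc:
  assumes V: "open V" and x: "x \<in> X" and xs: "\<And>j :: nat. xs j \<in> X" "xs \<longlonglongrightarrow> x" and y: "y \<in> reach V x"
  shows "\<forall>\<^sub>F j in sequentially. y \<in> reach V (xs j)"
proof -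
  from y obtain k where k: "y \<in> X" "k \<ge> 1" "((f ^^ k) x, (f ^^ k) y) \<in> V" by (auto simp: reach_def)
  have "(\<lambda>j. (f ^^ k) (xs j)) \<longlonglongrightarrow> (f ^^ k) x"
    using continuous_on_tendsto_compose[OF continuous_on_funpow xs(2) x] xs(1) by simp
  then have "(\<lambda>j. ((f ^^ k) (xs j), (f ^^ k) y)) \<longlonglongrightarrow> ((f ^^ k) x, (f ^^ k) y)"
    by (intro tendsto_intros)
  from topological_tendstoD[OF this V k(3)] show ?thesis
    by eventually_elim (use k in \<open>auto simp: reach_def\<close>)
qed

lemma sets_reach:
  assumes V: "open V"
  shows "reach V x \<in> sets M"
proof -
  have eq: "reach V x = (\<Union>k\<in>{1..}. X \<inter> (\<lambda>y. ((f ^^ k) x, (f ^^ k) y)) -` V)"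
    by (auto simp: reach_def)
  have *: "X \<inter> (\<lambda>y. ((f ^^ k) x, (f ^^ k) y)) -` V \<in> sets M" for k
  proof -
    have "continuous_on X (\<lambda>y. ((f ^^ k) x, (f ^^ k) y))"
      by (intro continuous_intros continuous_on_funpow)
    then obtain T where "open T" "T \<inter> X = (\<lambda>y. ((f ^^ k) x, (f ^^ k) y)) -` V \<inter> X"
      using V continuous_on_open_invariant by metis
    then show ?thesis using sets_open[of T] by (simp add: Int_commute)
  qed
  show ?thesis unfolding eq by (intro sets.countable_UN'' *) auto
qed

text \<open>A one-sided difference, because lower semicontinuity of the sections makes exactly this
  side tend to 0 (\<open>gap_tendsto\<close>). It becomes symmetric once all sections are known to
  have the same measure.\<close>

definition gap :: "('a \<times> 'a) set \<Rightarrow> 'a \<Rightarrow> 'a \<Rightarrow> real" where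
  "gap V x y = measure M (reach V x - reach V y)"

lemma gap_tendsto:
  assumes V: "open V" and x: "x \<in> X" and xs: "\<And>j :: nat. xs j \<in> X" "xs \<longlonglongrightarrow> x"
  shows "(\<lambda>j. gap V x (xs j)) \<longlonglongrightarrow> 0"
proof -
  have "(\<lambda>j. \<integral>y. indicator (reach V x - reach V (xs j)) y \<partial>M) \<longlonglongrightarrow> (\<integral>y. (0::real) \<partial>M)"
  proof (rule integral_dominated_convergence[where w = "\<lambda>_. 1"])
    show "indicator (reach V x - reach V (xs j)) \<in> borel_measurable M" for j
      using sets_reach[OF V] by (intro borel_measurable_indicator sets.Diff) auto
    show "AE y in M. (\<lambda>j. indicator (reach V x - reach V (xs j)) y :: real) \<longlonglongrightarrow> 0"
    proof (rule AE_I2, rule tendsto_eventually)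
      fix y
      show "\<forall>\<^sub>F j in sequentially. indicator (reach V x - reach V (xs j)) y = (0::real)"
      proof (cases "y \<in> reach V x")
        case True
        show ?thesis using reach_lsc[OF V x xs True] by eventually_elim auto
      qed auto
    qed
  qed (auto simp: indicator_def)
  moreover have "(\<integral>y. indicator (reach V x - reach V (xs j)) y \<partial>M) = gap V x (xs j)" for j
    using sets_reach[OF V] by (simp add: gap_def)
  ultimately show ?thesis by simp
qed

lemma gap_triangle: "open V \<Longrightarrow> gap V x z \<le> gap V x y + gap V y z"
  unfolding gap_def using sets_reach[of V] by (intro measure_le_add_of_subset_Un) auto

lemma measure_reach_le:
  assumes V: "open V"
  shows "measure M (reach V x) \<le> measure M (reach V y) + gap V x y"
  unfolding gap_def using sets_reach[OF V] by (intro measure_le_add_of_subset_Un) auto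

text \<open>\<open>x \<mapsto> \<mu>(reach V x)\<close> is lower semicontinuous and does not increase along orbits.\<close>

lemma measure_reach_const:
  assumes V: "open V" and x: "x \<in> X" and y: "y \<in> X"
  shows "measure M (reach V x) = measure M (reach V y)"
proof -
  have step: "measure M (reach V (f x)) \<le> measure M (reach V x)" for x
    using finite_measure_mono[OF reach_f_subset sets_reach[OF V]]
      measure_vimage_f[OF sets_reach[OF V]] by simp
  have orb: "measure M (reach V ((f ^^ n) y)) \<le> measure M (reach V y)" for n y
    by (induction n) (auto intro: order_trans[OF step])
  have "measure M (reach V x) \<le> measure M (reach V y)" if x: "x \<in> X" and y: "y \<in> X" for x y
  proof -
    have "x \<in> closure (range (\<lambda>i. (f ^^ i) y))" using closure_orbit[OF y] x by simp
    then obtain xs where xs: "\<And>j. xs j \<in> range (\<lambda>i. (f ^^ i) y)" "xs \<longlonglongrightarrow> x"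
      unfolding closure_sequential by blast
    have xsX: "xs j \<in> X" for j using xs(1)[of j] y by auto
    have "measure M (reach V x) \<le> measure M (reach V y) + gap V x (xs j)" for j
    proof -
      have "measure M (reach V (xs j)) \<le> measure M (reach V y)" using xs(1)[of j] orb by auto
      then show ?thesis using measure_reach_le[OF V, of x "xs j"] by linarith
    qed
    moreover have "(\<lambda>j. measure M (reach V y) + gap V x (xs j)) \<longlonglongrightarrow> measure M (reach V y) + 0"
      by (intro tendsto_intros gap_tendsto V x xsX xs)
    ultimately show ?thesis by (intro LIMSEQ_le_const[of _ "measure M (reach V y)"]) auto
  qed
  then show ?thesis using x y by (intro antisym) auto
qed

lemma gap_sym:
  assumes V: "open V" and "x \<in> X" "y \<in> X"
  shows "gap V x y = gap V y x"
proof -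
  have s: "reach V x \<in> sets M" "reach V y \<in> sets M" using sets_reach[OF V] by auto
  have "measure M (reach V x) = measure M (reach V x \<inter> reach V y) + gap V x y"
    unfolding gap_def using s by (subst finite_measure_Union[symmetric]) (auto intro!: arg_cong[of _ _ "measure M"])
  moreover have "measure M (reach V y) = measure M (reach V x \<inter> reach V y) + gap V y x"
    unfolding gap_def using s by (subst finite_measure_Union[symmetric]) (auto intro!: arg_cong[of _ _ "measure M"])
  ultimately show ?thesis using measure_reach_const[OF V assms(2,3)] by linarith
qed

text \<open>The inclusion \<open>reach_f_subset\<close> is one between sets of equal measure, by
  invariance and \<open>measure_reach_const\<close>.\<close>

lemma reach_f_null:
  assumes V: "open V" and x: "x \<in> X"
  shows "measure M (reach V x - (f -` reach V (f x) \<inter> X)) = 0"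
  using finite_measure_Diff[OF sets_reach[OF V, of x] sets_vimage_f[OF sets_reach[OF V, of "f x"]] reach_f_subset]
    measure_vimage_f[OF sets_reach[OF V, of "f x"]] measure_reach_const[OF V f_in[OF x] x] by simp

text \<open>Up to null sets the section at \<open>x\<close> is the preimage of the section at
  \<open>f x\<close>, and preimages keep their measure.\<close>

lemma gap_f:
  assumes V: "open V" and x: "x \<in> X" and y: "y \<in> X"
  shows "gap V (f x) (f y) = gap V x y"
proof -
  let ?A = "\<lambda>x. f -` reach V (f x) \<inter> X"
  have s: "reach V x \<in> sets M" "?A x \<in> sets M" for x using sets_reach[OF V] sets_vimage_f by auto
  have e: "gap V (f x) (f y) = measure M (?A x - ?A y)"
    unfolding gap_def using measure_vimage_f[of "reach V (f x) - reach V (f y)"] s(1)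
    by (simp add: vimage_Diff Diff_Int_distrib2)
  have "measure M (?A x - ?A y) \<le> gap V x y + measure M (reach V y - ?A y)"
    unfolding gap_def by (intro measure_le_add_of_subset_Un) (use s reach_f_subset[of V x] in auto)
  moreover have "gap V x y \<le> measure M (?A x - ?A y) + measure M (reach V x - ?A x)"
    unfolding gap_def by (intro measure_le_add_of_subset_Un) (use s reach_f_subset[of V y] in auto)
  ultimately show ?thesis using reach_f_null[OF V x] reach_f_null[OF V y] e by linarith
qed

lemma continuous_gap:
  assumes V: "open V" and y: "y \<in> X"
  shows "continuous_on X (\<lambda>x. gap V x y)"
  unfolding continuous_on_sequentially
proof (intro allI ballI impI)
  fix xs x assume x: "x \<in> X" and "(\<forall>n. xs n \<in> X) \<and> xs \<longlonglongrightarrow> x"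
  then have xs: "\<And>n. xs n \<in> X" "xs \<longlonglongrightarrow> x" by auto
  have "(\<lambda>j. gap V (xs j) y - gap V x y) \<longlonglongrightarrow> 0"
  proof (rule Lim_null_comparison[OF always_eventually gap_tendsto[OF V x xs]], rule allI)
    show "norm (gap V (xs j) y - gap V x y) \<le> gap V x (xs j)" for j
      using gap_triangle[OF V, of x y "xs j"] gap_triangle[OF V, of "xs j" y x] gap_sym[OF V x xs(1)[of j]]
      by (simp add: abs_if)
  qed
  then show "((\<lambda>x. gap V x y) \<circ> xs) \<longlonglongrightarrow> gap V x y"
    by (simp add: comp_def Lim_null[symmetric])
qed

lemma funpow_map_prod: "(map_prod f f ^^ k) (x, y) = ((f ^^ k) x, (f ^^ k) y)"
  by (induction k) auto

text \<open>If all gaps vanished, all sections would agree up to null sets. The section at a first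
  coordinate \<open>a\<close> of a point of U misses an open set \<open>U2\<close>, and transport
  along the orbit shows that the sections miss almost all of \<open>X\<close>. But minimality brings
  \<open>a\<close> into \<open>V1\<close>, so its section contains a preimage of \<open>V2\<close>,
  which has positive measure.\<close>

lemma gap_nonzero:
  assumes nwm: "\<not> topologically_weakly_mixing X f"
  obtains V x y where "open V" "x \<in> X" "y \<in> X" "gap V x y \<noteq> 0"
proof -
  obtain U V where UV: "openin (top_of_set (X \<times> X)) U" "U \<noteq> {}" "openin (top_of_set (X \<times> X)) V" "V \<noteq> {}"
    and disj: "\<And>k. k \<ge> 1 \<Longrightarrow> (map_prod f f ^^ k) ` U \<inter> V = {}"
    using nwm unfolding topologically_weakly_mixing_def topologically_transitive_def by blast
  obtain U' V' where U': "open U'" "U = X \<times> X \<inter> U'" and V': "open V'" "V = X \<times> X \<inter> V'"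
    using UV unfolding openin_open by blast
  obtain a b where ab: "a \<in> X" "b \<in> X" "(a, b) \<in> U'" using UV(2) U'(2) by auto
  obtain c d where cd: "c \<in> X" "d \<in> X" "(c, d) \<in> V'" using UV(4) V'(2) by auto
  obtain U1 U2 where U12: "open U1" "open U2" "(a, b) \<in> U1 \<times> U2" "U1 \<times> U2 \<subseteq> U'"
    using open_prod_elim[OF U'(1) ab(3)] by blast
  obtain V1 V2 where V12: "open V1" "open V2" "(c, d) \<in> V1 \<times> V2" "V1 \<times> V2 \<subseteq> V'"
    using open_prod_elim[OF V'(1) cd(3)] by blast
  have "\<exists>x\<in>X. \<exists>y\<in>X. gap V' x y \<noteq> 0"
  proof (rule ccontr)
    assume "\<not> ?thesis"
    then have 0: "gap V' x y = 0" if "x \<in> X" "y \<in> X" for x y using that by blast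
    have s: "reach V' x \<in> sets M" for x using sets_reach[OF V'(1)] .
    have sU: "(f ^^ n) -` (X \<inter> U2) \<inter> X \<in> sets M" for n
      by (intro sets_vimage_funpow sets_open U12)
    have empty: "reach V' a \<inter> U2 = {}"
    proof (rule ccontr)
      assume "\<not> ?thesis"
      then obtain y k where y: "y \<in> X" "y \<in> U2" "k \<ge> 1" "((f ^^ k) a, (f ^^ k) y) \<in> V'"
        by (auto simp: reach_def)
      have "(a, y) \<in> U" using y U12 ab U' by auto
      moreover have "(map_prod f f ^^ k) (a, y) \<in> V" using y ab V' by (simp add: funpow_map_prod)
      ultimately show False using disj[OF y(3)] by blast
    qed
    \<comment> \<open>For \<open>n = 0\<close> the section at \<open>x\<close> is compared with the
      one at \<open>a\<close>; the induction step pulls back under \<open>f\<close> and discards the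
      null set of \<open>reach_f_null\<close>.\<close>
    have null: "measure M (reach V' x \<inter> ((f ^^ n) -` (X \<inter> U2) \<inter> X)) = 0" if "x \<in> X" for n x
      using that
    proof (induction n arbitrary: x)
      case 0
      have "measure M (reach V' x \<inter> ((f ^^ 0) -` (X \<inter> U2) \<inter> X)) \<le> gap V' x a + measure M {}"
        unfolding gap_def by (intro measure_le_add_of_subset_Un) (use s empty in auto)
      then show ?case using 0 \<open>\<And>x y. x \<in> X \<Longrightarrow> y \<in> X \<Longrightarrow> gap V' x y = 0\<close>[OF 0 ab(1)]
        by (simp add: measure_le_0_iff)
    next
      case (Suc n)
      let ?B = "reach V' (f x) \<inter> ((f ^^ n) -` (X \<inter> U2) \<inter> X)"
      have B: "?B \<in> sets M" using s sU by blast
      have "measure M (reach V' x \<inter> ((f ^^ Suc n) -` (X \<inter> U2) \<inter> X))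
          \<le> measure M (reach V' x - (f -` reach V' (f x) \<inter> X)) + measure M (f -` ?B \<inter> X)"
      proof (intro measure_le_add_of_subset_Un)
        show "reach V' x - (f -` reach V' (f x) \<inter> X) \<in> sets M" using s sets_vimage_f by blast
        show "f -` ?B \<inter> X \<in> sets M" using B by (rule sets_vimage_f)
        show "reach V' x \<inter> ((f ^^ Suc n) -` (X \<inter> U2) \<inter> X)
            \<subseteq> reach V' x - (f -` reach V' (f x) \<inter> X) \<union> (f -` ?B \<inter> X)"
          by (auto simp: funpow_swap1)
      qed
      then show ?case
        using reach_f_null[OF V'(1) Suc.prems] measure_vimage_f[OF B] Suc.IH[OF f_in[OF Suc.prems]]
          measure_nonneg[of M "reach V' x \<inter> ((f ^^ Suc n) -` (X \<inter> U2) \<inter> X)"] by linarith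
    qed
    have reach0: "measure M (reach V' x) = 0" if x: "x \<in> X" for x
    proof (rule measure_zero_of_subset_UN[of "\<lambda>n. reach V' x \<inter> ((f ^^ n) -` (X \<inter> U2) \<inter> X)"])
      show "reach V' x \<subseteq> (\<Union>n. reach V' x \<inter> ((f ^^ n) -` (X \<inter> U2) \<inter> X))"
      proof
        fix y assume y: "y \<in> reach V' x"
        then have yX: "y \<in> X" using reach_subset by blast
        obtain n where "(f ^^ n) y \<in> U2" using orbit_hits[OF U12(2) _ ab(2) yX] U12(3) by auto
        then show "y \<in> (\<Union>n. reach V' x \<inter> ((f ^^ n) -` (X \<inter> U2) \<inter> X))" using y yX by auto
      qed
    qed (use s sU null[OF x] in blast)+
    \<comment> \<open>Starting from \<open>f a\<close> makes the visiting time \<open>Suc n\<close>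
      positive, as \<open>reach\<close> demands.\<close>
    obtain n where n: "(f ^^ n) (f a) \<in> V1" using orbit_hits[OF V12(1) _ cd(1) f_in[OF ab(1)]] V12(3) by auto
    have "(f ^^ Suc n) -` (X \<inter> V2) \<inter> X \<subseteq> reach V' a"
      using n V12 by (auto simp: reach_def funpow_swap1 intro!: exI[of _ "Suc n"])
    then have "measure M ((f ^^ Suc n) -` (X \<inter> V2) \<inter> X) \<le> measure M (reach V' a)"
      by (intro finite_measure_mono s)
    then have "measure M (X \<inter> V2) \<le> 0"
      using measure_vimage_funpow[OF sets_open[OF V12(2)], of "Suc n"] reach0[OF ab(1)] by simp
    then show False using full_support[OF V12(2) _ cd(2)] V12(3) by auto
  qed
  then show ?thesis using that V'(1) by blast
qed

end

subsection \<open>Almost periodicity and existence of an eigenfunction\<close>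

definition unity_root :: "nat \<Rightarrow> nat \<Rightarrow> complex" where
  "unity_root m j = exp (2 * of_real pi * \<i> * of_nat j / of_nat m)"

lemma norm_unity_root [simp]: "norm (unity_root m j) = 1"
  by (simp add: unity_root_def norm_exp_eq_Re)

lemma unity_root_power: "unity_root m j ^ e = unity_root m e ^ j"
  by (simp add: unity_root_def exp_of_nat_mult[symmetric] mult_ac)

lemma unity_root_pow_self: "m > 0 \<Longrightarrow> unity_root m j ^ m = 1"
  unfolding unity_root_def using complex_root_unity[of m j] by simp

lemma unity_root_inj: "m > 0 \<Longrightarrow> j < m \<Longrightarrow> e < m \<Longrightarrow> unity_root m j = unity_root m e \<Longrightarrow> j = e"
  unfolding unity_root_def using complex_root_unity_eq[of m j e] by (simp add: cong_def)

lemma unity_root_orthogonal: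
  assumes "e < m" "e' < m"
  shows "(\<Sum>j<m. unity_root m j ^ e * cnj (unity_root m j ^ e')) = (if e = e' then of_nat m else 0)"
proof -
  define z where "z = unity_root m e * cnj (unity_root m e')"
  have m: "m > 0" using assms by simp
  have zj: "unity_root m j ^ e * cnj (unity_root m j ^ e') = z ^ j" for j
    unfolding z_def power_mult_distrib unity_root_power[of m j] complex_cnj_power ..
  show ?thesis
  proof (cases "e = e'")
    case True
    have "z = 1" unfolding z_def True using cnj_mult_unit(1)[OF norm_unity_root] .
    then show ?thesis unfolding zj using True by simp
  next
    case False
    have "z \<noteq> 1"
    proof
      assume "z = 1"
      then have "unity_root m e' = unity_root m e * (cnj (unity_root m e') * unity_root m e')"
        unfolding z_def by (simp add: mult.assoc[symmetric])
      then have "unity_root m e' = unity_root m e" using cnj_mult_unit(2)[OF norm_unity_root, of m e'] by simp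
      then show False using unity_root_inj[OF m assms(2,1)] False by simp
    qed
    moreover have "z ^ m = 1"
      unfolding z_def power_mult_distrib complex_cnj_power[symmetric] unity_root_pow_self[OF m] by simp
    ultimately show ?thesis unfolding zj using False geometric_sum[of z m] by simp
  qed
qed

lemma discrete_Parseval:
  fixes c :: "nat \<Rightarrow> complex"
  shows "(\<Sum>j<m. (norm (\<Sum>e<m. c e * unity_root m j ^ e))\<^sup>2) = real m * (\<Sum>e<m. (norm (c e))\<^sup>2)"
proof -
  have "of_real (\<Sum>j<m. (norm (\<Sum>e<m. c e * unity_root m j ^ e))\<^sup>2)
    = (\<Sum>j<m. (\<Sum>e<m. \<Sum>e'<m. (c e * cnj (c e')) * (unity_root m j ^ e * cnj (unity_root m j ^ e'))))"
    unfolding of_real_sum complex_norm_square cnj_sum sum_product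
    by (intro sum.cong refl) (simp add: mult_ac)
  also have "\<dots> = (\<Sum>e<m. \<Sum>e'<m. (\<Sum>j<m. (c e * cnj (c e')) * (unity_root m j ^ e * cnj (unity_root m j ^ e'))))"
    by (subst sum.swap, rule sum.cong[OF refl], rule sum.swap)
  also have "\<dots> = (\<Sum>e<m. \<Sum>e'<m. (c e * cnj (c e')) * (if e = e' then of_nat m else 0))"
    by (intro sum.cong refl) (simp add: sum_distrib_left[symmetric] unity_root_orthogonal del: complex_cnj_power)
  also have "\<dots> = (\<Sum>e<m. c e * cnj (c e) * of_nat m)"
    by (intro sum.cong refl) (simp add: if_distrib sum.delta cong: if_cong)
  also have "\<dots> = of_real (real m * (\<Sum>e<m. (norm (c e))\<^sup>2))"
    unfolding of_real_mult of_real_sum complex_norm_square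
    by (simp add: sum_distrib_left mult.commute)
  finally show ?thesis by (simp only: of_real_eq_iff)
qed

context invariant_prob
begin

lemma integral_pos:
  fixes u :: "'a \<Rightarrow> real"
  assumes u: "continuous_on X u" "\<And>x. x \<in> X \<Longrightarrow> 0 \<le> u x" and x: "x \<in> X" "0 < u x"
    and supp: "\<And>U y. open U \<Longrightarrow> y \<in> U \<Longrightarrow> y \<in> X \<Longrightarrow> 0 < measure M (X \<inter> U)"
  shows "0 < (\<integral>x. u x \<partial>M)"
proof -
  have "openin (top_of_set X) (X \<inter> u -` {u x / 2<..})"
    by (rule continuous_openin_preimage_gen[OF u(1)]) auto
  then obtain U where U: "open U" "X \<inter> u -` {u x / 2<..} = X \<inter> U" unfolding openin_open by blast
  have "x \<in> U" using U(2) x by auto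
  then have "0 < u x / 2 * measure M (X \<inter> U)" using supp[OF U(1) _ x(1)] x(2) by simp
  also have "\<dots> = (\<integral>y. u x / 2 * indicator (X \<inter> U) y \<partial>M)" using sets_open[OF U(1)] by simp
  also have "\<dots> \<le> (\<integral>y. u y \<partial>M)"
  proof (rule integral_mono)
    show "integrable M (\<lambda>y. u x / 2 * indicator (X \<inter> U) y)"
      using sets_open[OF U(1)] by (intro integrable_mult_right integrable_real_indicator) (auto simp: emeasure_eq_measure)
    show "u x / 2 * indicator (X \<inter> U) y \<le> u y" if "y \<in> space M" for y
    proof (cases "y \<in> X \<inter> U")
      case True
      then show ?thesis unfolding U(2)[symmetric] by simp
    next
      case False
      then show ?thesis using that u(2)[of y] by (simp add: space_M)
    qed
  qed (rule integrable_continuous[OF u(1)])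
  finally show ?thesis .
qed

end

text \<open>To be instantiated with \<open>k = gap V\<close>. Different points may have distance 0,
  so compactness and density of orbits are taken from the metric of \<open>X\<close> and transferred
  by \<open>k_cont\<close>.\<close>

locale isometric_pseudometric = minimal_measure X f M
  for X :: "'a::metric_space set" and f M +
  fixes k :: "'a \<Rightarrow> 'a \<Rightarrow> real"
  assumes k_refl [simp]: "k x x = 0"
    and k_sym: "x \<in> X \<Longrightarrow> y \<in> X \<Longrightarrow> k x y = k y x"
    and k_triangle: "x \<in> X \<Longrightarrow> y \<in> X \<Longrightarrow> z \<in> X \<Longrightarrow> k x z \<le> k x y + k y z"
    and k_f: "x \<in> X \<Longrightarrow> y \<in> X \<Longrightarrow> k (f x) (f y) = k x y"
    and k_cont: "y \<in> X \<Longrightarrow> continuous_on X (\<lambda>x. k x y)"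
begin

lemma k_diff: "x \<in> X \<Longrightarrow> y \<in> X \<Longrightarrow> z \<in> X \<Longrightarrow> \<bar>k x z - k y z\<bar> \<le> k x y"
  using k_triangle[of x y z] k_triangle[of y x z] k_sym[of x y] by linarith

lemma k_funpow: "x \<in> X \<Longrightarrow> y \<in> X \<Longrightarrow> k ((f ^^ n) x) ((f ^^ n) y) = k x y"
  by (induction n) (auto simp: k_f)

lemma k_tendsto:
  assumes "x \<in> X" "\<And>j :: nat. xs j \<in> X" "xs \<longlonglongrightarrow> x"
  shows "(\<lambda>j. k (xs j) x) \<longlonglongrightarrow> 0"
  using continuous_on_tendsto_compose[OF k_cont[OF assms(1)] assms(3,1)] assms(2) by simp

lemma k_lipschitz_continuous:
  fixes u :: "'a \<Rightarrow> 'b::real_normed_vector"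
  assumes "\<And>x y. x \<in> X \<Longrightarrow> y \<in> X \<Longrightarrow> norm (u x - u y) \<le> k x y"
  shows "continuous_on X u"
  unfolding continuous_on_sequentially
proof (intro allI ballI impI)
  fix xs x assume x: "x \<in> X" and "(\<forall>n. xs n \<in> X) \<and> xs \<longlonglongrightarrow> x"
  then have xs: "\<And>n. xs n \<in> X" "xs \<longlonglongrightarrow> x" by auto
  have "(\<lambda>j. u (xs j) - u x) \<longlonglongrightarrow> 0"
    by (rule Lim_null_comparison[OF always_eventually k_tendsto[OF x xs]]) (use assms x xs in blast)
  then show "(u \<circ> xs) \<longlonglongrightarrow> u x" by (simp add: comp_def Lim_null[symmetric])
qed

lemma k_ball_open:
  assumes "p \<in> X"
  obtains U where "open U" "X \<inter> U = {x \<in> X. k x p < e}"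
proof -
  have "openin (top_of_set X) (X \<inter> (\<lambda>x. k x p) -` {..<e})"
    by (rule continuous_openin_preimage_gen[OF k_cont[OF assms]]) auto
  then obtain U where "open U" "X \<inter> (\<lambda>x. k x p) -` {..<e} = X \<inter> U" unfolding openin_open by blast
  then show ?thesis by (intro that[of U]) auto
qed

lemma k_net:
  assumes e: "0 < e"
  obtains P where "finite P" "P \<subseteq> X" "\<And>x. x \<in> X \<Longrightarrow> \<exists>p\<in>P. k x p < e"
proof -
  have "\<forall>p\<in>X. \<exists>U. open U \<and> X \<inter> U = {x \<in> X. k x p < e}" using k_ball_open by metis
  then obtain U where U: "\<And>p. p \<in> X \<Longrightarrow> open (U p) \<and> X \<inter> U p = {x \<in> X. k x p < e}" by metis
  have "X \<subseteq> (\<Union>p\<in>X. U p)"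
  proof
    fix x assume x: "x \<in> X"
    then have "x \<in> X \<inter> U x" using U[OF x] e by simp
    then show "x \<in> (\<Union>p\<in>X. U p)" using x by blast
  qed
  then obtain P where P: "P \<subseteq> X" "finite P" "X \<subseteq> (\<Union>p\<in>P. U p)"
    using compactE_image[OF compact, of X U] U by blast
  show ?thesis
  proof (rule that[OF P(2,1)])
    fix x assume x: "x \<in> X"
    then obtain p where "p \<in> P" "x \<in> U p" using P(3) by blast
    then show "\<exists>p\<in>P. k x p < e" using U[of p] P(1) x by blast
  qed
qed

text \<open>Pigeonhole: orbit points in the same cell of a net differ by an almost period.\<close>

lemma almost_periods:
  assumes e: "0 < e" and y: "y \<in> X"
  obtains L :: nat where "0 < L" "\<And>R. R \<le> L * card {d. d < R \<and> k ((f ^^ d) y) y < e}"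
proof -
  obtain P where P: "finite P" "P \<subseteq> X" "\<And>x. x \<in> X \<Longrightarrow> \<exists>p\<in>P. k x p < e / 2"
    using k_net[of "e/2"] e by auto
  have "P \<noteq> {}" using P(3)[OF y] by blast
  then have L: "0 < card P" using P(1) by (simp add: card_gt_0_iff)
  have "R \<le> card P * card {d. d < R \<and> k ((f ^^ d) y) y < e}" for R
  proof -
    define D where "D = {d. d < R \<and> k ((f ^^ d) y) y < e}"
    define C where "C p = {n. n < R \<and> k ((f ^^ n) y) p < e / 2}" for p
    have fin: "finite D" "finite (C p)" for p unfolding D_def C_def by auto
    have "card (C p) \<le> card D" if p: "p \<in> P" for p
    proof (cases "C p = {}")
      case False
      \<comment> \<open>With the least element as base point, the subtraction of natural numbers is
        genuine and stays below \<open>R\<close>. Each cell thus embeds into the almost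
        periods.\<close>
      define n0 where "n0 = Min (C p)"
      have n0: "n0 \<in> C p" "\<And>n. n \<in> C p \<Longrightarrow> n0 \<le> n" unfolding n0_def using False fin by auto
      have pX: "p \<in> X" using p P(2) by blast
      have "(\<lambda>n. n - n0) ` C p \<subseteq> D"
      proof
        fix d assume "d \<in> (\<lambda>n. n - n0) ` C p"
        then obtain n where n: "n \<in> C p" "d = n - n0" by blast
        have nn: "n = n0 + d" using n n0(2)[OF n(1)] by simp
        have "k ((f ^^ d) y) y = k ((f ^^ n0) ((f ^^ d) y)) ((f ^^ n0) y)"
          using k_funpow[of "(f ^^ d) y" y n0] y by simp
        also have "\<dots> = k ((f ^^ n) y) ((f ^^ n0) y)" unfolding nn funpow_add by simp
        also have "\<dots> \<le> k ((f ^^ n) y) p + k ((f ^^ n0) y) p"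
          using k_triangle[of "(f ^^ n) y" p "(f ^^ n0) y"] k_sym[of p "(f ^^ n0) y"] y pX by simp
        also have "\<dots> < e" using n(1) n0(1) unfolding C_def by simp
        finally have "k ((f ^^ d) y) y < e" .
        moreover have "n < R" using n(1) unfolding C_def by simp
        ultimately show "d \<in> D" using nn unfolding D_def by simp
      qed
      moreover have "inj_on (\<lambda>n. n - n0) (C p)"
        using n0(2) by (intro inj_onI) (metis le_add_diff_inverse)
      ultimately show ?thesis using card_inj_on_le fin by blast
    qed simp
    then have "(\<Sum>p\<in>P. card (C p)) \<le> card P * card D"
      using sum_bounded_above[of P "\<lambda>p. card (C p)" "card D"] by simp
    moreover have "{..<R} \<subseteq> (\<Union>p\<in>P. C p)" using P(3) y unfolding C_def by auto
    then have "R \<le> card (\<Union>p\<in>P. C p)" using card_mono[of "\<Union>p\<in>P. C p" "{..<R}"] P(1) fin by auto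
    moreover have "card (\<Union>p\<in>P. C p) \<le> (\<Sum>p\<in>P. card (C p))" by (rule card_UN_le[OF P(1)])
    ultimately show ?thesis unfolding D_def by linarith
  qed
  then show ?thesis using that L by blast
qed

text \<open>The displacement by \<open>f ^^ d\<close> is continuous, and invariant because
  \<open>f\<close> preserves \<open>k\<close>. Hence an almost period at one point is an almost
  period everywhere, which is what integrals over \<open>X\<close> need.\<close>

lemma k_funpow_const:
  assumes x: "x \<in> X" and y: "y \<in> X"
  shows "k ((f ^^ d) x) x = k ((f ^^ d) y) y"
proof (rule invariant_const[OF _ _ x y])
  show "continuous_on X (\<lambda>x. k ((f ^^ d) x) x)"
    unfolding continuous_on_sequentially
  proof (intro allI ballI impI)
    fix xs x assume x: "x \<in> X" and "(\<forall>n. xs n \<in> X) \<and> xs \<longlonglongrightarrow> x"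
    then have xs: "\<And>n. xs n \<in> X" "xs \<longlonglongrightarrow> x" by auto
    have "(\<lambda>j. k ((f ^^ d) (xs j)) (xs j) - k ((f ^^ d) x) x) \<longlonglongrightarrow> 0"
    proof (rule Lim_null_comparison[OF always_eventually])
      show "(\<lambda>j. 2 * k (xs j) x) \<longlonglongrightarrow> 0" using tendsto_mult_right[OF k_tendsto[OF x xs], of 2] by simp
      show "\<forall>j. norm (k ((f ^^ d) (xs j)) (xs j) - k ((f ^^ d) x) x) \<le> 2 * k (xs j) x"
      proof
        fix j
        have "\<bar>k ((f ^^ d) (xs j)) (xs j) - k ((f ^^ d) x) (xs j)\<bar> \<le> k (xs j) x"
          using k_diff[of "(f ^^ d) (xs j)" "(f ^^ d) x" "xs j"] k_funpow[OF xs(1) x] xs x by simp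
        moreover have "\<bar>k ((f ^^ d) x) (xs j) - k ((f ^^ d) x) x\<bar> \<le> k (xs j) x"
          using k_diff[of "xs j" x "(f ^^ d) x"] k_sym[of "(f ^^ d) x"] xs x by simp
        ultimately show "norm (k ((f ^^ d) (xs j)) (xs j) - k ((f ^^ d) x) x) \<le> 2 * k (xs j) x"
          unfolding real_norm_def by linarith
      qed
    qed
    then show "((\<lambda>x. k ((f ^^ d) x) x) \<circ> xs) \<longlonglongrightarrow> k ((f ^^ d) x) x"
      by (simp add: comp_def Lim_null[symmetric])
  qed
  show "k ((f ^^ d) (f x)) (f x) = k ((f ^^ d) x) x" if "x \<in> X" for x
    using k_f[of "(f ^^ d) x" x] that by (simp add: funpow_swap1)
qed

end

lemma sum_if_less:
  fixes a :: "nat \<Rightarrow> 'b::comm_monoid_add"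
  assumes "N \<le> m"
  shows "(\<Sum>e<m. if e < N then a e else 0) = (\<Sum>e<N. a e)"
proof -
  have "{..<m} \<inter> {e. e < N} = {..<N}" using assms by auto
  then show ?thesis by (simp add: sum.If_cases)
qed

context minimal_measure
begin

lemma integral_funpow:
  fixes u :: "'a \<Rightarrow> 'b::{banach, second_countable_topology}"
  assumes u: "continuous_on X u"
  shows "(\<integral>x. u ((f ^^ n) x) \<partial>M) = (\<integral>x. u x \<partial>M)"
proof (induction n)
  case (Suc n)
  have "(\<integral>x. u ((f ^^ n) (f x)) \<partial>M) = (\<integral>x. u ((f ^^ n) x) \<partial>M)"
    by (intro integral_f measurable_continuous continuous_on_iterate u)
  then show ?case using Suc by (simp add: funpow_swap1)
qed simp

end

context isometric_pseudometric
begin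

text \<open>The squares \<open>F j\<close> of the \<open>L\<^sup>2\<close> norms of the exponential sums at the \<open>4R\<close>-th roots of unity
  are, up to a phase, the values of a trigonometric polynomial whose coefficients are multiples of
  the correlations \<open>\<gamma> d\<close>. By Parseval \<open>\<Sum>\<^sub>j (F j)\<^sup>2\<close> is large, since many \<open>\<gamma> d\<close> are close to \<open>\<gamma> 0\<close>,
  while \<open>\<Sum>\<^sub>j F j\<close> is explicit; hence some \<open>F j\<close> is large.\<close>

lemma exponential_sum_large:
  fixes g :: "'a \<Rightarrow> real"
  assumes lip: "\<And>x y. x \<in> X \<Longrightarrow> y \<in> X \<Longrightarrow> \<bar>g x - g y\<bar> \<le> k x y"
    and y: "y \<in> X" "g y \<noteq> 0"
  obtains \<delta> where "0 < \<delta>"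
    "\<And>R. 0 < R \<Longrightarrow> \<exists>(l::complex) x. norm l = 1 \<and> x \<in> X \<and> real (2 * R) * \<delta> \<le> norm (\<Sum>n<2 * R. of_real (g ((f ^^ n) x)) * l ^ n)"
proof -
  have g: "continuous_on X g" using k_lipschitz_continuous[of g] lip by simp
  note gn = continuous_on_iterate[OF g]
  obtain G where G: "\<And>x. x \<in> X \<Longrightarrow> \<bar>g x\<bar> \<le> G" "0 < G"
    using compact_imp_bounded[OF compact_continuous_image[OF g compact]] bounded_pos[of "g ` X"] by auto
  define \<gamma> where "\<gamma> d = (\<integral>x. g ((f ^^ d) x) * g x \<partial>M)" for d
  have g0: "0 < \<gamma> 0"
  proof -
    have "0 < (\<integral>x. g x * g x \<partial>M)"
      by (rule integral_pos[OF _ _ y(1)]) (use y full_support in \<open>auto intro!: continuous_intros g simp: zero_less_mult_iff linorder_neq_iff\<close>)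
    then show ?thesis by (simp add: \<gamma>_def)
  qed
  have \<gamma>_shift: "(\<integral>x. g ((f ^^ n) x) * g ((f ^^ n') x) \<partial>M) = \<gamma> d" if "n = n' + d" for n n' d
  proof -
    have "(\<integral>x. g ((f ^^ n) x) * g ((f ^^ n') x) \<partial>M) = (\<integral>x. (\<lambda>x. g ((f ^^ d) x) * g x) ((f ^^ n') x) \<partial>M)"
      unfolding that funpow_add add.commute[of n' d] by simp
    also have "\<dots> = \<gamma> d" unfolding \<gamma>_def by (rule integral_funpow) (intro continuous_intros g gn)
    finally show ?thesis .
  qed
  \<comment> \<open>Since \<open>|g| \<le> G\<close>, a displacement below
    \<open>\<gamma> 0 / (2 * G)\<close> changes the correlation by at most
    \<open>\<gamma> 0 / 2\<close>.\<close>
  have almost: "\<gamma> 0 / 2 \<le> \<gamma> d" if "k ((f ^^ d) y) y < \<gamma> 0 / (2 * G)" for d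
  proof -
    have "\<gamma> 0 - \<gamma> d = (\<integral>x. g x * g x - g ((f ^^ d) x) * g x \<partial>M)"
      unfolding \<gamma>_def
      by (subst Bochner_Integration.integral_diff) (auto intro!: integrable_continuous continuous_intros g gn)
    also have "\<dots> \<le> (\<integral>x. \<gamma> 0 / 2 \<partial>M)"
    proof (rule integral_mono)
      fix x assume "x \<in> space M"
      then have x: "x \<in> X" by (simp add: space_M)
      have "\<bar>g x - g ((f ^^ d) x)\<bar> \<le> \<gamma> 0 / (2 * G)"
        using lip[of "(f ^^ d) x" x] k_funpow_const[OF x y(1), of d] that x by (simp add: abs_minus_commute)
      then have "\<bar>g x - g ((f ^^ d) x)\<bar> * \<bar>g x\<bar> \<le> \<gamma> 0 / (2 * G) * G"
        using G(1)[OF x] G(2) g0 by (intro mult_mono) auto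
      then have "\<bar>(g x - g ((f ^^ d) x)) * g x\<bar> \<le> \<gamma> 0 / 2" using G(2) by (simp add: abs_mult)
      then have "(g x - g ((f ^^ d) x)) * g x \<le> \<gamma> 0 / 2" by linarith
      then show "g x * g x - g ((f ^^ d) x) * g x \<le> \<gamma> 0 / 2" by (simp only: left_diff_distrib)
    qed (auto intro!: integrable_continuous continuous_intros g gn)
    also have "\<dots> = \<gamma> 0 / 2" using prob_space by simp
    finally show ?thesis by linarith
  qed
  obtain L where L: "0 < L" "\<And>R. R \<le> L * card {d. d < R \<and> k ((f ^^ d) y) y < \<gamma> 0 / (2 * G)}"
    using almost_periods[of "\<gamma> 0 / (2 * G)" y] g0 G(2) y(1) by auto
  \<comment> \<open>Chosen so that the final chain bounds \<open>card D * \<gamma> 0\<close> by half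
    of itself.\<close>
  define \<delta> where "\<delta> = sqrt (\<gamma> 0 / (64 * real L))"
  have \<delta>: "0 < \<delta>" "\<delta>\<^sup>2 = \<gamma> 0 / (64 * real L)" using g0 L(1) by (auto simp: \<delta>_def)
  have "\<exists>(l::complex) x. norm l = 1 \<and> x \<in> X \<and> real (2 * R) * \<delta> \<le> norm (\<Sum>n<2 * R. of_real (g ((f ^^ n) x)) * l ^ n)"
    if R: "0 < R" for R
  proof (rule ccontr)
    assume no: "\<not> ?thesis"
    define N where "N = 2 * R"
    \<comment> \<open>Twice the length, because the exponents \<open>ex p\<close> below run up to
      \<open>2 * N - 1\<close>: no two of them are identified modulo \<open>m\<close>, and Parseval
      sees every coefficient.\<close>
    define m where "m = 2 * N"
    define l where "l = unity_root m"
    define T where "T j x = (\<Sum>n<N. of_real (g ((f ^^ n) x)) * l j ^ n)" for j x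
    have nl: "norm (l j) = 1" for j by (simp add: l_def)
    have less: "norm (T j x) < real N * \<delta>" if "x \<in> X" for j x
    proof -
      have "\<not> real (2 * R) * \<delta> \<le> norm (\<Sum>n<2 * R. of_real (g ((f ^^ n) x)) * l j ^ n)"
        using no nl[of j] that by blast
      then show ?thesis unfolding T_def N_def by simp
    qed
    have contT: "continuous_on X (T j)" for j
      unfolding T_def[abs_def] by (intro continuous_intros gn)
    have contT2: "continuous_on X (\<lambda>x. (norm (T j x))\<^sup>2)" for j
      by (intro continuous_intros contT)
    define F where "F j = (\<integral>x. (norm (T j x))\<^sup>2 \<partial>M)" for j
    have F0: "0 \<le> F j" for j unfolding F_def by simp
    have F_le: "F j \<le> (real N * \<delta>)\<^sup>2" for j
    proof -
      have "F j \<le> (\<integral>x. (real N * \<delta>)\<^sup>2 \<partial>M)"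
        unfolding F_def
      proof (rule integral_mono)
        show "(norm (T j x))\<^sup>2 \<le> (real N * \<delta>)\<^sup>2" if "x \<in> space M" for x
          using less[of x j] that by (intro power_mono) (auto simp: space_M)
      qed (auto intro!: integrable_continuous contT2)
      then show ?thesis using prob_space by simp
    qed
    have sumF: "(\<Sum>j<m. F j) = real m * (real N * \<gamma> 0)"
    proof -
      have point: "(\<Sum>j<m. (norm (T j x))\<^sup>2) = real m * (\<Sum>n<N. g ((f ^^ n) x) * g ((f ^^ n) x))" for x
      proof -
        define c where "c e = (if e < N then complex_of_real (g ((f ^^ e) x)) else 0)" for e
        have "T j x = (\<Sum>e<m. c e * unity_root m j ^ e)" for j
        proof -
          have "(\<Sum>e<m. c e * unity_root m j ^ e) = (\<Sum>e<m. if e < N then of_real (g ((f ^^ e) x)) * l j ^ e else 0)"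
            by (intro sum.cong) (auto simp: c_def l_def)
          also have "\<dots> = T j x" unfolding T_def by (rule sum_if_less) (simp add: m_def)
          finally show ?thesis ..
        qed
        then have "(\<Sum>j<m. (norm (T j x))\<^sup>2) = real m * (\<Sum>e<m. (norm (c e))\<^sup>2)"
          using discrete_Parseval[of c m] by simp
        also have "(\<Sum>e<m. (norm (c e))\<^sup>2) = (\<Sum>e<m. if e < N then g ((f ^^ e) x) * g ((f ^^ e) x) else 0)"
          by (intro sum.cong) (auto simp: c_def power2_eq_square)
        also have "\<dots> = (\<Sum>n<N. g ((f ^^ n) x) * g ((f ^^ n) x))" by (rule sum_if_less) (simp add: m_def)
        finally show ?thesis .
      qed
      have "(\<Sum>j<m. F j) = (\<integral>x. (\<Sum>j<m. (norm (T j x))\<^sup>2) \<partial>M)"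
        unfolding F_def by (subst Bochner_Integration.integral_sum) (auto intro!: integrable_continuous contT2)
      also have "\<dots> = real m * (\<Sum>n<N. \<integral>x. g ((f ^^ n) x) * g ((f ^^ n) x) \<partial>M)"
        unfolding point
        by (subst integral_mult_right_zero, subst Bochner_Integration.integral_sum)
           (auto intro!: integrable_continuous continuous_intros gn)
      also have "\<dots> = real m * (real N * \<gamma> 0)" using \<gamma>_shift[of _ _ 0] by simp
      finally show ?thesis .
    qed
    define S where "S = {..<N} \<times> {..<N}"
    \<comment> \<open>In \<open>|T|^2\<close> the exponents are the differences of two times. The
      unimodular factor \<open>l j ^ N\<close> shifts them by \<open>N\<close> into the natural
      numbers without changing moduli.\<close>
    define ex where "ex p = fst p + (N - snd p)" for p :: "nat \<times> nat"
    define \<Gamma> where "\<Gamma> p = (\<integral>x. g ((f ^^ fst p) x) * g ((f ^^ snd p) x) \<partial>M)" for p :: "nat \<times> nat"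
    define c where "c e = (\<Sum>p\<in>{p \<in> S. ex p = e}. complex_of_real (\<Gamma> p))" for e
    have F_eq: "F j = norm (\<Sum>e<m. c e * unity_root m j ^ e)" for j
    proof -
      have point: "of_real ((norm (T j x))\<^sup>2) * l j ^ N
        = (\<Sum>p\<in>S. of_real (g ((f ^^ fst p) x) * g ((f ^^ snd p) x)) * l j ^ ex p)" for x
      proof -
        have "of_real ((norm (T j x))\<^sup>2) * l j ^ N
          = (\<Sum>n<N. \<Sum>n'<N. of_real (g ((f ^^ n) x)) * l j ^ n * (of_real (g ((f ^^ n') x)) * cnj (l j) ^ n') * l j ^ N)"
          unfolding complex_norm_square T_def cnj_sum sum_product
          unfolding sum_distrib_right by simp
        also have "\<dots> = (\<Sum>n<N. \<Sum>n'<N. of_real (g ((f ^^ n) x) * g ((f ^^ n') x)) * l j ^ (n + (N - n')))"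
        proof (intro sum.cong refl)
          fix n n' assume "n' \<in> {..<N}"
          then have "l j ^ N = l j ^ n' * l j ^ (N - n')" by (simp add: power_add[symmetric])
          then have "cnj (l j) ^ n' * l j ^ N = (cnj (l j) * l j) ^ n' * l j ^ (N - n')"
            by (simp add: power_mult_distrib)
          also have "\<dots> = l j ^ (N - n')" unfolding cnj_mult_unit(2)[OF nl] by simp
          finally have *: "cnj (l j) ^ n' * l j ^ N = l j ^ (N - n')" .
          show "of_real (g ((f ^^ n) x)) * l j ^ n * (of_real (g ((f ^^ n') x)) * cnj (l j) ^ n') * l j ^ N
            = of_real (g ((f ^^ n) x) * g ((f ^^ n') x)) * l j ^ (n + (N - n'))"
            unfolding power_add *[symmetric] by simp
        qed
        also have "\<dots> = (\<Sum>p\<in>S. of_real (g ((f ^^ fst p) x) * g ((f ^^ snd p) x)) * l j ^ ex p)"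
          unfolding S_def ex_def sum.cartesian_product by (rule sum.cong) auto
        finally show ?thesis .
      qed
      have cp: "continuous_on X (\<lambda>x. complex_of_real (g ((f ^^ fst p) x) * g ((f ^^ snd p) x)) * l j ^ ex p)" for p
        by (intro continuous_intros gn)
      have "of_real (F j) * l j ^ N = (\<integral>x. of_real ((norm (T j x))\<^sup>2) * l j ^ N \<partial>M)"
        unfolding F_def by (simp only: integral_mult_left_zero integral_complex_of_real)
      also have "\<dots> = (\<Sum>p\<in>S. \<integral>x. complex_of_real (g ((f ^^ fst p) x) * g ((f ^^ snd p) x)) * l j ^ ex p \<partial>M)"
        unfolding point by (rule Bochner_Integration.integral_sum) (rule integrable_continuous[OF cp])
      also have "\<dots> = (\<Sum>p\<in>S. of_real (\<Gamma> p) * l j ^ ex p)"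
        unfolding \<Gamma>_def by (simp only: integral_mult_left_zero integral_complex_of_real)
      also have "\<dots> = (\<Sum>e<m. \<Sum>p\<in>{p \<in> S. ex p = e}. of_real (\<Gamma> p) * l j ^ ex p)"
        by (rule sum.group[symmetric]) (auto simp: S_def ex_def m_def)
      also have "\<dots> = (\<Sum>e<m. c e * unity_root m j ^ e)"
        unfolding c_def sum_distrib_right l_def by (intro sum.cong refl) auto
      finally have "norm (\<Sum>e<m. c e * unity_root m j ^ e) = norm (of_real (F j) * l j ^ N)" by simp
      then show ?thesis using F0[of j] nl[of j] by (simp add: norm_mult norm_power)
    qed
    define D where "D = {d. d < R \<and> k ((f ^^ d) y) y < \<gamma> 0 / (2 * G)}"
    have finD: "finite D" unfolding D_def by simp
    \<comment> \<open>The coefficient at \<open>N + d\<close> collects the pairs of times at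
      distance \<open>d\<close>. Since \<open>N = 2 * R\<close> and \<open>d < R\<close>, there are
      at least \<open>R\<close> of them, each contributing \<open>\<gamma> d\<close>.\<close>
    have c_large: "(real R * (\<gamma> 0 / 2))\<^sup>2 \<le> (norm (c (N + d)))\<^sup>2" if d: "d \<in> D" for d
    proof -
      let ?A = "{p \<in> S. ex p = N + d}"
      have "\<Gamma> p = \<gamma> d" if "p \<in> ?A" for p
        unfolding \<Gamma>_def by (rule \<gamma>_shift) (use that in \<open>auto simp: S_def ex_def\<close>)
      then have "c (N + d) = of_real (real (card ?A) * \<gamma> d)" unfolding c_def by simp
      moreover have "R \<le> card ?A"
      proof -
        have "(\<lambda>i. (i + d, i)) ` {..<R} \<subseteq> ?A" using d unfolding D_def S_def ex_def N_def by auto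
        moreover have "finite ?A" unfolding S_def by simp
        ultimately have "card ((\<lambda>i. (i + d, i)) ` {..<R}) \<le> card ?A" using card_mono by blast
        then show ?thesis by (subst (asm) card_image) (auto intro!: inj_onI)
      qed
      moreover have "\<gamma> 0 / 2 \<le> \<gamma> d" using almost d unfolding D_def by simp
      ultimately have "real R * (\<gamma> 0 / 2) \<le> norm (c (N + d))"
        using g0 by (simp only: norm_of_real) (intro order_trans[OF mult_mono abs_ge_self]; simp)
      then show ?thesis using g0 by (intro power_mono) auto
    qed
    have "real (card D) * (real R * (\<gamma> 0 / 2))\<^sup>2 \<le> (\<Sum>d\<in>D. (norm (c (N + d)))\<^sup>2)"
      using sum_mono[of D "\<lambda>_. (real R * (\<gamma> 0 / 2))\<^sup>2" "\<lambda>d. (norm (c (N + d)))\<^sup>2"] c_large by simp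
    also have "\<dots> = (\<Sum>e\<in>(+) N ` D. (norm (c e))\<^sup>2)"
      by (subst sum.reindex) (auto simp: inj_on_def)
    also have "\<dots> \<le> (\<Sum>e<m. (norm (c e))\<^sup>2)"
      by (rule sum_mono2) (auto simp: D_def m_def N_def)
    finally have low: "real m * (real (card D) * (real R * (\<gamma> 0 / 2))\<^sup>2) \<le> (\<Sum>j<m. (F j)\<^sup>2)"
      unfolding F_eq discrete_Parseval by (intro mult_left_mono) auto
    \<comment> \<open>One factor of each square is replaced by the assumed upper bound, so the
      exactly known sum of the \<open>F j\<close> bounds the sum of squares.\<close>
    have "(\<Sum>j<m. (F j)\<^sup>2) \<le> (\<Sum>j<m. (real N * \<delta>)\<^sup>2 * F j)"
      unfolding power2_eq_square[of "F _"] by (intro sum_mono mult_right_mono F_le F0)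
    also have "\<dots> = (real N * \<delta>)\<^sup>2 * (real m * (real N * \<gamma> 0))"
      unfolding sum_distrib_left[symmetric] sumF ..
    finally have "real m * (real (card D) * (real R * (\<gamma> 0 / 2))\<^sup>2) \<le> (real N * \<delta>)\<^sup>2 * (real m * (real N * \<gamma> 0))"
      using low by linarith
    then have "real m * (real (card D) * (real R * (\<gamma> 0 / 2))\<^sup>2) \<le> real m * ((real N * \<delta>)\<^sup>2 * (real N * \<gamma> 0))"
      by (simp only: mult.left_commute[of _ "real m"])
    then have "real (card D) * (real R * (\<gamma> 0 / 2))\<^sup>2 \<le> (real N * \<delta>)\<^sup>2 * (real N * \<gamma> 0)"
      by (rule mult_left_le_imp_le) (use R in \<open>simp add: m_def N_def\<close>)
    then have "(real R ^ 2 * \<gamma> 0) * (real (card D) * \<gamma> 0) \<le> (real R ^ 2 * \<gamma> 0) * (32 * real R * \<delta>\<^sup>2)"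
      unfolding N_def by (simp add: power2_eq_square field_simps)
    then have "real (card D) * \<gamma> 0 \<le> 32 * real R * \<delta>\<^sup>2"
      by (rule mult_left_le_imp_le) (use R g0 in simp)
    also have "\<dots> = real R * \<gamma> 0 / (2 * real L)" unfolding \<delta>(2) by simp
    also have "\<dots> \<le> real (L * card D) * \<gamma> 0 / (2 * real L)"
    proof -
      have "real R \<le> real (L * card D)" unfolding of_nat_le_iff D_def by (rule L(2))
      then show ?thesis using g0 by (intro divide_right_mono mult_right_mono) auto
    qed
    also have "\<dots> = real (card D) * \<gamma> 0 / 2" using L(1) by simp
    finally have "real (card D) * \<gamma> 0 \<le> 0" by (simp add: mult.commute)
    then have "card D = 0" using g0 by (simp add: mult_le_0_iff)
    then show False using L(2)[of R] R unfolding D_def[symmetric] by simp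
  qed
  with \<delta>(1) that show ?thesis by blast
qed

text \<open>The eigenfunction is a subsequential limit of normalized exponential sums; these are
  equicontinuous for \<open>k\<close>, and have integral 0, which excludes the eigenvalue 1.\<close>

lemma eigenfunction_exists:
  assumes nz: "x0 \<in> X" "y0 \<in> X" "k x0 y0 \<noteq> 0"
  obtains h :: "'a \<Rightarrow> complex" and l where "continuous_on X h" "\<And>x. x \<in> X \<Longrightarrow> norm (h x) = 1"
    "\<And>x. x \<in> X \<Longrightarrow> h (f x) = l * h x" "l \<noteq> 1"
proof -
  \<comment> \<open>Subtracting the mean gives integral 0 and keeps \<open>g\<close> 1-Lipschitz for
    \<open>k\<close>. Its values at \<open>x0\<close> and \<open>y0\<close> still differ by
    \<open>k x0 y0\<close>, so it does not vanish identically.\<close>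
  define g where "g x = k x y0 - (\<integral>x. k x y0 \<partial>M)" for x
  have lip: "\<bar>g x - g y\<bar> \<le> k x y" if "x \<in> X" "y \<in> X" for x y
    unfolding g_def using k_diff[OF that nz(2)] by simp
  have g: "continuous_on X g" using k_lipschitz_continuous[of g] lip by simp
  note gn = continuous_on_iterate[OF g]
  have int0: "(\<integral>x. g x \<partial>M) = 0"
    unfolding g_def using integrable_continuous[OF k_cont[OF nz(2)]] prob_space
    by (subst Bochner_Integration.integral_diff) auto
  have "\<exists>y\<in>X. g y \<noteq> 0"
  proof (rule ccontr)
    assume "\<not> ?thesis"
    then have "g x0 = g y0" using nz by simp
    then show False using nz unfolding g_def by simp
  qed
  then obtain y where y: "y \<in> X" "g y \<noteq> 0" by blast
  obtain \<delta> where \<delta>: "0 < \<delta>"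
    "\<And>R. 0 < R \<Longrightarrow> \<exists>(l::complex) x. norm l = 1 \<and> x \<in> X \<and> real (2 * R) * \<delta> \<le> norm (\<Sum>n<2 * R. of_real (g ((f ^^ n) x)) * l ^ n)"
    using exponential_sum_large[OF lip y] by blast
  obtain G where G: "\<And>x. x \<in> X \<Longrightarrow> \<bar>g x\<bar> \<le> G"
    using compact_imp_bounded[OF compact_continuous_image[OF g compact]] by (auto simp: bounded_iff)
  define N where "N j = 2 * Suc j" for j
  define good where "good j p \<longleftrightarrow> norm (fst p) = 1 \<and> snd p \<in> X \<and>
    real (N j) * \<delta> \<le> norm (\<Sum>n<N j. of_real (g ((f ^^ n) (snd p))) * fst p ^ n)" for j and p :: "complex \<times> 'a"
  have "\<exists>p. good j p" for j
    using \<delta>(2)[of "Suc j"] unfolding good_def N_def by fastforce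
  then obtain q where q: "\<And>j. good j (q j)" by metis
  define l xs where "l = fst \<circ> q" and "xs = snd \<circ> q"
  have lx: "\<And>j. norm (l j) = 1" "\<And>j. xs j \<in> X"
    "\<And>j. real (N j) * \<delta> \<le> norm (\<Sum>n<N j. of_real (g ((f ^^ n) (xs j))) * l j ^ n)"
    using q unfolding good_def l_def xs_def by simp_all
  define h where "h j x = (\<Sum>n<N j. of_real (g ((f ^^ n) x)) * l j ^ n) / of_nat (N j)" for j x
  have N: "0 < real (N j)" for j by (simp add: N_def)
  have h_large: "\<delta> \<le> norm (h j (xs j))" for j
    unfolding h_def using lx(3)[of j] N[of j] by (simp add: norm_divide pos_le_divide_eq mult.commute)
  have h_bound: "norm (h j x) \<le> G" if "x \<in> X" for j x
  proof -
    have "norm (\<Sum>n<N j. of_real (g ((f ^^ n) x)) * l j ^ n) \<le> real (card {..<N j}) * G"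
      using that G by (intro sum_norm_bound) (simp add: norm_mult norm_power lx)
    then show ?thesis unfolding h_def using N[of j] by (simp add: norm_divide pos_divide_le_eq mult.commute)
  qed
  have h_lip: "norm (h j x - h j x') \<le> k x x'" if "x \<in> X" "x' \<in> X" for j x x'
  proof -
    have "norm (\<Sum>n<N j. of_real (g ((f ^^ n) x) - g ((f ^^ n) x')) * l j ^ n) \<le> real (card {..<N j}) * k x x'"
    proof (intro sum_norm_bound)
      fix n
      have "norm (complex_of_real (g ((f ^^ n) x) - g ((f ^^ n) x')) * l j ^ n) = \<bar>g ((f ^^ n) x) - g ((f ^^ n) x')\<bar>"
        by (simp only: norm_mult norm_power lx norm_of_real) simp
      also have "\<dots> \<le> k x x'" using lip[of "(f ^^ n) x" "(f ^^ n) x'"] k_funpow[OF that, of n] that by simp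
      finally show "norm (complex_of_real (g ((f ^^ n) x) - g ((f ^^ n) x')) * l j ^ n) \<le> k x x'" .
    qed
    moreover have "h j x - h j x' = (\<Sum>n<N j. of_real (g ((f ^^ n) x) - g ((f ^^ n) x')) * l j ^ n) / of_nat (N j)"
      unfolding h_def diff_divide_distrib[symmetric] sum_subtractf[symmetric]
      by (simp add: left_diff_distrib)
    ultimately show ?thesis using N[of j] by (simp add: norm_divide pos_divide_le_eq mult.commute)
  qed
  \<comment> \<open>Multiplication by \<open>l j\<close> and the step to \<open>f x\<close> shift
    the sum by one index, so only the two end terms survive.\<close>
  have h_step: "norm (l j * h j (f x) - h j x) \<le> 2 * G / real (N j)" if "x \<in> X" for j x
  proof -
    define a where "a n = of_real (g ((f ^^ n) x)) * l j ^ n" for n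
    have "l j * (\<Sum>n<N j. of_real (g ((f ^^ n) (f x))) * l j ^ n) = (\<Sum>n<N j. a (Suc n))"
      unfolding sum_distrib_left a_def by (intro sum.cong refl) (simp add: funpow_swap1)
    then have "l j * h j (f x) - h j x = (a (N j) - a 0) / of_nat (N j)"
      unfolding h_def a_def[symmetric] times_divide_eq_right diff_divide_distrib[symmetric]
      by (simp add: sum_subtractf[symmetric] sum_lessThan_telescope)
    moreover have an: "norm (a n) \<le> G" for n
      unfolding a_def using G[of "(f ^^ n) x"] that by (simp add: norm_mult norm_power lx)
    have "norm (a (N j) - a 0) \<le> 2 * G"
      using norm_triangle_ineq4[of "a (N j)" "a 0"] an[of "N j"] an[of 0] by linarith
    ultimately show ?thesis using N[of j] by (simp add: norm_divide divide_right_mono)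
  qed
  have h_int: "(\<integral>x. h j x \<partial>M) = 0" for j
  proof -
    have z: "(\<integral>x. of_real (g ((f ^^ n) x)) * l j ^ n \<partial>M) = 0" for n
      using integral_funpow[OF g, of n] int0
      by (simp only: integral_mult_left_zero integral_complex_of_real) simp
    have "(\<integral>x. (\<Sum>n<N j. of_real (g ((f ^^ n) x)) * l j ^ n) \<partial>M)
        = (\<Sum>n<N j. \<integral>x. of_real (g ((f ^^ n) x)) * l j ^ n \<partial>M)"
      by (subst Bochner_Integration.integral_sum) (auto intro!: integrable_continuous continuous_intros gn)
    also have "\<dots> = 0" unfolding z by simp
    finally show ?thesis unfolding h_def by simp
  qed
  have h_cont: "continuous_on X (h j)" for j by (rule k_lipschitz_continuous) (rule h_lip)

  \<comment> \<open>Compactness is applied only to the points \<open>xs\<close>, the frequencies and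
    the values at the single point \<open>y\<close>. Convergence then spreads along the orbit of
    \<open>y\<close> by \<open>step0\<close>, and to all of \<open>X\<close> by density and
    equicontinuity.\<close>
  have sc: "seq_compact (X \<times> (cball (0::complex) 1 \<times> cball (0::complex) G))"
    by (rule compact_imp_seq_compact[OF compact_Times[OF compact compact_Times[OF compact_cball compact_cball]]])
  have mem: "\<forall>j. (xs j, l j, h j y) \<in> X \<times> (cball 0 1 \<times> cball 0 G)"
    unfolding mem_Times_iff fst_conv snd_conv mem_cball_0 using lx h_bound[OF y(1)] by simp
  obtain p r where p: "p \<in> X \<times> (cball (0::complex) 1 \<times> cball (0::complex) G)"
    and r: "strict_mono r" and lim: "((\<lambda>j. (xs j, l j, h j y)) \<circ> r) \<longlonglongrightarrow> p"
    using seq_compactE[OF sc mem] .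
  obtain z L b where pz: "p = (z, L, b)" by (cases p)
  have z: "z \<in> X" using p pz by simp
  have lims: "(\<lambda>j. xs (r j)) \<longlonglongrightarrow> z" "(\<lambda>j. l (r j)) \<longlonglongrightarrow> L" "(\<lambda>j. h (r j) y) \<longlonglongrightarrow> b"
    using tendsto_fst[OF lim] tendsto_fst[OF tendsto_snd[OF lim]] tendsto_snd[OF tendsto_snd[OF lim]]
    unfolding pz by (simp_all add: comp_def)
  have step0: "(\<lambda>j. l (r j) * h (r j) (f x) - h (r j) x) \<longlonglongrightarrow> 0" if "x \<in> X" for x
  proof (rule Lim_null_comparison[OF always_eventually])
    show "\<forall>j. norm (l (r j) * h (r j) (f x) - h (r j) x) \<le> 2 * G / real (N (r j))" using h_step[OF that] by blast
    have "(\<lambda>j. 2 * G / real (N j)) \<longlonglongrightarrow> 0" unfolding N_def by real_asymp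
    from LIMSEQ_subseq_LIMSEQ[OF this r] show "(\<lambda>j. 2 * G / real (N (r j))) \<longlonglongrightarrow> 0"
      by (simp only: comp_def)
  qed
  have unit: "cnj (l j) * l j = 1" for j by (rule cnj_mult_unit(2)) (rule lx)
  have L: "norm L = 1" using tendsto_norm[OF lims(2)] lx(1) by (simp add: LIMSEQ_const_iff)
  have orbit: "\<exists>c. (\<lambda>j. h (r j) ((f ^^ n) y)) \<longlonglongrightarrow> c" for n
  proof (induction n)
    case 0
    show ?case using lims(3) by auto
  next
    case (Suc n)
    then obtain c where c: "(\<lambda>j. h (r j) ((f ^^ n) y)) \<longlonglongrightarrow> c" by blast
    have "(\<lambda>j. cnj (l (r j)) * (h (r j) ((f ^^ n) y) + (l (r j) * h (r j) (f ((f ^^ n) y)) - h (r j) ((f ^^ n) y))))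
        \<longlonglongrightarrow> cnj L * (c + 0)"
      by (intro tendsto_intros lims c step0) (use y in simp)
    moreover have "cnj (l j) * (h j u + (l j * h j v - h j u)) = h j v" for j u v
    proof -
      have "cnj (l j) * (h j u + (l j * h j v - h j u)) = (cnj (l j) * l j) * h j v" by simp
      then show ?thesis unfolding unit by simp
    qed
    ultimately have "(\<lambda>j. h (r j) (f ((f ^^ n) y))) \<longlonglongrightarrow> cnj L * (c + 0)" by (simp only:)
    then show ?case by auto
  qed
  have conv: "convergent (\<lambda>j. h (r j) x)" if x: "x \<in> X" for x
  proof (rule Cauchy_convergent, rule metric_CauchyI)
    fix e :: real assume e: "0 < e"
    obtain U where U: "open U" "X \<inter> U = {u \<in> X. k u x < e / 4}" using k_ball_open[OF x] .
    have "x \<in> X \<inter> U" unfolding U(2) using x e by simp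
    then obtain n where n: "(f ^^ n) y \<in> U" using orbit_hits[OF U(1) _ x y(1)] by blast
    define u where "u = (f ^^ n) y"
    have "u \<in> X \<inter> U" using n y unfolding u_def by simp
    then have u: "u \<in> X" "k u x < e / 4" unfolding U(2) by simp_all
    have "Cauchy (\<lambda>j. h (r j) u)" using orbit[of n] unfolding u_def by (auto intro: LIMSEQ_imp_Cauchy)
    then obtain K where K: "\<And>i j. i \<ge> K \<Longrightarrow> j \<ge> K \<Longrightarrow> dist (h (r i) u) (h (r j) u) < e / 2"
      using e metric_CauchyD[of "\<lambda>j. h (r j) u" "e/2"] by auto
    show "\<exists>K. \<forall>i\<ge>K. \<forall>j\<ge>K. dist (h (r i) x) (h (r j) x) < e"
    proof (intro exI allI impI)
      fix i j assume ij: "K \<le> i" "K \<le> j"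
      have "dist (h (r i) x) (h (r j) x) \<le> dist (h (r i) u) (h (r i) x) + dist (h (r i) u) (h (r j) u) + dist (h (r j) u) (h (r j) x)"
        using dist_triangle[of "h (r i) x" "h (r j) x" "h (r i) u"] dist_triangle[of "h (r i) u" "h (r j) x" "h (r j) u"]
          dist_commute[of "h (r i) x" "h (r i) u"] by linarith
      then show "dist (h (r i) x) (h (r j) x) < e"
        using h_lip[OF u(1) x, of "r i"] h_lip[OF u(1) x, of "r j"] u(2) K[OF ij] unfolding dist_norm by linarith
    qed
  qed
  define H where "H x = lim (\<lambda>j. h (r j) x)" for x
  have H: "(\<lambda>j. h (r j) x) \<longlonglongrightarrow> H x" if "x \<in> X" for x
    using conv[OF that] unfolding H_def convergent_LIMSEQ_iff .
  have H_lip: "norm (H x - H x') \<le> k x x'" if "x \<in> X" "x' \<in> X" for x x'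
    by (rule LIMSEQ_le_const2[OF tendsto_norm[OF tendsto_diff[OF H[OF that(1)] H[OF that(2)]]]]) (use h_lip[OF that] in blast)
  have H_cont: "continuous_on X H" by (rule k_lipschitz_continuous) (rule H_lip)
  have H_eig: "H (f x) = cnj L * H x" if "x \<in> X" for x
  proof -
    have "(\<lambda>j. l (r j) * h (r j) (f x) - h (r j) x) \<longlonglongrightarrow> L * H (f x) - H x"
      using that by (intro tendsto_intros lims H) auto
    then have "L * H (f x) - H x = 0" using LIMSEQ_unique step0[OF that] by blast
    then have e: "H x = L * H (f x)" by simp
    have "H (f x) = (cnj L * L) * H (f x)" unfolding cnj_mult_unit(2)[OF L] by simp
    also have "\<dots> = cnj L * H x" unfolding e by (simp only: mult.assoc)
    finally show ?thesis .
  qed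
  \<comment> \<open>The points where \<open>h j\<close> is large move with \<open>j\<close>; the
    Lipschitz bound transfers largeness to their limit \<open>z\<close>.\<close>
  have H_large: "\<delta> \<le> norm (H z)"
  proof -
    have *: "(\<lambda>j. norm (h (r j) z) + k (xs (r j)) z) \<longlonglongrightarrow> norm (H z) + 0"
      by (rule tendsto_add[OF tendsto_norm[OF H[OF z]] k_tendsto[OF z lx(2) lims(1)]])
    have "\<delta> \<le> norm (h (r j) z) + k (xs (r j)) z" for j
      using h_large[of "r j"] h_lip[OF lx(2) z, of "r j" "r j"] norm_triangle_sub[of "h (r j) (xs (r j))" "h (r j) z"] by linarith
    then have "\<delta> \<le> norm (H z) + 0" by (intro LIMSEQ_le_const[OF *]) blast
    then show ?thesis by simp
  qed
  have H_norm: "norm (H x) = norm (H z)" if "x \<in> X" for x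
  proof (rule invariant_const[OF _ _ that z])
    show "continuous_on X (\<lambda>x. norm (H x))" by (intro continuous_intros H_cont)
    show "norm (H (f x)) = norm (H x)" if "x \<in> X" for x using H_eig[OF that] L by (simp add: norm_mult)
  qed
  have "cnj L \<noteq> 1"
  proof
    assume 1: "cnj L = 1"
    have const: "H x = H z" if "x \<in> X" for x
      by (rule invariant_const[OF H_cont _ that z]) (simp add: H_eig 1)
    have "(\<lambda>j. \<integral>x. h (r j) x \<partial>M) \<longlonglongrightarrow> (\<integral>x. H x \<partial>M)"
    proof (rule integral_dominated_convergence[where w = "\<lambda>_. G"])
      show "AE x in M. (\<lambda>j. h (r j) x) \<longlonglongrightarrow> H x" using H by (intro AE_I2) (simp add: space_M)
      show "AE x in M. norm (h (r j) x) \<le> G" for j using h_bound by (intro AE_I2) (simp add: space_M)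
    qed (auto intro!: measurable_continuous h_cont H_cont)
    then have "(\<integral>x. H x \<partial>M) = 0" unfolding h_int by (simp add: LIMSEQ_const_iff)
    moreover have "(\<integral>x. H x \<partial>M) = (\<integral>x. H z \<partial>M)"
      by (rule Bochner_Integration.integral_cong[OF refl]) (rule const, simp add: space_M)
    ultimately have "H z = 0" using prob_space by simp
    then show False using H_large \<delta>(1) by simp
  qed
  moreover have nz: "norm (H z) \<noteq> 0" using H_large \<delta>(1) by linarith
  ultimately show ?thesis
  proof (intro that[of "\<lambda>x. H x / of_real (norm (H z))" "cnj L"])
    show "continuous_on X (\<lambda>x. H x / of_real (norm (H z)))"
      using nz by (intro continuous_intros H_cont) simp
    show "norm (H x / of_real (norm (H z))) = 1" if "x \<in> X" for x
      unfolding norm_divide H_norm[OF that] using nz by simp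
    show "H (f x) / of_real (norm (H z)) = cnj L * (H x / of_real (norm (H z)))" if "x \<in> X" for x
      unfolding H_eig[OF that] by simp
  qed
qed

end

context minimal_measure
begin

lemma non_uniform_of_not_weakly_mixing:
  assumes conn: "connected X" and nwm: "\<not> topologically_weakly_mixing X f"
  shows "\<exists>A\<in>continuous_GL X 2. \<not> uniform_cocycle X f 2 A"
proof -
  obtain V x0 y0 where V: "open V" and nz: "x0 \<in> X" "y0 \<in> X" "gap V x0 y0 \<noteq> 0"
    using gap_nonzero[OF nwm] .
  interpret isometric_pseudometric X f M "gap V"
  proof unfold_locales
    show "gap V x x = 0" for x by (simp add: gap_def)
  qed (rule gap_sym gap_triangle gap_f continuous_gap; (rule V | assumption))+
  obtain h :: "'a \<Rightarrow> complex" and l where "continuous_on X h" "\<And>x. x \<in> X \<Longrightarrow> norm (h x) = 1"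
    "\<And>x. x \<in> X \<Longrightarrow> h (f x) = l * h x" "l \<noteq> 1"
    using eigenfunction_exists[OF nz] by blast
  then show ?thesis using non_uniform_of_eigenfunction[OF conn X_nonempty] by blast
qed

end

subsection \<open>Powers with an additional invariant measure\<close>

lemma sets_restrict_closed:
  assumes "closed X"
  shows "sets (restrict_space borel X) = sigma_sets X ((\<inter>) X ` Collect closed)"
proof -
  have "sets (borel :: 'a::topological_space measure) = sigma_sets UNIV (Collect closed)"
    unfolding borel_eq_closed by (rule sets_measure_of) simp
  moreover have "(\<inter>) X ` sigma_sets UNIV (Collect closed) = sigma_sets X ((\<inter>) X ` Collect closed)"
    using assms by (intro sigma_sets_Int) auto
  ultimately show ?thesis by (simp add: sets_restrict_space)
qed

text \<open>Indicators of closed sets are pointwise limits of continuous functions of the distance,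
  and closed sets form an intersection-stable generator. It yields a continuous test function that
  detects that \<open>\<nu>\<close> is not \<open>f\<close>-invariant.\<close>

lemma measure_eqI_continuous:
  fixes X :: "'a::metric_space set"
  assumes X: "closed X" and M: "prob_space M" "sets M = sets (restrict_space borel X)"
    and N: "prob_space N" "sets N = sets (restrict_space borel X)"
    and eq: "\<And>u :: 'a \<Rightarrow> real. continuous_on UNIV u \<Longrightarrow> (\<integral>x. u x \<partial>M) = (\<integral>x. u x \<partial>N)"
  shows "M = N"
proof -
  have closed_eq: "emeasure M (X \<inter> C) = emeasure N (X \<inter> C)" if C: "closed C" for C
  \<comment> \<open>The empty set is treated apart because \<open>infdist x {}\<close> is 0, which
    would make every \<open>u j\<close> constantly 1.\<close>
  proof (cases "C = {}")
    case False
    define u where "u j x = max 0 (1 - real j * infdist x C)" for j x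
    have cu: "continuous_on UNIV (u j)" for j
      unfolding u_def[abs_def] by (intro continuous_intros)
    have lim: "(\<lambda>j. u j x) \<longlonglongrightarrow> indicator C x" for x
    proof (cases "x \<in> C")
      case True
      then show ?thesis by (simp add: u_def)
    next
      case False
      then have pos: "0 < infdist x C"
        using in_closed_iff_infdist_zero[OF C \<open>C \<noteq> {}\<close>, of x] infdist_nonneg[of x C] by linarith
      obtain n :: nat where n: "1 < real n * infdist x C"
        using reals_Archimedean3[OF pos] by blast
      have "u j x = 0" if "n \<le> j" for j
      proof -
        have "real n * infdist x C \<le> real j * infdist x C" using that pos by (intro mult_right_mono) auto
        then show ?thesis unfolding u_def using n by simp
      qed
      then have "\<forall>\<^sub>F j in sequentially. u j x = 0" unfolding eventually_sequentially by blast
      then show ?thesis using False by (simp add: tendsto_eventually)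
    qed
    have conv: "(\<lambda>j. \<integral>x. u j x \<partial>P) \<longlonglongrightarrow> measure P (X \<inter> C)"
      if P: "prob_space P" "sets P = sets (restrict_space borel X)" for P
    proof -
      interpret prob_space P by fact
      have sp: "space P = X" using sets_eq_imp_space_eq[OF P(2)] by (simp add: space_restrict_space)
      have meas: "v \<in> borel_measurable P" if "v \<in> borel_measurable borel" for v :: "'a \<Rightarrow> real"
        using measurable_restrict_space1[OF that] measurable_cong_sets[OF P(2) refl] by blast
      have "X \<inter> C \<in> sets P" using C unfolding P(2) by (auto simp: sets_restrict_space)
      have "(\<lambda>j. \<integral>x. u j x \<partial>P) \<longlonglongrightarrow> (\<integral>x. indicator C x \<partial>P)"
      proof (rule integral_dominated_convergence[where w = "\<lambda>_. 1"])
        show "AE x in P. norm (u j x) \<le> 1" for j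
          by (rule AE_I2) (simp add: u_def infdist_nonneg)
        show "(indicator C :: 'a \<Rightarrow> real) \<in> borel_measurable P"
          by (rule meas, rule borel_measurable_indicator) (use C in auto)
        show "u j \<in> borel_measurable P" for j
          by (intro meas borel_measurable_continuous_onI cu)
      qed (use lim in auto)
      also have "(\<integral>x. indicator C x \<partial>P) = measure P (X \<inter> C)"
        by (simp add: sp Int_commute)
      finally show ?thesis .
    qed
    have "measure M (X \<inter> C) = measure N (X \<inter> C)"
      using LIMSEQ_unique[OF conv[OF M] conv[OF N, folded eq[OF cu]]] .
    then show ?thesis
      using M(1) N(1) by (simp add: finite_measure.emeasure_eq_measure prob_space_def)
  qed simp
  show ?thesis
  proof (rule measure_eqI_generator_eq[where E = "(\<inter>) X ` Collect closed" and \<Omega> = X and A = "\<lambda>_. X"])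
    show "Int_stable ((\<inter>) X ` Collect closed)"
    proof (rule Int_stableI)
      fix a b assume "a \<in> (\<inter>) X ` Collect closed" "b \<in> (\<inter>) X ` Collect closed"
      then obtain C D where "closed C" "closed D" "a = X \<inter> C" "b = X \<inter> D" by blast
      then show "a \<inter> b \<in> (\<inter>) X ` Collect closed" by (intro image_eqI[of _ _ "C \<inter> D"]) auto
    qed
    show "emeasure M Y = emeasure N Y" if "Y \<in> (\<inter>) X ` Collect closed" for Y
      using that closed_eq by auto
    show "range (\<lambda>_. X) \<subseteq> (\<inter>) X ` Collect closed" using X by (auto intro!: image_eqI[of _ _ UNIV])
    show "emeasure M X \<noteq> \<infinity>" using M(1) by (simp add: finite_measure.emeasure_eq_measure prob_space_def)
  qed (use M(2) N(2) sets_restrict_closed[OF X] in auto)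
qed

section \<open>Weighted cyclic permutation matrices\<close>

definition perm_mat :: "nat \<Rightarrow> nat \<Rightarrow> (nat \<Rightarrow> real) \<Rightarrow> real mat" where
  "perm_mat n s w = mat n n (\<lambda>(a, b). if a = (b + s) mod n then w b else 0)"

lemma perm_mat_carrier [simp]: "perm_mat n s w \<in> carrier_mat n n"
  "dim_row (perm_mat n s w) = n" "dim_col (perm_mat n s w) = n"
  by (simp_all add: perm_mat_def)

lemma perm_mat_index: "a < n \<Longrightarrow> b < n \<Longrightarrow> perm_mat n s w $$ (a, b) = (if a = (b + s) mod n then w b else 0)"
  by (simp add: perm_mat_def)

lemma perm_mat_cong:
  assumes "s mod n = s' mod n" "\<And>b. b < n \<Longrightarrow> w b = w' b"
  shows "perm_mat n s w = perm_mat n s' w'"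
proof (rule eq_matI)
  fix a b assume "a < dim_row (perm_mat n s' w')" "b < dim_col (perm_mat n s' w')"
  then show "perm_mat n s w $$ (a, b) = perm_mat n s' w' $$ (a, b)"
    using assms mod_add_cong[OF refl assms(1), of b] by (simp add: perm_mat_index)
qed auto

lemma perm_mat_one: "perm_mat n 0 (\<lambda>_. 1) = 1\<^sub>m n"
  by (rule eq_matI) (auto simp: perm_mat_index)

lemma perm_mat_mult:
  assumes "0 < n"
  shows "perm_mat n s w * perm_mat n s' w' = perm_mat n (s + s') (\<lambda>b. w ((b + s') mod n) * w' b)"
proof (rule eq_matI)
  fix a b assume "a < dim_row (perm_mat n (s + s') (\<lambda>b. w ((b + s') mod n) * w' b))"
    "b < dim_col (perm_mat n (s + s') (\<lambda>b. w ((b + s') mod n) * w' b))"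
  then have ab: "a < n" "b < n" by auto
  define d where "d = (b + s') mod n"
  have d: "d < n" using assms by (simp add: d_def)
  have "(perm_mat n s w * perm_mat n s' w') $$ (a, b)
      = (\<Sum>c<n. perm_mat n s w $$ (a, c) * perm_mat n s' w' $$ (c, b))"
    using ab by (simp add: scalar_prod_def atLeast0LessThan)
  also have "\<dots> = (\<Sum>c<n. if c = d then perm_mat n s w $$ (a, d) * w' b else 0)"
    using ab by (intro sum.cong) (auto simp: perm_mat_index d_def)
  also have "\<dots> = perm_mat n s w $$ (a, d) * w' b" using d by simp
  also have "\<dots> = perm_mat n (s + s') (\<lambda>b. w ((b + s') mod n) * w' b) $$ (a, b)"
  proof -
    have "(d + s) mod n = (b + (s + s')) mod n" unfolding d_def by (simp add: mod_simps ac_simps)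
    then show ?thesis using ab d by (simp add: perm_mat_index d_def)
  qed
  finally show "(perm_mat n s w * perm_mat n s' w') $$ (a, b) = perm_mat n (s + s') (\<lambda>b. w ((b + s') mod n) * w' b) $$ (a, b)" .
qed auto

lemma perm_mat_GL:
  assumes n: "0 < n" and w: "\<And>b. w b \<noteq> 0"
  shows "perm_mat n 1 w \<in> GL n"
proof -
  define v where "v a = inverse (w ((a + (n - 1)) mod n))" for a
  have "perm_mat n 1 w * perm_mat n (n - 1) v = 1\<^sub>m n"
    unfolding perm_mat_mult[OF n] perm_mat_one[symmetric]
    by (rule perm_mat_cong) (use n w in \<open>auto simp: v_def\<close>)
  moreover have "perm_mat n (n - 1) v * perm_mat n 1 w = 1\<^sub>m n"
    unfolding perm_mat_mult[OF n] perm_mat_one[symmetric]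
  proof (rule perm_mat_cong)
    fix b assume b: "b < n"
    have "((b + 1) mod n + (n - 1)) mod n = (b + 1 + (n - 1)) mod n" by (rule mod_add_left_eq)
    also have "b + 1 + (n - 1) = b + n" using n by simp
    finally have "((b + 1) mod n + (n - 1)) mod n = b" using b by simp
    then show "v ((b + 1) mod n) * w b = 1" unfolding v_def using w[of b] by simp
  qed (use n in simp)
  ultimately show ?thesis
    unfolding GL_def invertible_mat_def inverts_mat_def
    by (auto intro!: exI[of _ "perm_mat n (n - 1) v"])
qed

lemma mat_norm_perm_mat:
  assumes "0 < n"
  shows "mat_norm (perm_mat n s w) = (\<Sum>b<n. \<bar>w b\<bar>)"
proof -
  have "mat_norm (perm_mat n s w) = (\<Sum>a<n. \<Sum>b<n. if a = (b + s) mod n then \<bar>w b\<bar> else 0)"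
    unfolding mat_norm_def by (intro sum.cong) (auto simp: perm_mat_index)
  also have "\<dots> = (\<Sum>b<n. \<Sum>a<n. if a = (b + s) mod n then \<bar>w b\<bar> else 0)" by (rule sum.swap)
  also have "\<dots> = (\<Sum>b<n. \<bar>w b\<bar>)" using assms by (intro sum.cong) auto
  finally show ?thesis .
qed

lemma sum_lessThan_add:
  fixes a :: "nat \<Rightarrow> 'b::comm_monoid_add"
  shows "(\<Sum>l<m + n. a l) = (\<Sum>l<m. a l) + (\<Sum>i<n. a (m + i))"
  by (induction n) (auto simp: add_ac)

text \<open>Each block of \<open>n\<close> consecutive times contains exactly one term, at offset
  \<open>n - b\<close>; the outer \<open>mod\<close> turns the offset \<open>n\<close> for
  \<open>b = 0\<close> into 0.\<close>

lemma sum_residue_class: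
  fixes u :: "nat \<Rightarrow> 'b::comm_monoid_add"
  assumes n: "0 < n" and b: "b < n"
  shows "(\<Sum>l<n * K. if (b + l) mod n = 0 then u l else 0) = (\<Sum>q<K. u (n * q + (n - b) mod n))"
proof (induction K)
  case (Suc K)
  have "(\<Sum>i<n. if (b + (n * K + i)) mod n = 0 then u (n * K + i) else 0)
      = (\<Sum>i<n. if i = (n - b) mod n then u (n * K + i) else 0)"
  proof (intro sum.cong refl)
    fix i assume "i \<in> {..<n}"
    then have i: "i < n" by simp
    have "(b + (n * K + i)) mod n = (b + i) mod n" by (metis add.left_commute mod_mult_self4)
    moreover have "(b + i) mod n = 0 \<longleftrightarrow> i = (n - b) mod n"
    proof (cases "b = 0")
      case True
      then show ?thesis using i by simp
    next
      case False
      then have *: "(n - b) mod n = n - b" using n by simp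
      have "(b + i) mod n = (if b + i < n then b + i else b + i - n)"
        using i b by (simp add: le_mod_geq)
      then show ?thesis unfolding * using False i b by auto
    qed
    ultimately show "(if (b + (n * K + i)) mod n = 0 then u (n * K + i) else 0) = (if i = (n - b) mod n then u (n * K + i) else 0)"
      by simp
  qed
  also have "\<dots> = u (n * K + (n - b) mod n)" using n by simp
  finally show ?case using Suc by (simp add: sum_lessThan_add[of _ "n * K" n, unfolded add.commute[of "n * K" n]] )
qed simp

text \<open>Balls of radius \<open>e\<close> around centres at least \<open>2 * e\<close> apart are
  disjoint, so \<open>ball p e\<close> and the union of the others would disconnect
  \<open>T\<close>.\<close>

lemma connected_near_finite:
  fixes T :: "'b::metric_space set"
  assumes T: "connected T" "T \<subseteq> (\<Union>p\<in>S. ball p e)"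
    and sep: "\<And>p q. p \<in> S \<Longrightarrow> q \<in> S \<Longrightarrow> p \<noteq> q \<Longrightarrow> 2 * e \<le> dist p q"
    and a: "a \<in> T" "a \<in> ball p e" "p \<in> S"
  shows "T \<subseteq> ball p e"
proof (rule ccontr)
  assume no: "\<not> ?thesis"
  have disj: "ball p e \<inter> ball q e = {}" if "q \<in> S - {p}" for q
  proof (rule ccontr)
    assume "ball p e \<inter> ball q e \<noteq> {}"
    then obtain z where "dist p z < e" "dist q z < e" by auto
    then have "dist p q < 2 * e" using dist_triangle[of p q z] dist_commute[of z q] by linarith
    then show False using sep[OF a(3), of q] that by force
  qed
  have "T \<subseteq> ball p e \<union> (\<Union>q\<in>S - {p}. ball q e)" using T(2) by blast
  moreover have "ball p e \<inter> (\<Union>q\<in>S - {p}. ball q e) \<inter> T = {}" using disj by blast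
  moreover have "open (\<Union>q\<in>S - {p}. ball q e)" by blast
  ultimately have "ball p e \<inter> T = {} \<or> (\<Union>q\<in>S - {p}. ball q e) \<inter> T = {}"
    using connectedD[OF T(1) open_ball[of p e]] by blast
  then show False using a no T(2) by blast
qed

lemma Max_image_le_add:
  fixes a b :: "'i \<Rightarrow> real"
  assumes "finite I" "I \<noteq> {}" "\<And>i. i \<in> I \<Longrightarrow> a i \<le> b i + c"
  shows "Max (a ` I) \<le> Max (b ` I) + c"
proof -
  have "a i \<le> Max (b ` I) + c" if "i \<in> I" for i
  proof -
    have "b i \<le> Max (b ` I)" using assms(1) that by (intro Max_ge) auto
    then show ?thesis using assms(3)[OF that] by linarith
  qed
  then show ?thesis using assms(1,2) by (subst Max_le_iff) auto
qed

lemma Max_image_dist: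
  fixes a b :: "'i \<Rightarrow> real"
  assumes "finite I" "I \<noteq> {}" "\<And>i. i \<in> I \<Longrightarrow> \<bar>a i - b i\<bar> \<le> c"
  shows "\<bar>Max (a ` I) - Max (b ` I)\<bar> \<le> c"
proof -
  have "Max (a ` I) \<le> Max (b ` I) + c" "Max (b ` I) \<le> Max (a ` I) + c"
    by (intro Max_image_le_add assms(1,2); use assms(3) in \<open>force simp: abs_le_iff\<close>)+
  then show ?thesis by linarith
qed

text \<open>A sum of exponentials lies between its largest term and the number of terms times it.
  This turns the norm of the permutation cocycle into a maximum of averages.\<close>

lemma log_sum_exp_bounds:
  fixes r :: "'i \<Rightarrow> real"
  assumes I: "finite I" "I \<noteq> {}" and K: "0 < K"
  shows "Max (r ` I) \<le> 1 / K * ln (\<Sum>i\<in>I. exp (K * r i))"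
    "1 / K * ln (\<Sum>i\<in>I. exp (K * r i)) \<le> Max (r ` I) + ln (real (card I)) / K"
proof -
  have "Max (r ` I) \<in> r ` I" using I by (intro Max_in) auto
  then obtain i where i: "i \<in> I" "Max (r ` I) = r i" by blast
  have pos: "0 < (\<Sum>i\<in>I. exp (K * r i))" using I by (intro sum_pos) auto
  have "exp (K * r i) \<le> (\<Sum>i\<in>I. exp (K * r i))"
    using I i by (intro member_le_sum) auto
  then have "K * r i \<le> ln (\<Sum>i\<in>I. exp (K * r i))" using pos by (simp add: ln_ge_iff)
  then show "Max (r ` I) \<le> 1 / K * ln (\<Sum>i\<in>I. exp (K * r i))"
    unfolding i(2) using K by (simp add: pos_le_divide_eq mult.commute)
  have "(\<Sum>i\<in>I. exp (K * r i)) \<le> real (card I) * exp (K * Max (r ` I))"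
    using I K by (intro sum_bounded_above) auto
  then have "ln (\<Sum>i\<in>I. exp (K * r i)) \<le> ln (real (card I) * exp (K * Max (r ` I)))"
    using pos by (intro ln_mono) auto
  also have "\<dots> = ln (real (card I)) + K * Max (r ` I)"
    using I by (subst ln_mult) (auto simp: card_gt_0_iff)
  finally show "1 / K * ln (\<Sum>i\<in>I. exp (K * r i)) \<le> Max (r ` I) + ln (real (card I)) / K"
    using K by (simp add: field_simps)
qed

text \<open>By Fourier inversion on Z/n, a sequence whose coefficients vanish at all roots other
  than 1 is constant.\<close>

lemma nonzero_Fourier_coefficient:
  fixes c :: "nat \<Rightarrow> complex"
  assumes n: "2 \<le> n" and c: "c 1 \<noteq> c 0"
  obtains j where "unity_root n j \<noteq> 1" "(\<Sum>i<n. c i * unity_root n j ^ i) \<noteq> 0"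
proof -
  have inv: "(\<Sum>j<n. (\<Sum>i<n. c i * unity_root n j ^ i) * cnj (unity_root n j ^ e)) = of_nat n * c e" if "e < n" for e
  proof -
    have "(\<Sum>j<n. (\<Sum>i<n. c i * unity_root n j ^ i) * cnj (unity_root n j ^ e))
        = (\<Sum>i<n. \<Sum>j<n. c i * (unity_root n j ^ i * cnj (unity_root n j ^ e)))"
      unfolding sum_distrib_right mult.assoc by (rule sum.swap)
    also have "\<dots> = (\<Sum>i<n. c i * (if i = e then of_nat n else 0))"
      using that by (intro sum.cong refl) (simp add: sum_distrib_left[symmetric] unity_root_orthogonal del: complex_cnj_power)
    also have "\<dots> = (\<Sum>i<n. if i = e then of_nat n * c e else 0)"
      by (intro sum.cong) auto
    finally show ?thesis using that by simp
  qed
  have "\<exists>j. unity_root n j \<noteq> 1 \<and> (\<Sum>i<n. c i * unity_root n j ^ i) \<noteq> 0"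
  proof (rule ccontr)
    assume no: "\<not> ?thesis"
    have "of_nat n * c 1 = (\<Sum>j<n. (\<Sum>i<n. c i * unity_root n j ^ i) * cnj (unity_root n j ^ 1))"
      using n by (intro inv[symmetric]) simp
    also have "\<dots> = (\<Sum>j<n. (\<Sum>i<n. c i * unity_root n j ^ i) * cnj (unity_root n j ^ 0))"
    proof (intro sum.cong refl)
      fix j
      show "(\<Sum>i<n. c i * unity_root n j ^ i) * cnj (unity_root n j ^ 1) = (\<Sum>i<n. c i * unity_root n j ^ i) * cnj (unity_root n j ^ 0)"
        using no by (cases "unity_root n j = 1") auto
    qed
    also have "\<dots> = of_nat n * c 0" using n by (intro inv) simp
    finally have "of_nat n * c 1 = of_nat n * c 0" .
    then show False using c n by simp
  qed
  then show ?thesis using that by blast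
qed

context minimal_map
begin

lemma cocycle_perm_mat:
  assumes n: "0 < n" and A: "A = (\<lambda>x. perm_mat n 1 (\<lambda>b. if b = 0 then exp (u x) else 1))"
  shows "cocycle n f A N x = perm_mat n N (\<lambda>b. exp (\<Sum>l<N. if (b + l) mod n = 0 then u ((f ^^ l) x) else 0))"
proof (induction N)
  case 0
  show ?case using perm_mat_one[of n] by simp
next
  case (Suc N)
  show ?case
    unfolding cocycle.simps Suc unfolding A perm_mat_mult[OF n]
    by (rule perm_mat_cong) (auto simp: exp_add)
qed

text \<open>Each column passes the exponential weight once in \<open>n\<close> steps, so it carries
  a sum along \<open>f ^^ n\<close>. The column determines only the starting point among the first
  \<open>n\<close> points of the orbit.\<close>

lemma mat_norm_cocycle:
  assumes n: "0 < n" and A: "A = (\<lambda>x. perm_mat n 1 (\<lambda>b. if b = 0 then exp (u x) else 1))"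
  shows "mat_norm (cocycle n f A (n * K) x) = (\<Sum>i<n. exp (\<Sum>q<K. u ((f ^^ (n * q)) ((f ^^ i) x))))"
proof -
  have "mat_norm (cocycle n f A (n * K) x)
      = (\<Sum>b<n. exp (\<Sum>l<n * K. if (b + l) mod n = 0 then u ((f ^^ l) x) else 0))"
    unfolding cocycle_perm_mat[OF n A] mat_norm_perm_mat[OF n] by simp
  also have "\<dots> = (\<Sum>b<n. exp (\<Sum>q<K. u ((f ^^ (n * q)) ((f ^^ ((n - b) mod n)) x))))"
    using n by (intro sum.cong refl) (simp add: sum_residue_class funpow_add)
  also have "\<dots> = (\<Sum>i<n. exp (\<Sum>q<K. u ((f ^^ (n * q)) ((f ^^ i) x))))"
  proof (rule sum.reindex_bij_witness[of _ "\<lambda>i. (n - i) mod n" "\<lambda>b. (n - b) mod n"])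
    fix b assume "b \<in> {..<n}"
    then show "(n - (n - b) mod n) mod n = b" by (cases "b = 0") auto
    then show "(n - (n - b) mod n) mod n = b" .
  qed (use n in auto)
  finally show ?thesis .
qed

lemma non_uniform_of_power_measure:
  assumes conn: "connected X" and n1: "1 \<le> n" and inv: "\<nu> \<in> invariant_prob_measures X (f ^^ n)"
    and ninv: "distr \<nu> \<nu> f \<noteq> \<nu>"
  shows "\<exists>m\<ge>2. \<exists>A\<in>continuous_GL X m. \<not> uniform_cocycle X f m A"
proof -
  have sets: "sets \<nu> = sets (restrict_space borel X)" and prob: "prob_space \<nu>" and dn: "distr \<nu> \<nu> (f ^^ n) = \<nu>"
    using inv unfolding invariant_prob_measures_def by auto
  interpret G: invariant_prob X "f ^^ n" \<nu>
    using prob sets dn compact continuous_on_funpow[of n]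
    by (intro invariant_prob.intro invariant_prob_axioms.intro) auto
  have ne: "X \<noteq> {}" using G.not_empty G.space_M by simp
  have f_meas: "f \<in> \<nu> \<rightarrow>\<^sub>M \<nu>" using measurable_self_map[OF sets cont maps] .
  have "\<exists>\<phi> :: 'a \<Rightarrow> real. continuous_on UNIV \<phi> \<and> (\<integral>x. \<phi> x \<partial>distr \<nu> \<nu> f) \<noteq> (\<integral>x. \<phi> x \<partial>\<nu>)"
  proof (rule ccontr)
    assume "\<not> ?thesis"
    then have "distr \<nu> \<nu> f = \<nu>"
      by (intro measure_eqI_continuous[OF compact_imp_closed[OF compact] G.prob_space_distr[OF f_meas] _ prob sets])
         (auto simp: sets)
    then show False using ninv by blast
  qed
  then obtain \<phi> :: "'a \<Rightarrow> real" where \<phi>: "continuous_on X \<phi>"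
    and neq: "(\<integral>x. \<phi> x \<partial>distr \<nu> \<nu> f) \<noteq> (\<integral>x. \<phi> x \<partial>\<nu>)"
    using continuous_on_subset[OF _ subset_UNIV] by blast
  note \<phi>i = continuous_on_iterate[OF \<phi>]
  define c where "c i = (\<integral>x. \<phi> ((f ^^ i) x) \<partial>\<nu>)" for i
  have c01: "c 1 \<noteq> c 0"
    using neq integral_distr[OF f_meas G.measurable_continuous[OF \<phi>]] by (simp add: c_def)
  have cn: "c n = c 0"
    using G.integral_f[OF G.measurable_continuous[OF \<phi>]] by (simp add: c_def)
  have n: "2 \<le> n" using n1 c01 cn by (cases "n = 1") auto
  then have n0: "0 < n" by simp
  obtain j where j: "unity_root n j \<noteq> 1" "(\<Sum>i<n. of_real (c i) * unity_root n j ^ i) \<noteq> 0"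
    using nonzero_Fourier_coefficient[OF n, of "\<lambda>i. of_real (c i)"] c01 by auto
  define \<zeta> where "\<zeta> = unity_root n j"
  define \<omega> where "\<omega> = cnj \<zeta>"
  have \<zeta>1: "norm \<zeta> = 1" and \<zeta>n: "\<zeta> ^ n = 1" unfolding \<zeta>_def using unity_root_pow_self[OF n0] by auto
  have \<omega>1: "norm \<omega> = 1" and \<omega>n: "\<omega> ^ n = 1" and \<omega>ne: "\<omega> \<noteq> 1"
    using \<zeta>1 \<zeta>n j(1) unfolding \<omega>_def \<zeta>_def[symmetric] complex_cnj_power[symmetric] by auto
  have \<omega>\<zeta>: "\<omega> * \<zeta> = 1" unfolding \<omega>_def by (rule cnj_mult_unit(2)[OF \<zeta>1])
  have \<omega>_norm: "norm (\<omega> ^ i) = 1" for i by (simp add: norm_power \<omega>1)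
  \<comment> \<open>The weights make \<open>f\<close> act as multiplication by
    \<open>\<omega> = cnj \<zeta>\<close>, up to a difference of \<open>\<phi>\<close> along
    \<open>f ^^ n\<close> that telescopes in the averages.\<close>
  define \<psi> where "\<psi> x = (\<Sum>i<n. of_real (\<phi> ((f ^^ i) x)) * \<zeta> ^ i)" for x
  have \<psi>: "continuous_on X \<psi>" unfolding \<psi>_def[abs_def] by (intro continuous_intros \<phi>i)
  have \<psi>_f: "\<psi> (f x) = \<omega> * (\<psi> x + of_real (\<phi> ((f ^^ n) x) - \<phi> x))" for x
  proof -
    define a where "a i = of_real (\<phi> ((f ^^ i) x)) * \<zeta> ^ i" for i
    have "\<zeta> * \<psi> (f x) = (\<Sum>i<n. a (Suc i))"
      unfolding \<psi>_def sum_distrib_left a_def by (intro sum.cong refl) (simp add: funpow_swap1)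
    also have "\<dots> = \<psi> x + (a n - a 0)"
      unfolding sum_lessThan_telescope[of a n, symmetric] sum_subtractf \<psi>_def a_def[symmetric] by simp
    also have "a n - a 0 = of_real (\<phi> ((f ^^ n) x) - \<phi> x)" unfolding a_def \<zeta>n by simp
    finally have e: "\<zeta> * \<psi> (f x) = \<psi> x + of_real (\<phi> ((f ^^ n) x) - \<phi> x)" .
    have "\<psi> (f x) = \<omega> * (\<zeta> * \<psi> (f x))" unfolding mult.assoc[symmetric] \<omega>\<zeta> by simp
    then show ?thesis unfolding e .
  qed
  define I where "I = (\<integral>x. \<psi> x \<partial>\<nu>)"
  have I: "I \<noteq> 0"
  proof -
    have "I = (\<Sum>i<n. \<integral>x. of_real (\<phi> ((f ^^ i) x)) * \<zeta> ^ i \<partial>\<nu>)"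
      unfolding I_def \<psi>_def
      by (subst Bochner_Integration.integral_sum) (auto intro!: G.integrable_continuous continuous_intros \<phi>i)
    also have "\<dots> = (\<Sum>i<n. of_real (c i) * \<zeta> ^ i)"
      unfolding c_def by (simp only: integral_mult_left_zero integral_complex_of_real)
    finally show ?thesis using j(2) unfolding \<zeta>_def by simp
  qed
  obtain B where B: "\<And>x. x \<in> X \<Longrightarrow> \<bar>\<phi> x\<bar> \<le> B"
    using compact_imp_bounded[OF compact_continuous_image[OF \<phi> compact]] by (auto simp: bounded_iff)
  have B0: "0 \<le> B" using ne B abs_ge_zero order_trans by blast
  \<comment> \<open>At \<open>K = 0\<close> the quotient is 0, and so is the bound
    \<open>2 * B / real K\<close>; the estimates hold there trivially.\<close>
  define g where "g K x = (\<Sum>q<K. \<psi> ((f ^^ (n * q)) x)) / of_nat K" for K x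
  have g_cont: "continuous_on X (g K)" for K
  proof (cases "K = 0")
    case True
    then have "g K = (\<lambda>_. 0)" by (auto simp: g_def)
    then show ?thesis by simp
  next
    case False
    then show ?thesis unfolding g_def[abs_def] by (intro continuous_intros continuous_on_iterate[OF \<psi>]) simp
  qed
  have g_f: "norm (g K (f x) - \<omega> * g K x) \<le> 2 * B / real K" if x: "x \<in> X" for K x
  proof (cases "K = 0")
    case False
    define b where "b q = complex_of_real (\<phi> ((f ^^ (n * q)) x))" for q
    have "\<psi> ((f ^^ (n * q)) (f x)) = \<omega> * (\<psi> ((f ^^ (n * q)) x) + (b (Suc q) - b q))" for q
    proof -
      have "(f ^^ (n * q)) (f x) = f ((f ^^ (n * q)) x)" by (simp add: funpow_swap1)
      then show ?thesis unfolding b_def \<psi>_f[of "(f ^^ (n * q)) x"] by (simp add: \<psi>_f funpow_add)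
    qed
    then have "(\<Sum>q<K. \<psi> ((f ^^ (n * q)) (f x))) = \<omega> * ((\<Sum>q<K. \<psi> ((f ^^ (n * q)) x)) + (b K - b 0))"
      unfolding sum_lessThan_telescope[of b K, symmetric] sum.distrib[symmetric] sum_distrib_left by simp
    then have "g K (f x) - \<omega> * g K x = \<omega> * (b K - b 0) / of_nat K"
      unfolding g_def by (simp add: distrib_left add_divide_distrib)
    moreover have "norm (b K - b 0) \<le> 2 * B"
      using norm_triangle_ineq4[of "b K" "b 0"] B[of "(f ^^ (n * K)) x"] B[OF x] x unfolding b_def by simp
    ultimately show ?thesis using \<omega>1 by (simp add: norm_mult norm_divide divide_right_mono)
  qed (simp add: g_def)
  have g_iter: "norm (g K ((f ^^ i) x) - \<omega> ^ i * g K x) \<le> real i * (2 * B / real K)" if x: "x \<in> X" for K i x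
  proof (induction i)
    case (Suc i)
    have "g K ((f ^^ Suc i) x) - \<omega> ^ Suc i * g K x
      = (g K (f ((f ^^ i) x)) - \<omega> * g K ((f ^^ i) x)) + \<omega> * (g K ((f ^^ i) x) - \<omega> ^ i * g K x)"
      by (simp add: right_diff_distrib)
    also have "norm \<dots> \<le> norm (g K (f ((f ^^ i) x)) - \<omega> * g K ((f ^^ i) x)) + norm (\<omega> * (g K ((f ^^ i) x) - \<omega> ^ i * g K x))"
      by (rule norm_triangle_ineq)
    also have "\<dots> \<le> 2 * B / real K + real i * (2 * B / real K)"
      using g_f[of "(f ^^ i) x" K] Suc x by (intro add_mono) (simp_all add: norm_mult \<omega>1)
    finally show ?case by (simp add: algebra_simps add_divide_distrib)
  qed simp
  have \<psi>_bound: "norm (\<psi> x) \<le> real n * B" if "x \<in> X" for x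
  proof -
    have "norm (\<psi> x) \<le> real (card {..<n}) * B"
      unfolding \<psi>_def using that B by (intro sum_norm_bound) (simp add: norm_mult norm_power \<zeta>1)
    then show ?thesis by simp
  qed
  have g_bound: "norm (g K x) \<le> real n * B" if "x \<in> X" for K x
  proof (cases "K = 0")
    case False
    have "norm (\<Sum>q<K. \<psi> ((f ^^ (n * q)) x)) \<le> real (card {..<K}) * (real n * B)"
      using that by (intro sum_norm_bound \<psi>_bound) simp
    then show ?thesis unfolding g_def using False by (simp add: norm_divide pos_divide_le_eq mult_ac)
  qed (use B0 in \<open>simp add: g_def\<close>)
  \<comment> \<open>Invariance of \<open>\<nu>\<close> under \<open>f ^^ n\<close> makes averaging
    preserve the integral. It is the lower bound for the maximal moduli.\<close>
  have g_int: "(\<integral>x. g (Suc K) x \<partial>\<nu>) = I" for K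
  proof -
    have "(\<integral>x. \<psi> ((f ^^ (n * q)) x) \<partial>\<nu>) = I" for q
    proof (induction q)
      case (Suc q)
      have "(\<integral>x. \<psi> ((f ^^ (n * q)) ((f ^^ n) x)) \<partial>\<nu>) = (\<integral>x. \<psi> ((f ^^ (n * q)) x) \<partial>\<nu>)"
        by (rule G.integral_f[OF G.measurable_continuous[OF continuous_on_iterate[OF \<psi>]]])
      moreover have "(f ^^ (n * Suc q)) x = (f ^^ (n * q)) ((f ^^ n) x)" for x
        unfolding mult_Suc_right add.commute[of n] funpow_add by simp
      ultimately show ?case using Suc by simp
    qed (simp add: I_def)
    then have "(\<Sum>q<Suc K. \<integral>x. \<psi> ((f ^^ (n * q)) x) \<partial>\<nu>) = of_nat (Suc K) * I" by simp
    moreover have "(\<integral>x. (\<Sum>q<Suc K. \<psi> ((f ^^ (n * q)) x)) \<partial>\<nu>) = (\<Sum>q<Suc K. \<integral>x. \<psi> ((f ^^ (n * q)) x) \<partial>\<nu>)"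
      by (rule Bochner_Integration.integral_sum) (rule G.integrable_continuous[OF continuous_on_iterate[OF \<psi>]])
    ultimately show ?thesis
      unfolding g_def integral_divide_zero by (simp del: sum.lessThan_Suc of_nat_Suc)
  qed
  have "\<exists>x\<in>X. \<forall>y\<in>X. norm (g (Suc K) y) \<le> norm (g (Suc K) x)" for K
    by (rule continuous_attains_sup[OF compact ne]) (intro continuous_intros g_cont)
  then obtain xs where xs: "\<And>K. xs K \<in> X" "\<And>K y. y \<in> X \<Longrightarrow> norm (g (Suc K) y) \<le> norm (g (Suc K) (xs K))"
    by metis
  have I_le: "norm I \<le> norm (g (Suc K) (xs K))" for K
  proof -
    have "norm I \<le> (\<integral>x. norm (g (Suc K) x) \<partial>\<nu>)" unfolding g_int[of K, symmetric] by (rule integral_norm_bound)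
    also have "\<dots> \<le> (\<integral>x. norm (g (Suc K) (xs K)) \<partial>\<nu>)"
    proof (rule integral_mono)
      show "integrable \<nu> (\<lambda>x. norm (g (Suc K) x))" by (intro G.integrable_continuous continuous_intros g_cont)
    qed (use xs(2) in \<open>auto simp: G.space_M\<close>)
    also have "\<dots> = norm (g (Suc K) (xs K))" using G.prob_space by simp
    finally show ?thesis .
  qed
  have mem: "\<forall>K. g (Suc K) (xs K) \<in> cball 0 (real n * B)" using g_bound[OF xs(1)] by simp
  obtain z0 r where "z0 \<in> cball 0 (real n * B)" and r: "strict_mono r"
    and "((\<lambda>K. g (Suc K) (xs K)) \<circ> r) \<longlonglongrightarrow> z0"
    using seq_compactE[OF compact_imp_seq_compact[OF compact_cball] mem] .
  then have lim: "(\<lambda>i. g (Suc (r i)) (xs (r i))) \<longlonglongrightarrow> z0" by (simp add: comp_def)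
  define R where "R = norm z0"
  have R: "0 < R"
  proof -
    have "norm I \<le> R" unfolding R_def
      by (rule LIMSEQ_le_const[OF tendsto_norm[OF lim]]) (use I_le in blast)
    then show ?thesis using I by (meson less_le_trans zero_less_norm_iff)
  qed
  \<comment> \<open>The component of \<open>\<psi>\<close> along \<open>z0\<close>: the growth rate
    then measures how far the averages reach towards \<open>z0\<close> and its rotates.\<close>
  define u where "u x = Re (cnj z0 * \<psi> x)" for x
  have u: "continuous_on X u" unfolding u_def by (intro continuous_intros \<psi>)
  define A where "A = (\<lambda>x. perm_mat n 1 (\<lambda>b. if b = 0 then exp (u x) else 1))"
  have AGL: "A \<in> continuous_GL X n"
    unfolding continuous_GL_def
  proof (intro CollectI conjI ballI allI impI)
    show "A x \<in> GL n" for x unfolding A_def by (rule perm_mat_GL[OF n0]) simp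
    show "continuous_on X (\<lambda>x. A x $$ (a, b))" if "a < n" "b < n" for a b
      unfolding A_def using that u
      by (cases "a = (b + 1) mod n"; cases "b = 0") (auto simp: perm_mat_index intro!: continuous_intros)
  qed
  have "\<not> uniform_cocycle X f n A"
  proof
    assume "uniform_cocycle X f n A"
    then obtain L where L: "uniform_limit X (\<lambda>N x. 1 / real N * ln (mat_norm (cocycle n f A N x))) L sequentially"
      unfolding uniform_cocycle_def uniformly_convergent_on_def by blast
    \<comment> \<open>\<open>w (g K x)\<close> approximates \<open>n\<close> times the rate at time
      \<open>n * K\<close>. The maximum over all powers of \<open>\<omega>\<close> absorbs the
      rotation caused by replacing \<open>x\<close> by \<open>f x\<close>.\<close>
    define w where "w z = Max ((\<lambda>i. Re (cnj z0 * (\<omega> ^ i * z))) ` {..<n})" for z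
    have ne': "{..<n} \<noteq> {}" using n0 by auto
    have re_le: "\<bar>Re (cnj z0 * a) - Re (cnj z0 * b)\<bar> \<le> R * norm (a - b)" for a b
    proof -
      have "Re (cnj z0 * a) - Re (cnj z0 * b) = Re (cnj z0 * (a - b))" by (simp add: algebra_simps)
      moreover have "\<bar>Re (cnj z0 * (a - b))\<bar> \<le> norm (cnj z0 * (a - b))" by (rule abs_Re_le_cmod)
      ultimately show ?thesis by (simp only: norm_mult complex_mod_cnj R_def)
    qed
    have w_lip: "\<bar>w a - w b\<bar> \<le> R * norm (a - b)" for a b
      unfolding w_def
    proof (rule Max_image_dist[OF finite_lessThan ne'])
      fix i
      have "norm (\<omega> ^ i * a - \<omega> ^ i * b) = norm (a - b)"
        unfolding right_diff_distrib[symmetric] norm_mult \<omega>_norm by simp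
      then show "\<bar>Re (cnj z0 * (\<omega> ^ i * a)) - Re (cnj z0 * (\<omega> ^ i * b))\<bar> \<le> R * norm (a - b)"
        using re_le[of "\<omega> ^ i * a" "\<omega> ^ i * b"] by simp
    qed
    have w_cont: "continuous_on UNIV w"
    proof (rule continuous_onI)
      fix a :: complex and e :: real assume e: "0 < e"
      have "dist (w b) (w a) \<le> e" if "dist b a < e / R" for b
      proof -
        have "R * norm (b - a) \<le> e" using that R by (simp add: dist_norm field_simps)
        then show ?thesis using w_lip[of b a] by (simp add: dist_norm)
      qed
      then show "\<exists>d>0. \<forall>b\<in>UNIV. dist b a < d \<longrightarrow> dist (w b) (w a) \<le> e"
        using e R by (intro exI[of _ "e / R"]) auto
    qed
    have \<omega>_mod: "\<omega> ^ (m mod n) = \<omega> ^ m" for m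
    proof -
      have "\<omega> ^ m = \<omega> ^ (n * (m div n) + m mod n)" by simp
      also have "\<dots> = \<omega> ^ (m mod n)" unfolding power_add power_mult \<omega>n by simp
      finally show ?thesis by simp
    qed
    have w_rot: "w (\<omega> * z) = w z" for z
    proof -
      let ?h = "\<lambda>i. Re (cnj z0 * (\<omega> ^ i * z))"
      have "(\<lambda>i. Re (cnj z0 * (\<omega> ^ i * (\<omega> * z)))) ` {..<n} = (\<lambda>i. ?h (Suc i mod n)) ` {..<n}"
        unfolding \<omega>_mod by (simp add: mult_ac)
      also have "\<dots> = ?h ` ((\<lambda>i. Suc i mod n) ` {..<n})" by (simp only: image_image)
      also have "(\<lambda>i. Suc i mod n) ` {..<n} = {..<n}"
      proof
        show "(\<lambda>i. Suc i mod n) ` {..<n} \<subseteq> {..<n}" using n0 by auto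
        show "{..<n} \<subseteq> (\<lambda>i. Suc i mod n) ` {..<n}"
        proof
          fix i assume i: "i \<in> {..<n}"
          have "Suc ((i + (n - 1)) mod n) mod n = Suc (i + (n - 1)) mod n" by (rule mod_Suc_eq)
          also have "Suc (i + (n - 1)) = i + n" using n0 by simp
          finally have "i = Suc ((i + (n - 1)) mod n) mod n" using i by simp
          then show "i \<in> (\<lambda>i. Suc i mod n) ` {..<n}" by (rule image_eqI) (use n0 in simp)
        qed
      qed
      finally show ?thesis unfolding w_def by simp
    qed
    define W where "W K x = w (g K x)" for K x
    \<comment> \<open>The first term comes from \<open>log_sum_exp_bounds\<close>, the second from
      replacing \<open>g K ((f ^^ i) x)\<close> by \<open>\<omega> ^ i * g K x\<close>.\<close>
    define E where "E K = ln (real n) / real K + R * (real n * (2 * B / real K))" for K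
    have E0: "E \<longlonglongrightarrow> 0" unfolding E_def[abs_def] by real_asymp
    have approx: "\<bar>real n * (1 / real (n * K) * ln (mat_norm (cocycle n f A (n * K) x))) - W K x\<bar> \<le> E K"
      if x: "x \<in> X" and K: "0 < K" for K x
    proof -
      define \<rho> where "\<rho> i = Re (cnj z0 * g K ((f ^^ i) x))" for i
      have "(\<Sum>q<K. u ((f ^^ (n * q)) y)) = real K * Re (cnj z0 * g K y)" for y
      proof -
        have "(\<Sum>q<K. u ((f ^^ (n * q)) y)) = Re (cnj z0 * (\<Sum>q<K. \<psi> ((f ^^ (n * q)) y)))"
          unfolding u_def sum_distrib_left Re_sum ..
        also have "(\<Sum>q<K. \<psi> ((f ^^ (n * q)) y)) = of_real (real K) * g K y" unfolding g_def using K by simp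
        also have "Re (cnj z0 * (of_real (real K) * g K y)) = real K * Re (cnj z0 * g K y)"
          unfolding mult.left_commute[of "cnj z0"] by simp
        finally show ?thesis .
      qed
      then have "mat_norm (cocycle n f A (n * K) x) = (\<Sum>i<n. exp (real K * \<rho> i))"
        unfolding mat_norm_cocycle[OF n0 A_def] \<rho>_def by simp
      then have "real n * (1 / real (n * K) * ln (mat_norm (cocycle n f A (n * K) x))) = 1 / real K * ln (\<Sum>i<n. exp (real K * \<rho> i))"
        using n0 by simp
      moreover have "Max (\<rho> ` {..<n}) \<le> 1 / real K * ln (\<Sum>i<n. exp (real K * \<rho> i))"
        "1 / real K * ln (\<Sum>i<n. exp (real K * \<rho> i)) \<le> Max (\<rho> ` {..<n}) + ln (real n) / real K"
        using log_sum_exp_bounds[OF finite_lessThan ne', of "real K" \<rho>] K by simp_all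
      moreover have "\<bar>Max (\<rho> ` {..<n}) - W K x\<bar> \<le> R * (real n * (2 * B / real K))"
        unfolding W_def w_def
      proof (rule Max_image_dist[OF finite_lessThan ne'])
        fix i assume "i \<in> {..<n}"
        have "\<bar>\<rho> i - Re (cnj z0 * (\<omega> ^ i * g K x))\<bar> \<le> R * norm (g K ((f ^^ i) x) - \<omega> ^ i * g K x)"
          unfolding \<rho>_def by (rule re_le)
        also have "\<dots> \<le> R * (real i * (2 * B / real K))"
          using R by (intro mult_left_mono g_iter x) simp
        also have "\<dots> \<le> R * (real n * (2 * B / real K))"
          using R B0 \<open>i \<in> {..<n}\<close> by (intro mult_left_mono mult_right_mono) auto
        finally show "\<bar>\<rho> i - Re (cnj z0 * (\<omega> ^ i * g K x))\<bar> \<le> R * (real n * (2 * B / real K))" .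
      qed
      moreover have "0 \<le> R * (real n * (2 * B / real K))" "0 \<le> ln (real n) / real K" using R B0 n by simp_all
      ultimately show ?thesis unfolding E_def by linarith
    qed
    have limW: "uniform_limit X W (\<lambda>x. real n * L x) sequentially"
    proof (rule uniform_limitI)
      fix e :: real assume e: "0 < e"
      have "\<forall>\<^sub>F N in sequentially. \<forall>x\<in>X. dist (1 / real N * ln (mat_norm (cocycle n f A N x))) (L x) < e / (2 * real n)"
        using uniform_limitD[OF L] e n0 by simp
      then obtain N0 where N0: "\<And>N x. N0 \<le> N \<Longrightarrow> x \<in> X \<Longrightarrow> \<bar>1 / real N * ln (mat_norm (cocycle n f A N x)) - L x\<bar> < e / (2 * real n)"
        unfolding eventually_sequentially dist_real_def by blast
      have "\<forall>\<^sub>F K in sequentially. E K < e / 2" using order_tendstoD(2)[OF E0, of "e/2"] e by simp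
      moreover have "\<forall>\<^sub>F K in sequentially. max N0 1 \<le> K" by (rule eventually_ge_at_top)
      ultimately show "\<forall>\<^sub>F K in sequentially. \<forall>x\<in>X. dist (W K x) (real n * L x) < e"
      proof eventually_elim
        case (elim K)
        show ?case
        proof
          fix x assume x: "x \<in> X"
          have "K \<le> n * K" using n0 by simp
          then have NK: "N0 \<le> n * K" using elim(2) by linarith
          let ?U = "1 / real (n * K) * ln (mat_norm (cocycle n f A (n * K) x))"
          have triangle: "\<bar>b - a\<bar> < e" if "\<bar>v - a\<bar> < e / 2" "\<bar>v - b\<bar> \<le> E K" for a b v
            using that elim(1) by linarith
          have "real n * \<bar>?U - L x\<bar> < real n * (e / (2 * real n))"
            using N0[OF NK x] n0 by (intro mult_strict_left_mono) auto
          then have *: "\<bar>real n * ?U - real n * L x\<bar> < e / 2"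
            unfolding right_diff_distrib[symmetric] abs_mult using n0 by simp
          have "0 < K" using elim(2) by simp
          show "dist (W K x) (real n * L x) < e"
            unfolding dist_real_def by (rule triangle[OF * approx[OF x \<open>0 < K\<close>]])
        qed
      qed
    qed
    have "continuous_on X (W K)" for K
      unfolding W_def by (rule continuous_on_compose2[OF w_cont g_cont]) simp
    moreover have "(\<lambda>K. W K (f x) - W K x) \<longlonglongrightarrow> 0" if x: "x \<in> X" for x
    proof (rule Lim_null_comparison[OF always_eventually])
      show "\<forall>K. norm (W K (f x) - W K x) \<le> R * (2 * B / real K)"
      proof
        fix K
        have "norm (W K (f x) - W K x) \<le> R * norm (g K (f x) - \<omega> * g K x)"
          unfolding W_def w_rot[of "g K x", symmetric] real_norm_def by (rule w_lip)
        also have "\<dots> \<le> R * (2 * B / real K)" using R by (intro mult_left_mono g_f x) simp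
        finally show "norm (W K (f x) - W K x) \<le> R * (2 * B / real K)" .
      qed
      show "(\<lambda>K. R * (2 * B / real K)) \<longlonglongrightarrow> 0" by real_asymp
    qed
    ultimately obtain c where c: "uniform_limit X W (\<lambda>_. c) sequentially" using limit_const[OF limW] by blast
    \<comment> \<open>The averages at the extremal points \<open>xs\<close> tend to
      \<open>z0\<close> along \<open>r\<close>, so this value is the constant
      \<open>c\<close>.\<close>
    have "w z0 = R\<^sup>2"
    proof (rule antisym)
      show "w z0 \<le> R\<^sup>2"
        unfolding w_def
      proof (subst Max_le_iff)
        show "\<forall>a\<in>(\<lambda>i. Re (cnj z0 * (\<omega> ^ i * z0))) ` {..<n}. a \<le> R\<^sup>2"
        proof
          fix a assume "a \<in> (\<lambda>i. Re (cnj z0 * (\<omega> ^ i * z0))) ` {..<n}"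
          then obtain i where "a = Re (cnj z0 * (\<omega> ^ i * z0))" by blast
          then have "a \<le> norm (cnj z0 * (\<omega> ^ i * z0))" by (simp only: complex_Re_le_cmod)
          then show "a \<le> R\<^sup>2" unfolding norm_mult \<omega>_norm complex_mod_cnj R_def by (simp add: power2_eq_square)
        qed
      qed (use n0 in auto)
      have "Re (cnj z0 * (\<omega> ^ 0 * z0)) \<le> w z0"
        unfolding w_def by (rule Max_ge, simp, rule imageI[of 0]) (use n0 in simp)
      moreover have "Re (cnj z0 * (\<omega> ^ 0 * z0)) = R\<^sup>2"
        unfolding R_def by (simp add: cmod_power2) (simp add: power2_eq_square)
      ultimately show "R\<^sup>2 \<le> w z0" by simp
    qed
    have r_top: "filterlim (\<lambda>i. Suc (r i)) at_top sequentially"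
      using filterlim_compose[OF filterlim_Suc filterlim_subseq[OF r]] .
    have "(\<lambda>i. W (Suc (r i)) (xs (r i))) \<longlonglongrightarrow> w z0"
      unfolding W_def using continuous_on_tendsto_compose[OF w_cont lim] by simp
    moreover have "(\<lambda>i. W (Suc (r i)) (xs (r i))) \<longlonglongrightarrow> c"
    proof (rule metric_LIMSEQ_I)
      fix e :: real assume "0 < e"
      then have "\<forall>\<^sub>F i in sequentially. \<forall>x\<in>X. dist (W (Suc (r i)) x) c < e"
        using eventually_compose_filterlim[OF uniform_limitD[OF c] r_top] by blast
      then show "\<exists>i0. \<forall>i\<ge>i0. dist (W (Suc (r i)) (xs (r i))) c < e"
        unfolding eventually_sequentially using xs(1) by blast
    qed
    ultimately have cR: "c = R\<^sup>2" using LIMSEQ_unique \<open>w z0 = R\<^sup>2\<close> by force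
    define S where "S = (\<lambda>i. cnj (\<omega> ^ i) * z0) ` {..<n}"
    have finS: "finite S" by (simp add: S_def)
    \<comment> \<open>Distances between distinct rotates of \<open>z0\<close>, together with the
      distance \<open>R * norm (1 - \<omega>)\<close> by which \<open>\<omega>\<close> moves each of
      them. A quarter of the minimum keeps the balls disjoint and too small for the
      rotation.\<close>
    define D where "D = insert (R * norm (1 - \<omega>)) ((\<lambda>(p, q). dist p q) ` {(p, q) \<in> S \<times> S. p \<noteq> q})"
    have finD: "finite D" unfolding D_def using finS by (auto intro: finite_subset[of _ "S \<times> S"])
    have "0 < d" if "d \<in> D" for d using that R \<omega>ne unfolding D_def by auto
    moreover have "Min D \<in> D" using finD by (intro Min_in) (auto simp: D_def)
    ultimately have Dpos: "0 < Min D" by blast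
    define e where "e = Min D / 4"
    have e: "0 < e" using Dpos by (simp add: e_def)
    have eR: "4 * e \<le> R * norm (1 - \<omega>)" unfolding e_def using finD by (simp add: D_def)
    have eS: "4 * e \<le> dist p q" if "p \<in> S" "q \<in> S" "p \<noteq> q" for p q
    proof -
      have "dist p q \<in> D" unfolding D_def using that by force
      then show ?thesis unfolding e_def using Min_le[OF finD] by simp
    qed
    \<comment> \<open>Chosen for the estimate of \<open>(norm (y - z0))\<^sup>2\<close> below, where
      \<open>\<epsilon> * (2 * R + 2 + \<epsilon>)\<close> has to stay below
      \<open>e\<^sup>2\<close>.\<close>
    define \<epsilon> where "\<epsilon> = min 1 (e\<^sup>2 / (2 * R + 4))"
    have \<epsilon>: "0 < \<epsilon>" "\<epsilon> \<le> 1" "\<epsilon> * (2 * R + 4) \<le> e\<^sup>2"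
    proof -
      show "0 < \<epsilon>" "\<epsilon> \<le> 1" using e R by (auto simp: \<epsilon>_def)
      have "\<epsilon> \<le> e\<^sup>2 / (2 * R + 4)" unfolding \<epsilon>_def by (rule min.cobounded2)
      then show "\<epsilon> * (2 * R + 4) \<le> e\<^sup>2" using R by (simp add: pos_le_divide_eq)
    qed
    have "\<forall>\<^sub>F i in sequentially. \<forall>x\<in>X. dist (W (Suc (r i)) x) c < \<epsilon>"
      using eventually_compose_filterlim[OF uniform_limitD[OF c \<epsilon>(1)] r_top] .
    moreover have "\<forall>\<^sub>F i in sequentially. norm (g (Suc (r i)) (xs (r i))) < R + \<epsilon>"
      using order_tendstoD(2)[OF tendsto_norm[OF lim], of "R + \<epsilon>"] \<epsilon>(1) by (simp add: R_def)
    moreover have "\<forall>\<^sub>F i in sequentially. 2 * B / real (Suc (r i)) < e"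
    proof -
      have "(\<lambda>K. 2 * B / real K) \<longlonglongrightarrow> 0" by real_asymp
      from order_tendstoD(2)[OF filterlim_compose[OF this r_top] e] show ?thesis .
    qed
    ultimately have "\<forall>\<^sub>F i in sequentially. (\<forall>x\<in>X. dist (W (Suc (r i)) x) c < \<epsilon>)
        \<and> norm (g (Suc (r i)) (xs (r i))) < R + \<epsilon> \<and> 2 * B / real (Suc (r i)) < e"
      by eventually_elim blast
    then obtain i where i: "\<And>x. x \<in> X \<Longrightarrow> dist (W (Suc (r i)) x) c < \<epsilon>"
      "norm (g (Suc (r i)) (xs (r i))) < R + \<epsilon>" "2 * B / real (Suc (r i)) < e"
      unfolding eventually_sequentially by blast
    define K where "K = Suc (r i)"
    have near: "\<exists>p\<in>S. g K x \<in> ball p e" if x: "x \<in> X" for x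
    proof -
      have "w (g K x) \<in> (\<lambda>i. Re (cnj z0 * (\<omega> ^ i * g K x))) ` {..<n}"
        unfolding w_def using ne' by (intro Max_in) auto
      then obtain m where m: "m < n" "w (g K x) = Re (cnj z0 * (\<omega> ^ m * g K x))" by auto
      define y where "y = \<omega> ^ m * g K x"
      have y1: "R\<^sup>2 - \<epsilon> < Re (cnj z0 * y)"
        using i(1)[OF x] m(2) unfolding W_def K_def[symmetric] y_def cR dist_real_def by linarith
      have "norm y \<le> norm (g K (xs (r i)))" unfolding y_def norm_mult \<omega>_norm K_def using xs(2)[OF x] by simp
      then have "norm y \<le> R + \<epsilon>" using i(2) unfolding K_def by linarith
      then have y2: "(norm y)\<^sup>2 \<le> (R + \<epsilon>)\<^sup>2" by (intro power_mono) auto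
      \<comment> \<open>The modulus of \<open>y\<close> is at most \<open>R + \<epsilon>\<close>,
        while its product with \<open>cnj z0\<close> has real part almost \<open>R\<^sup>2\<close>.
        Expanding the square shows that only points near \<open>z0\<close> satisfy both.\<close>
      have "(norm (y - z0))\<^sup>2 = (norm y)\<^sup>2 + R\<^sup>2 - 2 * Re (cnj z0 * y)"
        unfolding R_def cmod_power2 by (simp add: power2_eq_square algebra_simps)
      also have "\<dots> < (R + \<epsilon>)\<^sup>2 + R\<^sup>2 - 2 * (R\<^sup>2 - \<epsilon>)" using y1 y2 by argo
      also have "\<dots> = \<epsilon> * (2 * R + 2 + \<epsilon>)" by (simp add: power2_eq_square algebra_simps)
      also have "\<dots> \<le> \<epsilon> * (2 * R + 4)" using \<epsilon> by (intro mult_left_mono) auto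
      also have "\<dots> \<le> e\<^sup>2" by (rule \<epsilon>)
      finally have "norm (y - z0) < e" using e by (intro power2_less_imp_less[of _ e]) auto
      moreover have "cnj (\<omega> ^ m) * y = g K x"
        unfolding y_def mult.assoc[symmetric] cnj_mult_unit(2)[OF \<omega>_norm] by simp
      then have "norm (g K x - cnj (\<omega> ^ m) * z0) = norm (y - z0)"
        by (metis (no_types) right_diff_distrib norm_mult complex_mod_cnj \<omega>_norm mult_1)
      ultimately have "g K x \<in> ball (cnj (\<omega> ^ m) * z0) e" by (simp add: dist_norm norm_minus_commute)
      then show ?thesis unfolding S_def using m(1) by blast
    qed
    obtain x where x: "x \<in> X" using ne by blast
    obtain p where p: "p \<in> S" "g K x \<in> ball p e" using near[OF x] by blast
    have "g K ` X \<subseteq> ball p e"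
    proof (rule connected_near_finite[OF _ _ _ _ p(2,1)])
      show "connected (g K ` X)" by (rule connected_continuous_image[OF g_cont conn])
      show "g K ` X \<subseteq> (\<Union>p\<in>S. ball p e)" using near by blast
      show "2 * e \<le> dist p q" if "p \<in> S" "q \<in> S" "p \<noteq> q" for p q using eS[OF that] e by linarith
      show "g K x \<in> g K ` X" using x by blast
    qed
    then have "g K x \<in> ball p e" "g K (f x) \<in> ball p e" using x f_in[OF x] by blast+
    then have b: "norm (p - g K x) < e" "norm (p - g K (f x)) < e" by (simp_all add: dist_norm)
    have "norm (\<omega> * g K x - \<omega> * p) = norm (p - g K x)"
      unfolding right_diff_distrib[symmetric] norm_mult \<omega>1 by (simp add: norm_minus_commute)
    moreover have "norm (g K (f x) - \<omega> * g K x) < e" using g_f[OF x, of K] i(3) unfolding K_def by linarith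
    moreover have "norm (p - \<omega> * p) = R * norm (1 - \<omega>)"
    proof -
      obtain m where "p = cnj (\<omega> ^ m) * z0" using p(1) unfolding S_def by blast
      then have "norm p = R" by (simp only: norm_mult complex_mod_cnj \<omega>_norm R_def mult_1)
      moreover have "p - \<omega> * p = p * (1 - \<omega>)" by (simp add: algebra_simps)
      ultimately show ?thesis by (simp add: norm_mult)
    qed
    \<comment> \<open>Both averages lie within \<open>e\<close> of \<open>p\<close>, and
      \<open>f\<close> acts on them as \<open>\<omega>\<close> up to \<open>e\<close>. Hence
      \<open>\<omega>\<close> would move \<open>p\<close> by less than \<open>3 * e\<close>,
      although it moves it by at least \<open>4 * e\<close>.\<close>
    moreover have "norm (p - \<omega> * p) \<le> norm (p - g K (f x)) + norm (g K (f x) - \<omega> * g K x) + norm (\<omega> * g K x - \<omega> * p)"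
      using norm_triangle_ineq[of "p - g K (f x)" "g K (f x) - \<omega> * p"]
        norm_triangle_ineq[of "g K (f x) - \<omega> * g K x" "\<omega> * g K x - \<omega> * p"] by simp
    ultimately show False using b eR e by linarith
  qed
  with AGL n show ?thesis by blast
qed

end

section \<open>Iterates of an invariant measure and the two classes\<close>

lemma funpow_distr:
  assumes f: "f \<in> M \<rightarrow>\<^sub>M M" and inv: "distr M M f = M"
  shows "distr M M (f ^^ n) = M"
proof (induction n)
  case 0
  show ?case by (simp add: id_def distr_id2)
next
  case (Suc n)
  have fn: "f ^^ n \<in> M \<rightarrow>\<^sub>M M"
  proof (induction n)
    case (Suc n)
    then show ?case using measurable_comp[OF Suc f] by (simp only: funpow.simps)
  qed (simp add: id_def)
  have "distr M M (f \<circ> f ^^ n) = distr (distr M M (f ^^ n)) M f" using distr_distr[OF f fn] by simp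
  then show ?case using Suc inv by (simp only: funpow.simps)
qed

theorem theorem1:
  fixes X :: "'a::metric_space set" and f :: "'a \<Rightarrow> 'a"
  assumes "dynamical_system X f"
    and "uniquely_ergodic X f"
    and "minimal_system X f"
    and "connected X"
    and "\<not> totally_uniquely_ergodic X f \<or>
         (totally_uniquely_ergodic X f \<and> \<not> topologically_weakly_mixing X f)"
  shows "\<exists>m\<ge>2. \<exists>A\<in>continuous_GL X m. \<not> uniform_cocycle X f m A"
proof -
  have X: "compact X" "continuous_on X f" "f ` X \<subseteq> X"
    using assms(1) unfolding dynamical_system_def homeomorphism_def by auto
  interpret minimal_map X f using X assms(3) by unfold_locales
  obtain M where M: "invariant_prob_measures X f = {M}"
    using assms(2) unfolding uniquely_ergodic_def by blast
  then have inv: "prob_space M" "sets M = sets (restrict_space borel X)" "distr M M f = M"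
    unfolding invariant_prob_measures_def by blast+
  show ?thesis
  proof (cases "totally_uniquely_ergodic X f")
    case False
    then obtain n where n: "1 \<le> n" "invariant_prob_measures X (f ^^ n) \<noteq> {M}"
      using M unfolding totally_uniquely_ergodic_def by blast
    have "M \<in> invariant_prob_measures X (f ^^ n)"
      unfolding invariant_prob_measures_def
      using inv funpow_distr[OF measurable_self_map[OF inv(2) X(2,3)] inv(3)] by blast
    then obtain \<nu> where \<nu>: "\<nu> \<in> invariant_prob_measures X (f ^^ n)" "\<nu> \<noteq> M" using n(2) by blast
    have "distr \<nu> \<nu> f \<noteq> \<nu>"
    proof
      assume "distr \<nu> \<nu> f = \<nu>"
      then have "\<nu> \<in> invariant_prob_measures X f" using \<nu>(1) unfolding invariant_prob_measures_def by blast
      then show False using M \<nu>(2) by blast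
    qed
    then show ?thesis using non_uniform_of_power_measure[OF assms(4) n(1) \<nu>(1)] by blast
  next
    case True
    interpret P: prob_space M by fact
    interpret minimal_measure X f M
      using X inv by unfold_locales auto
    show ?thesis using non_uniform_of_not_weakly_mixing[OF assms(4)] assms(5) True by blast
  qed
qed

end
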